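(* A parabolic subalgebra $\mathfrak p\subset so(7)$ (containing $\mathfrak b$) has a finite branching problem over $i(\mathrm{Lie}\,G_2)$ if and only if $\mathfrak p=\mathfrak p_{(1,0,0)}$ or $\mathfrak p=\mathfrak p_{(0,0,0)}=so(7)$.
   Context: The base field is $\mathbb C$. $\mathfrak g=so(7)$ has a fixed Cartan subalgebra $\mathfrak h$ and Borel subalgebra $\mathfrak b\supset\mathfrak h$ with simple roots $\eta_1=\varepsilon_1-\varepsilon_2$, $\eta_2=\varepsilon_2-\varepsilon_3$, $\eta_3=\varepsilon_3$ and Chevalley generators $g_{\pm1},g_{\pm2},g_{\pm3}$ for $\pm\eta_1,\pm\eta_2,\pm\eta_3$. $\bar{\mathfrak g}=\mathrm{Lie}\,G_2$ is the simple Lie algebra of type $G_2$ with short simple root $\alpha_1$, long simple root $\alpha_2$, and Chevalley generators $\bar g_{\pm1},\bar g_{\pm2}$ for $\pm\alpha_1,\pm\alpha_2$; $\bar{\mathfrak h}$ and $\bar{\mathfrak b}$ are the corresponding Cartan and Borel subalgebras. The embedding $i:\mathrm{Lie}\,G_2\hookrightarrow so(7)$ is determined by $i(\bar g_{\pm2})=g_{\pm2}$, $i(\bar g_{\pm1})=g_{\pm1}+g_{\pm3}$; it satisfies $i(\bar{\mathfrak h})\subset\mathfrak h$ and $i(\bar{\mathfrak b})\subset\mathfrak b$. All parabolic subalgebras of $so(7)$ are assumed to contain $\mathfrak b$; for $(a_1,a_2,a_3)\in\{0,1\}^3$, $\mathfrak p_{(a_1,a_2,a_3)}\supset\mathfrak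 b$ is the parabolic subalgebra for which $\eta_j$ is a root of the nilradical if $a_j=1$ and a root of the Levi part if $a_j=0$. For a parabolic $\mathfrak p\supset\mathfrak b$ let $\bar{\mathfrak p}:=i^{-1}(i(\bar{\mathfrak g})\cap\mathfrak p)$; $\mathfrak l\supset\mathfrak h$, $\bar{\mathfrak l}\supset\bar{\mathfrak h}$ are the Levi parts of $\mathfrak p,\bar{\mathfrak p}$, and $\mathfrak n_-,\bar{\mathfrak n}_-$ the nilradicals opposite to their nilradicals $\mathfrak n,\bar{\mathfrak n}$. Modules over $\mathfrak l$ are modules over $\bar{\mathfrak l}$ via $i$, and $\mathfrak n_-$ is an $\bar{\mathfrak l}$-module under $\mathrm{ad}\circ i$. $V_\lambda(\mathfrak l)$, $V_\mu(\bar{\mathfrak l})$ are the irreducible finite-dimensional modules of highest weights $\lambda\in\mathfrak h^*$, $\mu\in\bar{\mathfrak h}^*$ (when they exist). Let $N$ be any $\bar{\mathfrak l}$-submodule of $\mathfrak n_-$ isomorphic to $\bar{\mathfrak n}_-$ (one exists), and $m(\mu,\lambda):=\dim\mathrm{Hom}_{\bar{\mathfrak l}}(V_\mu(\bar{\mathfrak l}),V_\lambda(\mathfrak l)\otimes S^\star(\mathfrak n_-/N))$ with $S^\star$ the symmetric tensor algebra. $\mathfrak p$ has a finite branching problem over $i(\bar{\mathfrak g})$ if for each $\lambda\in\mathfrak h^*$ (with $V_\lambda(\mathfrak l)$ finite-dimensional) there are only finitely many $\mu\in\bar{\mathfrak h}^*$ with $m(\mu,\lambda)\ne0$. (This is taken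 to be equivalent to $M_\lambda(\mathfrak g,\mathfrak p)=U(\mathfrak g)\otimes_{U(\mathfrak p)}V_\lambda(\mathfrak l)$ having a finite Jordan-Hölder series as a $\bar{\mathfrak g}$-module, and to $\dim\mathfrak n=\dim\bar{\mathfrak n}$.) *)

theory Defs
  imports
    "HOL-Analysis.Analysis"
    "HOL-Library.Poly_Mapping"
    "HOL-Library.Function_Algebras"
    "HOL-Library.Multiset"
    "HOL-Library.Extended_Nat"
begin

section \<open>Linear maps on subspaces\<close>

definition linear_on ::
  "(complex \<Rightarrow> 'a \<Rightarrow> 'a) \<Rightarrow> (complex \<Rightarrow> 'b \<Rightarrow> 'b) \<Rightarrow> 'a::ab_group_add set \<Rightarrow> ('a \<Rightarrow> 'b::ab_group_add) \<Rightarrow> bool"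
where
  "linear_on s1 s2 S f \<longleftrightarrow>
     (\<forall>x\<in>S. \<forall>y\<in>S. f (x + y) = f x + f y) \<and> (\<forall>c. \<forall>x\<in>S. f (s1 c x) = s2 c (f x))"

text \<open>The dimension of a subspace, with value \<open>\<infinity>\<close> (and not 0) in the infinite-dimensional case.\<close>

definition edim :: "(complex \<Rightarrow> 'a \<Rightarrow> 'a) \<Rightarrow> 'a::ab_group_add set \<Rightarrow> enat" where
  "edim s S = (if \<exists>B. finite B \<and> S \<subseteq> module.span s B then enat (vector_space.dim s S) else \<infinity>)"


section \<open>Spaces with a basis, tensor products, symmetric algebras\<close>

text \<open>
  \<open>'i \<Rightarrow>\<^sub>0 complex\<close> is the complex vector space with basis \<open>Poly_Mapping.single i 1\<close>.
  The tensor product of the spaces with bases \<open>'i\<close> and \<open>'j\<close> is the space with basis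
  \<open>'i \<times> 'j\<close>. The symmetric algebra of the space with basis \<open>'i\<close> is the polynomial ring in
  the variables \<open>'i\<close>: the monomials are the finite multisets over \<open>'i\<close>, and the product is
  the convolution product of \<open>'i multiset \<Rightarrow>\<^sub>0 complex\<close>.
\<close>

definition pm_scale :: "complex \<Rightarrow> ('i \<Rightarrow>\<^sub>0 complex) \<Rightarrow> ('i \<Rightarrow>\<^sub>0 complex)" where
  "pm_scale c = Poly_Mapping.map ((*) c)"

lemma lookup_pm_scale: "Poly_Mapping.lookup (pm_scale c f) i = c * Poly_Mapping.lookup f i"
  by (simp add: pm_scale_def Poly_Mapping.map.rep_eq when_def)

interpretation pm: vector_space "pm_scale :: complex \<Rightarrow> ('i \<Rightarrow>\<^sub>0 complex) \<Rightarrow> _"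
  by unfold_locales (rule poly_mapping_eqI, simp add: lookup_pm_scale lookup_add algebra_simps)+

definition lin_ext :: "('i \<Rightarrow> ('j \<Rightarrow>\<^sub>0 complex)) \<Rightarrow> ('i \<Rightarrow>\<^sub>0 complex) \<Rightarrow> ('j \<Rightarrow>\<^sub>0 complex)" where
  "lin_ext b f = (\<Sum>i\<in>Poly_Mapping.keys f. pm_scale (Poly_Mapping.lookup f i) (b i))"

definition tensor :: "('i \<Rightarrow>\<^sub>0 complex) \<Rightarrow> ('j \<Rightarrow>\<^sub>0 complex) \<Rightarrow> ('i \<times> 'j \<Rightarrow>\<^sub>0 complex)" where
  "tensor u v = lin_ext (\<lambda>i. lin_ext (\<lambda>j. Poly_Mapping.single (i, j) 1) v) u"

definition sym_incl :: "('i \<Rightarrow>\<^sub>0 complex) \<Rightarrow> ('i multiset \<Rightarrow>\<^sub>0 complex)" where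
  "sym_incl = lin_ext (\<lambda>i. Poly_Mapping.single {#i#} 1)"

text \<open>\<open>D \<otimes> 1 + 1 \<otimes> E\<close>, and the derivation of the symmetric algebra extending \<open>D\<close>,
  both given on basis vectors.\<close>

definition tensor_act ::
  "(('i \<Rightarrow>\<^sub>0 complex) \<Rightarrow> ('i \<Rightarrow>\<^sub>0 complex)) \<Rightarrow> (('j \<Rightarrow>\<^sub>0 complex) \<Rightarrow> ('j \<Rightarrow>\<^sub>0 complex)) \<Rightarrow>
   ('i \<times> 'j \<Rightarrow>\<^sub>0 complex) \<Rightarrow> ('i \<times> 'j \<Rightarrow>\<^sub>0 complex)"
where
  "tensor_act D E = lin_ext (\<lambda>(i, j).
     tensor (D (Poly_Mapping.single i 1)) (Poly_Mapping.single j 1) +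
     tensor (Poly_Mapping.single i 1) (E (Poly_Mapping.single j 1)))"

definition sym_act ::
  "(('i \<Rightarrow>\<^sub>0 complex) \<Rightarrow> ('i \<Rightarrow>\<^sub>0 complex)) \<Rightarrow>
   ('i multiset \<Rightarrow>\<^sub>0 complex) \<Rightarrow> ('i multiset \<Rightarrow>\<^sub>0 complex)"
where
  "sym_act D = lin_ext (\<lambda>M.
     \<Sum>i\<in>#M. Poly_Mapping.single (M - {#i#}) 1 * sym_incl (D (Poly_Mapping.single i 1)))"

text \<open>\<open>\<complex>\<^sup>d\<close>, and \<open>\<complex>\<^sup>d \<otimes> S(\<complex>\<^sup>r)\<close>. Finite-dimensional modules are taken on the
  spaces \<open>coord d\<close>.\<close>

definition coord :: "nat \<Rightarrow> (nat \<Rightarrow>\<^sub>0 complex) set" where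
  "coord d = {v. Poly_Mapping.keys v \<subseteq> {..<d}}"

definition coord_tensor_sym :: "nat \<Rightarrow> nat \<Rightarrow> (nat \<times> nat multiset \<Rightarrow>\<^sub>0 complex) set" where
  "coord_tensor_sym d r = {t. Poly_Mapping.keys t \<subseteq> {..<d} \<times> {M. set_mset M \<subseteq> {..<r}}}"

text \<open>Homomorphisms of \<open>L\<close>-modules from \<open>V\<close> to \<open>W\<close>; to make the space of such maps independent
  of values off \<open>V\<close>, these values are set to 0.\<close>

definition module_homs ::
  "'g set \<Rightarrow> ('i \<Rightarrow>\<^sub>0 complex) set \<Rightarrow> ('g \<Rightarrow> ('i \<Rightarrow>\<^sub>0 complex) \<Rightarrow> ('i \<Rightarrow>\<^sub>0 complex)) \<Rightarrow>
   ('j \<Rightarrow>\<^sub>0 complex) set \<Rightarrow> ('g \<Rightarrow> ('j \<Rightarrow>\<^sub>0 complex) \<Rightarrow> ('j \<Rightarrow>\<^sub>0 complex)) \<Rightarrow>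
   (('i \<Rightarrow>\<^sub>0 complex) \<Rightarrow> ('j \<Rightarrow>\<^sub>0 complex)) set"
where
  "module_homs L V act W act' = {f. linear_on pm_scale pm_scale V f \<and> f ` V \<subseteq> W \<and>
     (\<forall>x\<in>L. \<forall>v\<in>V. f (act x v) = act' x (f v)) \<and> (\<forall>v. v \<notin> V \<longrightarrow> f v = 0)}"


section \<open>Lie algebras\<close>

locale lie_algebra = vector_space scale
  for scale :: "complex \<Rightarrow> 'a::ab_group_add \<Rightarrow> 'a" +
  fixes br :: "'a \<Rightarrow> 'a \<Rightarrow> 'a"
  assumes br_add_left: "br (x + y) z = br x z + br y z"
    and br_add_right: "br x (y + z) = br x y + br x z"
    and br_scale_left: "br (scale c x) y = scale c (br x y)"
    and br_scale_right: "br x (scale c y) = scale c (br x y)"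
    and br_self: "br x x = 0"
    and jacobi: "br x (br y z) + br y (br z x) + br z (br x y) = 0"
begin

definition subalgebra :: "'a set \<Rightarrow> bool" where
  "subalgebra S \<longleftrightarrow> subspace S \<and> (\<forall>x\<in>S. \<forall>y\<in>S. br x y \<in> S)"

definition simple_fd :: bool where
  "simple_fd \<longleftrightarrow> (\<exists>B. finite B \<and> span B = UNIV) \<and> (\<exists>x y. br x y \<noteq> 0) \<and>
     (\<forall>I. subspace I \<and> (\<forall>x. \<forall>y\<in>I. br x y \<in> I) \<longrightarrow> I = {0} \<or> I = UNIV)"

text \<open>Elements of \<open>H\<^sup>*\<close> are extended by 0 off \<open>H\<close>.\<close>

definition dual :: "'a set \<Rightarrow> ('a \<Rightarrow> complex) set" where
  "dual H = {\<mu>. linear_on scale (*) H \<mu> \<and> (\<forall>x. x \<notin> H \<longrightarrow> \<mu> x = 0)}"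

text \<open>Below, \<open>G\<close> is a subalgebra and \<open>H \<subseteq> G\<close> a Cartan subalgebra of it; the simple roots are
  \<open>\<alpha> k\<close> for \<open>k \<in> K\<close>.\<close>

definition root_space :: "'a set \<Rightarrow> 'a set \<Rightarrow> ('a \<Rightarrow> complex) \<Rightarrow> 'a set" where
  "root_space G H \<beta> = {x\<in>G. \<forall>h\<in>H. br h x = scale (\<beta> h) x}"

definition roots :: "'a set \<Rightarrow> 'a set \<Rightarrow> ('a \<Rightarrow> complex) set" where
  "roots G H = {\<beta>\<in>dual H. \<beta> \<noteq> (\<lambda>_. 0) \<and> root_space G H \<beta> \<noteq> {0}}"

definition borel :: "'a set \<Rightarrow> 'a set \<Rightarrow> nat set \<Rightarrow> (nat \<Rightarrow> 'a \<Rightarrow> complex) \<Rightarrow> 'a set" where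
  "borel G H K \<alpha> = span (H \<union> (\<Union>\<beta>\<in>{\<beta>\<in>roots G H.
     \<exists>n. \<beta> = (\<lambda>x. \<Sum>k\<in>K. of_nat (n k) * \<alpha> k x)}. root_space G H \<beta>))"

text \<open>\<open>g k\<close> and \<open>g (- k)\<close> are the generators belonging to \<open>\<alpha> k\<close> and \<open>- \<alpha> k\<close>.\<close>

definition chevalley_generators ::
  "'a set \<Rightarrow> 'a set \<Rightarrow> nat set \<Rightarrow> (nat \<Rightarrow> 'a \<Rightarrow> complex) \<Rightarrow> (int \<Rightarrow> 'a) \<Rightarrow> bool"
where
  "chevalley_generators G H K \<alpha> g \<longleftrightarrow>
     (\<forall>k\<in>K. g (int k) \<in> root_space G H (\<alpha> k) \<and> g (- int k) \<in> root_space G H (- \<alpha> k) \<and>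
        br (g (int k)) (g (- int k)) \<in> H \<and> \<alpha> k (br (g (int k)) (g (- int k))) = 2) \<and>
     (\<forall>k\<in>K. \<forall>l\<in>K. k \<noteq> l \<longrightarrow> br (g (int k)) (g (- int l)) = 0)"

text \<open>For a parabolic \<open>P\<close> containing \<open>H\<close>: the Levi part containing \<open>H\<close>, the nilradical, and the
  nilradical of the opposite parabolic.\<close>

definition levi :: "'a set \<Rightarrow> 'a set \<Rightarrow> 'a set \<Rightarrow> 'a set" where
  "levi G H P = span (H \<union> (\<Union>\<beta>\<in>{\<beta>\<in>roots G H.
     root_space G H \<beta> \<subseteq> P \<and> root_space G H (- \<beta>) \<subseteq> P}. root_space G H \<beta>))"

definition nilrad :: "'a set \<Rightarrow> 'a set \<Rightarrow> 'a set \<Rightarrow> 'a set" where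
  "nilrad G H P = span (\<Union>\<beta>\<in>{\<beta>\<in>roots G H.
     root_space G H \<beta> \<subseteq> P \<and> \<not> root_space G H (- \<beta>) \<subseteq> P}. root_space G H \<beta>)"

definition opp_nilrad :: "'a set \<Rightarrow> 'a set \<Rightarrow> 'a set \<Rightarrow> 'a set" where
  "opp_nilrad G H P = span (\<Union>\<beta>\<in>{\<beta>\<in>roots G H.
     root_space G H \<beta> \<subseteq> P \<and> \<not> root_space G H (- \<beta>) \<subseteq> P}. root_space G H (- \<beta>))"

definition fd_module :: "'a set \<Rightarrow> nat \<Rightarrow> ('a \<Rightarrow> (nat \<Rightarrow>\<^sub>0 complex) \<Rightarrow> (nat \<Rightarrow>\<^sub>0 complex)) \<Rightarrow> bool" where
  "fd_module L d act \<longleftrightarrow>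
     (\<forall>x\<in>L. act x ` coord d \<subseteq> coord d \<and> linear_on pm_scale pm_scale (coord d) (act x)) \<and>
     (\<forall>v\<in>coord d. linear_on scale pm_scale L (\<lambda>x. act x v)) \<and>
     (\<forall>x\<in>L. \<forall>y\<in>L. \<forall>v\<in>coord d. act (br x y) v = act x (act y v) - act y (act x v))"

definition irreducible_module ::
  "'a set \<Rightarrow> nat \<Rightarrow> ('a \<Rightarrow> (nat \<Rightarrow>\<^sub>0 complex) \<Rightarrow> (nat \<Rightarrow>\<^sub>0 complex)) \<Rightarrow> bool"
where
  "irreducible_module L d act \<longleftrightarrow> fd_module L d act \<and> d \<noteq> 0 \<and>
     (\<forall>W. pm.subspace W \<and> W \<subseteq> coord d \<and> (\<forall>x\<in>L. act x ` W \<subseteq> W) \<longrightarrow> W = {0} \<or> W = coord d)"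

text \<open>\<open>act\<close> makes \<open>\<complex>\<^sup>d\<close> into \<open>V\<^sub>\<Lambda>(L)\<close>, where \<open>L \<supseteq> H\<close> is a Levi part and \<open>B \<supseteq> H\<close> is the Borel
  subalgebra of \<open>G\<close>; a highest weight vector is annihilated by the positive root spaces of \<open>L\<close>.\<close>

definition highest_weight_module ::
  "'a set \<Rightarrow> 'a set \<Rightarrow> 'a set \<Rightarrow> 'a set \<Rightarrow> ('a \<Rightarrow> complex) \<Rightarrow> nat \<Rightarrow>
   ('a \<Rightarrow> (nat \<Rightarrow>\<^sub>0 complex) \<Rightarrow> (nat \<Rightarrow>\<^sub>0 complex)) \<Rightarrow> bool"
where
  "highest_weight_module G H B L \<Lambda> d act \<longleftrightarrow> irreducible_module L d act \<and>
     (\<exists>v\<in>coord d. v \<noteq> 0 \<and> (\<forall>h\<in>H. act h v = pm_scale (\<Lambda> h) v) \<and>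
        (\<forall>x\<in>L \<inter> nilrad G H B. act x v = 0))"

end


section \<open>The Lie algebra so(7)\<close>

definition mat_scale :: "complex \<Rightarrow> complex^7^7 \<Rightarrow> complex^7^7" where
  "mat_scale c X = (\<chi> i j. c * X $ i $ j)"

definition commutator :: "complex^7^7 \<Rightarrow> complex^7^7 \<Rightarrow> complex^7^7" where
  "commutator X Y = X ** Y - Y ** X"

interpretation gl7: lie_algebra mat_scale commutator
proof unfold_locales
  fix X Y Z :: "complex^7^7"
  have "(A - B) ** C = A ** C - B ** C" "C ** (A - B) = C ** A - C ** B"
    for A B C :: "complex^7^7"
    by (simp_all add: vec_eq_iff matrix_matrix_mult_def sum_subtractf algebra_simps)
  then show "commutator X (commutator Y Z) + commutator Y (commutator Z X) +
      commutator Z (commutator X Y) = 0"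
    by (simp add: commutator_def matrix_mul_assoc)
qed (simp_all add: vec_eq_iff commutator_def mat_scale_def matrix_matrix_mult_def
  sum_distrib_left sum.distrib algebra_simps)

text \<open>The standard basis is indexed by \<open>1, \<dots>, 7\<close>; the type \<open>7\<close> is the ring of integers modulo 7, so
  the index 7 is 0, and \<open>i + j = 8\<close> says that \<open>j = 8 - i\<close> for representatives in \<open>1, \<dots>, 7\<close>.
  The symmetric form is \<open>(e\<^sub>i, e\<^sub>j) = 1\<close> if \<open>i + j = 8\<close>, and 0 otherwise. The diagonal matrices in
  so(7) are \<open>diag(t\<^sub>1, t\<^sub>2, t\<^sub>3, 0, -t\<^sub>3, -t\<^sub>2, -t\<^sub>1)\<close>.\<close>

definition form7 :: "complex^7^7" where
  "form7 = (\<chi> i j. if i + j = 8 then 1 else 0)"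

definition so7 :: "(complex^7^7) set" where
  "so7 = {X. transpose X ** form7 + form7 ** X = 0}"

definition cartan7 :: "(complex^7^7) set" where
  "cartan7 = {X\<in>so7. \<forall>i j. i \<noteq> j \<longrightarrow> X $ i $ j = 0}"

definition eps :: "7 \<Rightarrow> complex^7^7 \<Rightarrow> complex" where
  "eps k X = (if X \<in> cartan7 then X $ k $ k else 0)"

definition eta :: "nat \<Rightarrow> complex^7^7 \<Rightarrow> complex" where
  "eta k = (if k = 1 then eps 1 - eps 2 else if k = 2 then eps 2 - eps 3 else eps 3)"

definition borel7 :: "(complex^7^7) set" where
  "borel7 = gl7.borel so7 cartan7 {1, 2, 3} eta"

definition parabolic7 :: "(complex^7^7) set \<Rightarrow> bool" where
  "parabolic7 p \<longleftrightarrow> gl7.subalgebra p \<and> borel7 \<subseteq> p \<and> p \<subseteq> so7"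

definition std_parabolic7 :: "nat \<Rightarrow> nat \<Rightarrow> nat \<Rightarrow> (complex^7^7) set" where
  "std_parabolic7 a1 a2 a3 = (THE p. parabolic7 p \<and>
     (\<forall>(j, a) \<in> {(1, a1), (2, a2), (3, a3)}.
        (a = 1 \<longrightarrow> gl7.root_space so7 cartan7 (eta j) \<subseteq> gl7.nilrad so7 cartan7 p) \<and>
        (a = 0 \<longrightarrow> gl7.root_space so7 cartan7 (eta j) \<subseteq> gl7.levi so7 cartan7 p)))"


section \<open>The embedding of Lie G2 into so(7) and the branching problem\<close>

text \<open>The ambient Lie algebra of the locale is Lie G2, with Chevalley generators \<open>gb (\<plusminus>1)\<close>,
  \<open>gb (\<plusminus>2)\<close>, Cartan subalgebra \<open>H\<close>, short simple root \<open>\<alpha> 1\<close> and long simple root \<open>\<alpha> 2\<close>: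
  the pairing of \<open>\<alpha> 1\<close> with the coroot of \<open>\<alpha> 2\<close> is -1, that of \<open>\<alpha> 2\<close> with the coroot
  of \<open>\<alpha> 1\<close> is -3. The matrices \<open>g k\<close> are Chevalley generators of so(7).\<close>

locale G2_in_so7 = lie_algebra scale br
  for scale :: "complex \<Rightarrow> 'b::ab_group_add \<Rightarrow> 'b"
    and br :: "'b \<Rightarrow> 'b \<Rightarrow> 'b" +
  fixes H :: "'b set"
    and \<alpha> :: "nat \<Rightarrow> 'b \<Rightarrow> complex"
    and gb :: "int \<Rightarrow> 'b"
    and g :: "int \<Rightarrow> complex^7^7"
    and i :: "'b \<Rightarrow> complex^7^7"
  assumes simple: "simple_fd"
    and H_def: "H = span {br (gb 1) (gb (- 1)), br (gb 2) (gb (- 2))}"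
    and H_abelian: "\<forall>x\<in>H. \<forall>y\<in>H. br x y = 0"
    and \<alpha>_dual: "\<alpha> 1 \<in> dual H" "\<alpha> 2 \<in> dual H"
    and gb_chevalley: "chevalley_generators UNIV H {1, 2} \<alpha> gb"
    and cartan_matrix: "\<alpha> 1 (br (gb 2) (gb (- 2))) = - 1" "\<alpha> 2 (br (gb 1) (gb (- 1))) = - 3"
    and gb_generate: "subalgebra hull {gb 1, gb (- 1), gb 2, gb (- 2)} = UNIV"
    and g_chevalley: "gl7.chevalley_generators so7 cartan7 {1, 2, 3} eta g"
    and i_linear: "Vector_Spaces.linear scale mat_scale i"
    and i_br: "i (br x y) = commutator (i x) (i y)"
    and i_inj: "inj i"
    and i_range: "range i \<subseteq> so7"
    and i_gb: "i (gb 2) = g 2" "i (gb (- 2)) = g (- 2)"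
      "i (gb 1) = g 1 + g 3" "i (gb (- 1)) = g (- 1) + g (- 3)"
begin

definition borel_bar :: "'b set" where
  "borel_bar = borel UNIV H {1, 2} \<alpha>"

definition p_bar :: "(complex^7^7) set \<Rightarrow> 'b set" where
  "p_bar p = i -` (range i \<inter> p)"

definition l_bar :: "(complex^7^7) set \<Rightarrow> 'b set" where
  "l_bar p = levi UNIV H (p_bar p)"

text \<open>\<open>N\<close> is an \<open>l_bar\<close>-submodule of \<open>\<nn>\<^sub>-\<close> isomorphic to the opposite nilradical of \<open>p_bar\<close>.\<close>

definition admissible_N :: "(complex^7^7) set \<Rightarrow> (complex^7^7) set \<Rightarrow> bool" where
  "admissible_N p N \<longleftrightarrow>
     gl7.subspace N \<and> N \<subseteq> gl7.opp_nilrad so7 cartan7 p \<and>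
     (\<forall>x\<in>l_bar p. \<forall>y\<in>N. commutator (i x) y \<in> N) \<and>
     (\<exists>\<phi>. linear_on scale mat_scale (opp_nilrad UNIV H (p_bar p)) \<phi> \<and>
        bij_betw \<phi> (opp_nilrad UNIV H (p_bar p)) N \<and>
        (\<forall>x\<in>l_bar p. \<forall>y\<in>opp_nilrad UNIV H (p_bar p). \<phi> (br x y) = commutator (i x) (\<phi> y)))"

text \<open>\<open>q\<close> makes \<open>\<complex>\<^sup>r\<close> into the \<open>l_bar\<close>-module \<open>\<nn>\<^sub>- / N\<close>; \<open>\<pi>\<close> is the quotient map.\<close>

definition quotient_module ::
  "(complex^7^7) set \<Rightarrow> (complex^7^7) set \<Rightarrow> nat \<Rightarrow>
   ('b \<Rightarrow> (nat \<Rightarrow>\<^sub>0 complex) \<Rightarrow> (nat \<Rightarrow>\<^sub>0 complex)) \<Rightarrow> bool"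
where
  "quotient_module p N r q \<longleftrightarrow>
     (\<exists>\<pi>. linear_on mat_scale pm_scale (gl7.opp_nilrad so7 cartan7 p) \<pi> \<and>
        \<pi> ` gl7.opp_nilrad so7 cartan7 p = coord r \<and>
        {y\<in>gl7.opp_nilrad so7 cartan7 p. \<pi> y = 0} = N \<and>
        (\<forall>x\<in>l_bar p. \<forall>y\<in>gl7.opp_nilrad so7 cartan7 p. \<pi> (commutator (i x) y) = q x (\<pi> y)))"

text \<open>The dimension of \<open>Hom(V\<^sub>\<mu>, V\<^sub>\<Lambda> \<otimes> S(\<nn>\<^sub>- / N))\<close> over \<open>l_bar\<close>, with \<open>V\<^sub>\<mu>\<close>, \<open>V\<^sub>\<Lambda>\<close> and \<open>\<nn>\<^sub>- / N\<close> given by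
  the actions \<open>actm\<close>, \<open>actl\<close> (of \<open>\<ll>\<close>) and \<open>q\<close> on \<open>\<complex>\<^sup>e\<close>, \<open>\<complex>\<^sup>d\<close> and \<open>\<complex>\<^sup>r\<close>.\<close>

definition multiplicity ::
  "(complex^7^7) set \<Rightarrow> nat \<Rightarrow> ('b \<Rightarrow> (nat \<Rightarrow>\<^sub>0 complex) \<Rightarrow> (nat \<Rightarrow>\<^sub>0 complex)) \<Rightarrow>
   nat \<Rightarrow> (complex^7^7 \<Rightarrow> (nat \<Rightarrow>\<^sub>0 complex) \<Rightarrow> (nat \<Rightarrow>\<^sub>0 complex)) \<Rightarrow>
   nat \<Rightarrow> ('b \<Rightarrow> (nat \<Rightarrow>\<^sub>0 complex) \<Rightarrow> (nat \<Rightarrow>\<^sub>0 complex)) \<Rightarrow> enat"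
where
  "multiplicity p e actm d actl r q =
     edim (\<lambda>c f v. pm_scale c (f v))
       (module_homs (l_bar p) (coord e) actm
          (coord_tensor_sym d r) (\<lambda>x. tensor_act (actl (i x)) (sym_act (q x))))"

definition finite_branching :: "(complex^7^7) set \<Rightarrow> (complex^7^7) set \<Rightarrow> bool" where
  "finite_branching p N \<longleftrightarrow>
     (\<forall>\<Lambda> \<in> gl7.dual cartan7. \<forall>d actl r q.
        gl7.highest_weight_module so7 cartan7 borel7 (gl7.levi so7 cartan7 p) \<Lambda> d actl \<longrightarrow>
        quotient_module p N r q \<longrightarrow>
        finite {\<mu> \<in> dual H. \<exists>e actm.
          highest_weight_module UNIV H borel_bar (l_bar p) \<mu> e actm \<and>
          multiplicity p e actm d actl r q \<noteq> 0})"

end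

end

theory Submission
  imports Defs
begin

text \<open>
  A parabolic subalgebra is determined by the negatives of the simple roots that it contains, and it is the part of degree
  \<open>\<ge> 0\<close> of a grading of so(7). For \<open>\<pp>\<close> of type \<open>(1, 0, 0)\<close> and so(7) the
  weights of \<open>\<nn>\<^sub>-\<close> are simple and all of them are weights of \<open>N\<close>, so \<open>\<nn>\<^sub>-
  / N = 0\<close>, and a highest weight \<open>\<mu>\<close> with nonzero multiplicity is a joint eigenvalue on the
  finite-dimensional \<open>V\<^sub>\<Lambda>\<close>. In all other cases \<open>\<nn>\<^sub>-\<close> contains the root
  vectors of both \<open>- \<epsilon>\<^sub>1\<close> and \<open>- \<epsilon>\<^sub>2 - \<epsilon>\<^sub>3\<close>. These
  roots have the same restriction, which has multiplicity 1 in the Lie algebra of type G2, hence \<open>N \<noteq>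
  \<nn>\<^sub>-\<close>. For the trivial module \<open>V\<^sub>\<Lambda>\<close> every irreducible submodule of
  \<open>S\<^sup>n(\<nn>\<^sub>- / N)\<close> contributes a highest weight \<open>\<mu>\<close>, and \<open>\<mu>\<close>
  takes a value \<open>\<le> - n\<close> at the element of the Cartan subalgebra on which both simple roots are 1; so there
  are infinitely many \<open>\<mu>\<close>.
\<close>

section \<open>Linear algebra\<close>

text \<open>Multiplicities are defined through homomorphisms from irreducible modules on coordinate
  spaces, and complete reducibility is not invoked. To obtain infinitely many \<mu> it is enough to
  exhibit one irreducible submodule in each symmetric power: an invariant subspace of least
  dimension, transported to coordinates. Its highest weight vector comes from an extremal choice
  among monomials rather than from simultaneous diagonalisation. Heights are measured by
  \<open>h 3 5\<close>, whose image in so(7) is \<open>D 3 2 1\<close>; the simple roots of so(7)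
  take the value 1 there as well, so one integer grading serves both algebras.

  The algebra of type G2 enters abstractly. That its root spaces are large enough is seen from
  iterated brackets of the generators; that they are no larger, from linear equations for the image
  of \<open>i\<close>, whose solution space has dimension 14 and is stable under the
  generators.\<close>

lemma eigencomponents_in_invariant_subspace:
  fixes scale :: "complex \<Rightarrow> 'a::ab_group_add \<Rightarrow> 'a"
  assumes "vector_space scale"
  assumes "finite J" "inj_on c J" "module.subspace scale S" "module.subspace scale U"
    and T: "linear_on scale scale U T" "\<And>x. x \<in> S \<Longrightarrow> T x \<in> S"
    and x: "\<And>j. j \<in> J \<Longrightarrow> x j \<in> U" "\<And>j. j \<in> J \<Longrightarrow> T (x j) = scale (c j) (x j)"
    and sum: "(\<Sum>j\<in>J. x j) \<in> S"
  shows "\<forall>j\<in>J. x j \<in> S"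
proof -
  interpret vector_space scale by fact
  show ?thesis
    using \<open>finite J\<close> \<open>inj_on c J\<close> x sum
  proof (induction J arbitrary: x rule: finite_induct)
    case empty
    then show ?case by simp
  next
    case (insert a J)
    have Tsum: "T (\<Sum>j\<in>J'. x j) = (\<Sum>j\<in>J'. scale (c j) (x j))" if "finite J'" "J' \<subseteq> insert a J" for J'
      using that
    proof (induction J' rule: finite_induct)
      case empty
      have "T (scale 0 0) = scale 0 (T 0)"
        using T(1) subspace_0[OF assms(5)] unfolding linear_on_def by blast
      then show ?case by simp
    next
      case (insert b J')
      have "x b \<in> U" "(\<Sum>j\<in>J'. x j) \<in> U"
        using insert.prems insert(4) \<open>\<And>j. j \<in> insert a J \<Longrightarrow> x j \<in> U\<close>
        by (auto intro!: subspace_sum[OF assms(5)])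
      then have "T (x b + (\<Sum>j\<in>J'. x j)) = T (x b) + T (\<Sum>j\<in>J'. x j)"
        using T(1) unfolding linear_on_def by blast
      then show ?case
        using insert \<open>\<And>j. j \<in> insert a J \<Longrightarrow> T (x j) = scale (c j) (x j)\<close> by auto
    qed
    let ?s = "\<Sum>j\<in>insert a J. x j"
    \<comment> \<open>\<open>T - c a\<close> annihilates the component at \<open>a\<close> and
      multiplies the one at \<open>j\<close> by the nonzero number \<open>c j - c a\<close>, so the
      sum loses a term; dividing by these numbers undoes the rescaling.\<close>
    have "T ?s - scale (c a) ?s \<in> S"
      by (intro subspace_diff[OF assms(4)] subspace_scale[OF assms(4)] T(2) insert.prems)
    moreover have "T ?s - scale (c a) ?s = (\<Sum>j\<in>J. scale (c j - c a) (x j))"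
      using insert by (subst Tsum) (auto simp: scale_sum_right sum_subtractf scale_right_distrib scale_left_diff_distrib)
    ultimately have "(\<Sum>j\<in>J. scale (c j - c a) (x j)) \<in> S" by simp
    then have "\<forall>j\<in>J. scale (c j - c a) (x j) \<in> S"
    proof (intro insert.IH)
      show "inj_on c J" using insert.prems by auto
      fix j assume j: "j \<in> J"
      then have xj: "x j \<in> U" "T (x j) = scale (c j) (x j)" using insert.prems by auto
      then show "scale (c j - c a) (x j) \<in> U" by (auto intro: subspace_scale[OF assms(5)])
      have "T (scale (c j - c a) (x j)) = scale (c j - c a) (T (x j))"
        using T(1) xj unfolding linear_on_def by blast
      then show "T (scale (c j - c a) (x j)) = scale (c j) (scale (c j - c a) (x j))"
        by (simp add: xj mult.commute)
    qed
    then have J: "x j \<in> S" if "j \<in> J" for j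
    proof -
      have "c j \<noteq> c a" using insert that by (auto simp: inj_on_def)
      moreover have "scale (1 / (c j - c a)) (scale (c j - c a) (x j)) \<in> S"
        using \<open>\<forall>j\<in>J. _\<close> that by (intro subspace_scale[OF assms(4), of "scale (c j - c a) (x j)"]) auto
      ultimately show ?thesis by simp
    qed
    have "?s - (\<Sum>j\<in>J. x j) \<in> S"
      by (intro subspace_diff[OF assms(4)] insert.prems subspace_sum[OF assms(4)] J)
    with J insert show ?case by auto
  qed
qed

lemma (in vector_space) card_eq_dim_imp_subspace_eq:
  assumes "subspace W'" "subspace W" "W' \<subseteq> W" "finite B" "W \<subseteq> span B" "dim W' = dim W"
  shows "W' = W"
proof -
  obtain b' where b': "b' \<subseteq> W'" "independent b'" "W' \<subseteq> span b'" "card b' = dim W'"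
    using basis_exists by blast
  then have "b' \<subseteq> W" using assms by auto
  then obtain b where b: "b' \<subseteq> b" "b \<subseteq> W" "independent b" "W \<subseteq> span b"
    using maximal_independent_subset_extend b'(2) by metis
  have "finite b" using independent_span_bound[OF assms(4) b(3)] b(2) assms(5) by auto
  moreover have "card b = dim W" using basis_card_eq_dim b by blast
  ultimately have "b' = b" using b b' assms card_subset_eq by metis
  then show ?thesis using b b' assms span_minimal by blast
qed

text \<open>A nonzero invariant subspace of least dimension is minimal, because a proper subspace of
  a finite-dimensional space has smaller dimension. This supplies irreducible submodules.\<close>

lemma (in vector_space) exists_minimal_invariant_subspace:
  assumes "subspace V" "V \<noteq> {0}" "finite B" "V \<subseteq> span B" "\<And>x v. x \<in> L \<Longrightarrow> v \<in> V \<Longrightarrow> act x v \<in> V"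
  obtains W where "subspace W" "W \<subseteq> V" "W \<noteq> {0}" "\<And>x v. x \<in> L \<Longrightarrow> v \<in> W \<Longrightarrow> act x v \<in> W"
    "\<And>W'. subspace W' \<Longrightarrow> W' \<subseteq> W \<Longrightarrow> (\<And>x v. x \<in> L \<Longrightarrow> v \<in> W' \<Longrightarrow> act x v \<in> W') \<Longrightarrow> W' = {0} \<or> W' = W"
proof -
  define good where "good W \<longleftrightarrow> subspace W \<and> W \<subseteq> V \<and> W \<noteq> {0} \<and> (\<forall>x\<in>L. \<forall>v\<in>W. act x v \<in> W)" for W
  have "good V" using assms by (auto simp: good_def)
  then obtain W where W: "good W" "\<And>W'. good W' \<Longrightarrow> dim W \<le> dim W'"
    using ex_has_least_nat[of good V dim] by blast
  show ?thesis
  proof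
    show "subspace W" "W \<subseteq> V" "W \<noteq> {0}" "\<And>x v. x \<in> L \<Longrightarrow> v \<in> W \<Longrightarrow> act x v \<in> W"
      using W(1) by (auto simp: good_def)
    fix W' assume W': "subspace W'" "W' \<subseteq> W" "\<And>x v. x \<in> L \<Longrightarrow> v \<in> W' \<Longrightarrow> act x v \<in> W'"
    show "W' = {0} \<or> W' = W"
    proof (rule disjCI)
      assume "W' \<noteq> W"
      have "W \<subseteq> span B" using W(1) assms(4) by (auto simp: good_def)
      obtain b where b: "b \<subseteq> W" "independent b" "W \<subseteq> span b" "card b = dim W" using basis_exists by blast
      have fb: "finite b" using independent_span_bound[OF assms(3) b(2)] b(1) \<open>W \<subseteq> span B\<close> by auto
      obtain b' where b': "b' \<subseteq> W'" "independent b'" "W' \<subseteq> span b'" "card b' = dim W'" using basis_exists by blast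
      have "dim W' \<le> dim W"
        using independent_span_bound[OF fb b'(2)] b' b W' by auto
      show "W' = {0}"
      proof (rule ccontr)
        assume "W' \<noteq> {0}"
        then have "good W'" using W' W(1) by (auto simp: good_def)
        then have "dim W' = dim W" using W(2) \<open>dim W' \<le> dim W\<close> by force
        then show False
          using card_eq_dim_imp_subspace_eq[OF W'(1) _ W'(2) assms(3) \<open>W \<subseteq> span B\<close>] W(1) \<open>W' \<noteq> W\<close>
          by (auto simp: good_def)
      qed
    qed
  qed
qed

section \<open>Linear maps between spaces with a basis\<close>

interpretation pmp: vector_space_pair
  "pm_scale :: complex \<Rightarrow> ('i \<Rightarrow>\<^sub>0 complex) \<Rightarrow> _" "pm_scale :: complex \<Rightarrow> ('j \<Rightarrow>\<^sub>0 complex) \<Rightarrow> _"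
  by unfold_locales

abbreviation lin :: "(('i \<Rightarrow>\<^sub>0 complex) \<Rightarrow> ('j \<Rightarrow>\<^sub>0 complex)) \<Rightarrow> bool" where
  "lin \<equiv> Vector_Spaces.linear pm_scale pm_scale"

lemma linI:
  assumes "\<And>x y. f (x + y) = f x + f y" "\<And>c x. f (pm_scale c x) = pm_scale c (f x)"
  shows "lin f"
  using assms by unfold_locales (auto simp: pm.scale_right_distrib pm.scale_left_distrib)

lemma lin_ext_superset:
  assumes "finite S" "Poly_Mapping.keys f \<subseteq> S"
  shows "lin_ext b f = (\<Sum>i\<in>S. pm_scale (Poly_Mapping.lookup f i) (b i))"
  unfolding lin_ext_def
  by (rule sum.mono_neutral_left) (use assms in \<open>auto simp: in_keys_iff\<close>)

lemma lin_lin_ext: "lin (lin_ext b)"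
proof (rule linI)
  fix x y :: "'a \<Rightarrow>\<^sub>0 complex" and c
  let ?S = "Poly_Mapping.keys x \<union> Poly_Mapping.keys y"
  have "Poly_Mapping.keys (x + y) \<subseteq> ?S" by (rule Poly_Mapping.keys_add)
  then show "lin_ext b (x + y) = lin_ext b x + lin_ext b y"
    by (simp add: lin_ext_superset[of ?S] lookup_add pm.scale_left_distrib sum.distrib)
  have "Poly_Mapping.keys (pm_scale c x) \<subseteq> Poly_Mapping.keys x"
    by (auto simp: in_keys_iff lookup_pm_scale)
  then show "lin_ext b (pm_scale c x) = pm_scale c (lin_ext b x)"
    by (simp add: lin_ext_superset[of "Poly_Mapping.keys x"] lookup_pm_scale pm.scale_sum_right)
qed

lemma lin_ext_single [simp]: "lin_ext b (Poly_Mapping.single i c) = pm_scale c (b i)"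
  by (simp add: lin_ext_superset[of "{i}"])

lemma single_expansion: "x = (\<Sum>i\<in>Poly_Mapping.keys x. pm_scale (Poly_Mapping.lookup x i) (Poly_Mapping.single i 1))"
  by (rule poly_mapping_eqI)
    (simp add: lookup_sum lookup_pm_scale lookup_single when_def in_keys_iff if_distrib cong: if_cong)

lemma lin_apply_expansion:
  assumes "lin F"
  shows "F x = (\<Sum>i\<in>Poly_Mapping.keys x. pm_scale (Poly_Mapping.lookup x i) (F (Poly_Mapping.single i 1)))"
  by (subst single_expansion[of x]) (simp add: pmp.linear_sum[OF assms] pmp.linear_scale[OF assms])

text \<open>Identities on tensor products and symmetric algebras are reduced to basis vectors by
  this. Only basis vectors occurring in \<open>x\<close> are compared, so maps that agree merely on
  the span of some of the basis vectors are covered too.\<close>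

lemma lin_eq_on:
  assumes "lin F" "lin G"
    and "\<And>i. i \<in> Poly_Mapping.keys x \<Longrightarrow> F (Poly_Mapping.single i 1) = G (Poly_Mapping.single i 1)"
  shows "F x = G x"
  by (simp add: lin_apply_expansion[OF assms(1), of x] lin_apply_expansion[OF assms(2), of x] assms(3) cong: sum.cong)

lemma keys_sum_subset:
  assumes "\<And>i. i \<in> S \<Longrightarrow> Poly_Mapping.keys (f i) \<subseteq> K"
  shows "Poly_Mapping.keys (\<Sum>i\<in>S. f i) \<subseteq> K"
  using assms
proof (induction S rule: infinite_finite_induct)
  case (insert a S)
  have "Poly_Mapping.keys (f a + sum f S) \<subseteq> Poly_Mapping.keys (f a) \<union> Poly_Mapping.keys (sum f S)"
    by (rule Poly_Mapping.keys_add)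
  with insert show ?case by auto
qed auto

lemma keys_pm_scale_subset: "Poly_Mapping.keys (pm_scale c x) \<subseteq> Poly_Mapping.keys x"
  by (auto simp: in_keys_iff lookup_pm_scale)

lemma keys_lin_subset:
  assumes "lin F" "\<And>i. i \<in> Poly_Mapping.keys x \<Longrightarrow> Poly_Mapping.keys (F (Poly_Mapping.single i 1)) \<subseteq> K"
  shows "Poly_Mapping.keys (F x) \<subseteq> K"
  unfolding lin_apply_expansion[OF assms(1), of x]
  by (intro keys_sum_subset order_trans[OF keys_pm_scale_subset assms(2)])

lemma subspace_keys: "pm.subspace {s. Poly_Mapping.keys s \<subseteq> K}"
proof (rule pm.subspaceI)
  show "x + y \<in> {s. Poly_Mapping.keys s \<subseteq> K}"
    if "x \<in> {s. Poly_Mapping.keys s \<subseteq> K}" "y \<in> {s. Poly_Mapping.keys s \<subseteq> K}" for x y :: "'a \<Rightarrow>\<^sub>0 complex"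
    using that Poly_Mapping.keys_add[of x y] by blast
  show "pm_scale c x \<in> {s. Poly_Mapping.keys s \<subseteq> K}"
    if "x \<in> {s. Poly_Mapping.keys s \<subseteq> K}" for c and x :: "'a \<Rightarrow>\<^sub>0 complex"
    using that keys_pm_scale_subset[of c x] by blast
qed simp

lemma coord_subspace: "pm.subspace (coord d)"
  unfolding coord_def by (rule subspace_keys)

lemma keys_subset_span: "{s. Poly_Mapping.keys s \<subseteq> K} \<subseteq> pm.span ((\<lambda>i. Poly_Mapping.single i 1) ` K)"
proof
  fix s :: "'a \<Rightarrow>\<^sub>0 complex" assume "s \<in> {s. Poly_Mapping.keys s \<subseteq> K}"
  then show "s \<in> pm.span ((\<lambda>i. Poly_Mapping.single i 1) ` K)"
    by (subst single_expansion) (auto intro!: pm.span_sum pm.span_scale intro: pm.span_base)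
qed

text \<open>Eigenvectors for distinct eigenvalues are independent, and \<open>d + 1\<close>
  independent vectors do not fit into \<open>coord d\<close>.\<close>

lemma finite_eigenvalues:
  assumes "linear_on pm_scale pm_scale (coord d) T"
  shows "finite {c. \<exists>v\<in>coord d. v \<noteq> 0 \<and> T v = pm_scale c v}" (is "finite ?E")
proof (rule ccontr)
  assume "infinite ?E"
  then obtain S where S: "S \<subseteq> ?E" "finite S" "card S = Suc d"
    using infinite_arbitrarily_large by blast
  then have "\<forall>c\<in>S. \<exists>v. v \<in> coord d \<and> v \<noteq> 0 \<and> T v = pm_scale c v" by blast
  then obtain v where v: "\<And>c. c \<in> S \<Longrightarrow> v c \<in> coord d \<and> v c \<noteq> 0 \<and> T (v c) = pm_scale c (v c)"
    by metis
  have coeff: "a c = 0" if "S' \<subseteq> S" "(\<Sum>c\<in>S'. pm_scale (a c) (v c)) = 0" "c \<in> S'" for a S' c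
  proof -
    \<comment> \<open>A linear relation says that a sum of eigenvectors lies in the invariant
      subspace \<open>{0}\<close>; then so does every summand.\<close>
    have "\<forall>c\<in>S'. pm_scale (a c) (v c) \<in> {0}"
    proof (rule eigencomponents_in_invariant_subspace[where c = id and scale = pm_scale and U = "coord d" and T = T])
      show "finite S'" using that S finite_subset by blast
      have "T (pm_scale 0 0) = pm_scale 0 (T 0)"
        using assms pm.subspace_0[OF coord_subspace] unfolding linear_on_def by blast
      then show "T x \<in> {0}" if "x \<in> {0}" for x using that by simp
      fix c assume "c \<in> S'"
      then have c: "v c \<in> coord d" "T (v c) = pm_scale c (v c)" using v that by auto
      then show "pm_scale (a c) (v c) \<in> coord d" by (intro pm.subspace_scale[OF coord_subspace])
      have "T (pm_scale (a c) (v c)) = pm_scale (a c) (T (v c))"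
        using assms c unfolding linear_on_def by blast
      then show "T (pm_scale (a c) (v c)) = pm_scale (id c) (pm_scale (a c) (v c))"
        by (simp add: c mult.commute)
    qed (use that in \<open>auto simp: assms coord_subspace pm.vector_space_axioms\<close>)
    then show ?thesis using that v by auto
  qed
  have inj: "inj_on v S"
  proof (rule inj_onI, rule ccontr)
    fix c c' assume c: "c \<in> S" "c' \<in> S" "v c = v c'" "c \<noteq> c'"
    \<comment> \<open>If two eigenvalues shared an eigenvector, the relation
      \<open>v c - v c' = 0\<close> would have nonzero coefficients.\<close>
    have "(if c = c then 1 else -1::complex) = 0"
      by (rule coeff[of "{c, c'}" "\<lambda>x. if x = c then 1 else -1" c]) (use c in auto)
    then show False by simp
  qed
  have "pm.independent (v ` S)"
  proof (subst pm.independent_explicit_finite_subsets, intro allI impI ballI)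
    fix A u x assume A: "A \<subseteq> v ` S" "finite A" "(\<Sum>w\<in>A. pm_scale (u w) w) = 0" "x \<in> A"
    then obtain S' where S': "S' \<subseteq> S" "A = v ` S'" by (meson subset_imageE)
    then have "(\<Sum>c\<in>S'. pm_scale (u (v c)) (v c)) = 0"
      using A(3) inj by (subst (asm) S'(2), subst (asm) sum.reindex) (auto intro: inj_on_subset)
    then show "u x = 0" using coeff[of S' "\<lambda>c. u (v c)"] S' A(4) by auto
  qed
  moreover have "v ` S \<subseteq> pm.span ((\<lambda>i. Poly_Mapping.single i 1) ` {..<d})"
    using v by (auto simp: coord_def intro!: subsetD[OF keys_subset_span[of "{..<d}"]])
  ultimately have "card (v ` S) \<le> card ((\<lambda>i. Poly_Mapping.single i (1::complex)) ` {..<d})"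
    by (intro pm.independent_span_bound[THEN conjunct2]) auto
  also have "\<dots> \<le> d" using card_image_le[of "{..<d}"] by auto
  finally show False using card_image[OF inj] S by simp
qed

section \<open>The symmetric algebra\<close>

lemma pm_scale_mult_left:
  fixes x y :: "'m::comm_monoid_add \<Rightarrow>\<^sub>0 complex"
  shows "pm_scale c x * y = pm_scale c (x * y)" "x * pm_scale c y = pm_scale c (x * y)"
  by (simp_all add: pm_scale_def mult_map_scale_conv_mult mult.assoc mult.left_commute)

lemma lin_mult:
  fixes F G :: "_ \<Rightarrow> ('m::comm_monoid_add \<Rightarrow>\<^sub>0 complex)"
  shows "lin F \<Longrightarrow> lin (\<lambda>x. F x * y)" "lin F \<Longrightarrow> lin (\<lambda>x. y * F x)"
  by (auto intro!: linI simp: pmp.linear_add pmp.linear_scale distrib_left distrib_right pm_scale_mult_left)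

lemma lin_id: "lin (\<lambda>x. x)"
  by (auto intro!: linI)

lemma lin_comp: "lin F \<Longrightarrow> lin G \<Longrightarrow> lin (\<lambda>x. F (G x))"
  by (auto intro!: linI simp: pmp.linear_add pmp.linear_scale)

lemma lin_plus_minus: "lin F \<Longrightarrow> lin G \<Longrightarrow> lin (\<lambda>x. F x + G x)" "lin F \<Longrightarrow> lin G \<Longrightarrow> lin (\<lambda>x. F x - G x)"
  by (auto intro!: linI simp: pmp.linear_add pmp.linear_scale pm.scale_right_distrib pm.scale_right_diff_distrib)

lemma lin_pm_scale: "lin F \<Longrightarrow> lin (\<lambda>x. pm_scale c (F x))"
  by (auto intro!: linI simp: pmp.linear_add pmp.linear_scale pm.scale_right_distrib mult.commute)

lemma lin_sym_incl: "lin sym_incl"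
  unfolding sym_incl_def by (rule lin_lin_ext)

lemma lin_sym_act: "lin (sym_act D)"
  unfolding sym_act_def by (rule lin_lin_ext)

lemma lin_sym_act_comp: "lin F \<Longrightarrow> lin (\<lambda>x. sym_act D (F x))"
  by (rule lin_comp[OF lin_sym_act])

lemma sym_act_monomial:
  "sym_act D (Poly_Mapping.single M 1) =
     (\<Sum>i\<in>#M. Poly_Mapping.single (M - {#i#}) 1 * sym_incl (D (Poly_Mapping.single i 1)))"
  by (simp add: sym_act_def)

lemma sym_incl_single: "sym_incl (Poly_Mapping.single i 1) = Poly_Mapping.single {#i#} 1"
  by (simp add: sym_incl_def)

lemma single_mult_monomial:
  "Poly_Mapping.single M 1 * Poly_Mapping.single N (1::complex) = Poly_Mapping.single (M + N) 1"
  by (simp add: mult_single)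

text \<open>A variable deleted from the product comes either from \<open>M\<close> or from
  \<open>N\<close>, which splits the defining sum into the two terms of the Leibniz rule.\<close>

lemma sym_act_monomial_mult:
  "sym_act D (Poly_Mapping.single M 1 * Poly_Mapping.single N 1) =
     sym_act D (Poly_Mapping.single M 1) * Poly_Mapping.single N 1 +
     Poly_Mapping.single M 1 * sym_act D (Poly_Mapping.single N 1)"
proof -
  let ?s = "\<lambda>M. Poly_Mapping.single M (1::complex)" and ?d = "\<lambda>i. sym_incl (D (Poly_Mapping.single i 1))"
  have "(\<Sum>i\<in>#M. ?s (M + N - {#i#}) * ?d i) = (\<Sum>i\<in>#M. ?s (M - {#i#}) * ?d i * ?s N)"
  proof (rule arg_cong[where f = sum_mset], rule image_mset_cong)
    fix i assume "i \<in># M"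
    then have "M + N - {#i#} = (M - {#i#}) + N" by simp
    then show "?s (M + N - {#i#}) * ?d i = ?s (M - {#i#}) * ?d i * ?s N"
      by (simp only: single_mult_monomial[symmetric] mult_ac)
  qed
  moreover have "(\<Sum>i\<in>#N. ?s (M + N - {#i#}) * ?d i) = (\<Sum>i\<in>#N. ?s M * (?s (N - {#i#}) * ?d i))"
  proof (rule arg_cong[where f = sum_mset], rule image_mset_cong)
    fix i assume "i \<in># N"
    then have "M + N - {#i#} = M + (N - {#i#})" by simp
    then show "?s (M + N - {#i#}) * ?d i = ?s M * (?s (N - {#i#}) * ?d i)"
      by (simp only: single_mult_monomial[symmetric] mult_ac)
  qed
  ultimately show ?thesis
    by (simp add: single_mult_monomial sym_act_monomial sum_mset_distrib_left sum_mset_distrib_right)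
qed

lemma sym_act_mult: "sym_act D (f * g) = sym_act D f * g + f * sym_act D g"
proof -
  have *: "sym_act D (Poly_Mapping.single M 1 * g) =
      sym_act D (Poly_Mapping.single M 1) * g + Poly_Mapping.single M 1 * sym_act D g" for M
    by (rule lin_eq_on[of "\<lambda>g. sym_act D (Poly_Mapping.single M 1 * g)"])
      (intro lin_plus_minus lin_mult lin_sym_act_comp lin_id sym_act_monomial_mult)+
  show ?thesis
    by (rule lin_eq_on[of "\<lambda>f. sym_act D (f * g)"])
      (intro lin_plus_minus lin_mult lin_sym_act_comp lin_id *)+
qed

lemma sym_act_one: "sym_act D 1 = 0"
  using sym_act_monomial[of D "{#}"] by simp

lemma sym_act_sym_incl:
  assumes "lin D"
  shows "sym_act D (sym_incl v) = sym_incl (D v)"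
proof (rule lin_eq_on[of "\<lambda>v. sym_act D (sym_incl v)" "\<lambda>v. sym_incl (D v)"])
  show "lin (\<lambda>v. sym_act D (sym_incl v))" by (intro lin_sym_act_comp lin_sym_incl)
  show "lin (\<lambda>v. sym_incl (D v))" by (rule lin_comp[OF lin_sym_incl assms])
qed (simp add: sym_incl_single sym_act_monomial)

text \<open>Both sides are derivations, because the mixed terms of the Leibniz rule cancel in the
  commutator, and they agree on the variables; induction on the monomial does the rest. This makes
  the symmetric algebra a module.\<close>

lemma sym_act_commutator:
  assumes "lin D" "lin E"
  shows "sym_act (\<lambda>v. D (E v) - E (D v)) s = sym_act D (sym_act E s) - sym_act E (sym_act D s)"
proof (rule lin_eq_on[of "sym_act (\<lambda>v. D (E v) - E (D v))" "\<lambda>s. sym_act D (sym_act E s) - sym_act E (sym_act D s)"])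
  show "lin (sym_act (\<lambda>v. D (E v) - E (D v)))" by (rule lin_sym_act)
  show "lin (\<lambda>s. sym_act D (sym_act E s) - sym_act E (sym_act D s))"
    by (intro lin_plus_minus lin_sym_act_comp lin_sym_act)
next
  fix M :: "'a multiset"
  let ?C = "\<lambda>v. D (E v) - E (D v)"
  have C: "lin ?C" by (rule lin_plus_minus(2)[OF lin_comp[OF assms] lin_comp[OF assms(2,1)]])
  show "sym_act ?C (Poly_Mapping.single M 1) = sym_act D (sym_act E (Poly_Mapping.single M 1)) -
      sym_act E (sym_act D (Poly_Mapping.single M 1))"
  proof (induction M)
    case empty
    then show ?case by (simp add: sym_act_one pmp.linear_0[OF lin_sym_act])
  next
    case (add i M)
    have i: "sym_act F (Poly_Mapping.single {#i#} 1) = sym_incl (F (Poly_Mapping.single i 1))" if "lin F" for F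
      using sym_act_sym_incl[OF that, of "Poly_Mapping.single i 1"] by (simp add: sym_incl_single)
    have *: "Poly_Mapping.single (add_mset i M) (1::complex) = Poly_Mapping.single {#i#} 1 * Poly_Mapping.single M 1"
      by (simp add: single_mult_monomial)
    show ?case
      unfolding * sym_act_mult add
      by (simp add: i C assms sym_act_mult pmp.linear_add[OF lin_sym_act] pmp.linear_diff[OF lin_sym_act]
          pmp.linear_diff[OF lin_sym_incl] sym_act_sym_incl algebra_simps)
  qed
qed

lemma sym_act_add: "sym_act (\<lambda>v. D v + E v) s = sym_act D s + sym_act E s"
  by (rule lin_eq_on[OF lin_sym_act lin_plus_minus(1)[OF lin_sym_act lin_sym_act]])
    (simp add: sym_act_monomial pmp.linear_add[OF lin_sym_incl] distrib_left sum_mset.distrib)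

lemma sum_mset_pm_scale: "(\<Sum>i\<in>#M. pm_scale c (f i)) = pm_scale c (\<Sum>i\<in>#M. f i)"
  by (induction M) (auto simp: pm.scale_right_distrib)

lemma sum_mset_pm_scale_left: "(\<Sum>i\<in>#M. pm_scale (f i) w) = pm_scale (\<Sum>i\<in>#M. f i) w"
  by (induction M) (auto simp: pm.scale_left_distrib)

lemma sym_act_scale: "sym_act (\<lambda>v. pm_scale c (D v)) s = pm_scale c (sym_act D s)"
  by (rule lin_eq_on[OF lin_sym_act lin_pm_scale[OF lin_sym_act]])
    (simp add: sym_act_monomial pmp.linear_scale[OF lin_sym_incl] pm_scale_mult_left sum_mset_pm_scale)

lemma sym_act_monomial_weight:
  assumes "\<And>i. i \<in># M \<Longrightarrow> D (Poly_Mapping.single i 1) = pm_scale (\<nu> i) (Poly_Mapping.single i 1)"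
  shows "sym_act D (Poly_Mapping.single M 1) = pm_scale (\<Sum>i\<in>#M. \<nu> i) (Poly_Mapping.single M 1)"
proof -
  have "sym_act D (Poly_Mapping.single M 1) = (\<Sum>i\<in>#M. pm_scale (\<nu> i) (Poly_Mapping.single M 1))"
    unfolding sym_act_monomial
  proof (rule arg_cong[where f = sum_mset], rule image_mset_cong)
    fix i assume "i \<in># M"
    then show "Poly_Mapping.single (M - {#i#}) 1 * sym_incl (D (Poly_Mapping.single i 1)) =
        pm_scale (\<nu> i) (Poly_Mapping.single M 1)"
      using assms by (simp add: pmp.linear_scale[OF lin_sym_incl] sym_incl_single pm_scale_mult_left single_mult_monomial)
  qed
  also have "\<dots> = pm_scale (\<Sum>i\<in>#M. \<nu> i) (Poly_Mapping.single M 1)"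
    by (rule sum_mset_pm_scale_left)
  finally show ?thesis .
qed

lemma keys_sum_mset_subset:
  assumes "\<And>i. i \<in># M \<Longrightarrow> Poly_Mapping.keys (f i) \<subseteq> K"
  shows "Poly_Mapping.keys (\<Sum>i\<in>#M. f i) \<subseteq> K"
  using assms
proof (induction M)
  case (add a M)
  have "Poly_Mapping.keys (f a + (\<Sum>i\<in>#M. f i)) \<subseteq> Poly_Mapping.keys (f a) \<union> Poly_Mapping.keys (\<Sum>i\<in>#M. f i)"
    by (rule Poly_Mapping.keys_add)
  with add show ?case by fastforce
qed auto

text \<open>A derivation of this kind replaces one variable of a monomial by a linear form, so each
  symmetric power is stable.\<close>

lemma sym_act_keys:
  assumes "\<And>i. i < r \<Longrightarrow> D (Poly_Mapping.single i 1) \<in> coord r"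
    and "Poly_Mapping.keys s \<subseteq> {M. set_mset M \<subseteq> {..<r} \<and> size M = k}"
  shows "Poly_Mapping.keys (sym_act D s) \<subseteq> {M. set_mset M \<subseteq> {..<r} \<and> size M = k}"
proof (rule keys_lin_subset[OF lin_sym_act])
  fix M assume "M \<in> Poly_Mapping.keys s"
  then have M: "set_mset M \<subseteq> {..<r}" "size M = k" using assms(2) by auto
  show "Poly_Mapping.keys (sym_act D (Poly_Mapping.single M 1)) \<subseteq> {M. set_mset M \<subseteq> {..<r} \<and> size M = k}"
    unfolding sym_act_monomial
  proof (rule keys_sum_mset_subset, rule subsetI)
    fix i M' assume i: "i \<in># M" and
      M': "M' \<in> Poly_Mapping.keys (Poly_Mapping.single (M - {#i#}) 1 * sym_incl (D (Poly_Mapping.single i 1)))"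
    have "Poly_Mapping.keys (sym_incl (D (Poly_Mapping.single i 1))) \<subseteq> (\<lambda>j. {#j#}) ` {..<r}"
    proof (rule keys_lin_subset[OF lin_sym_incl])
      fix j assume "j \<in> Poly_Mapping.keys (D (Poly_Mapping.single i 1))"
      then have "j < r" using assms(1)[of i] i M by (auto simp: coord_def)
      then show "Poly_Mapping.keys (sym_incl (Poly_Mapping.single j 1)) \<subseteq> (\<lambda>j. {#j#}) ` {..<r}"
        by (simp add: sym_incl_single)
    qed
    moreover obtain a b where ab: "M' = a + b" "a \<in> Poly_Mapping.keys (Poly_Mapping.single (M - {#i#}) (1::complex))"
      "b \<in> Poly_Mapping.keys (sym_incl (D (Poly_Mapping.single i 1)))"
      using subsetD[OF keys_mult M'] by blast
    moreover have "a = M - {#i#}" using ab(2) by simp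
    ultimately obtain j where "j < r" "M' = M - {#i#} + {#j#}" by blast
    moreover have "set_mset (M - {#i#}) \<subseteq> {..<r}" using M by (auto dest: in_diffD)
    moreover have "Suc (size (M - {#i#})) = k" using M i by (simp add: size_Suc_Diff1)
    ultimately show "M' \<in> {M. set_mset M \<subseteq> {..<r} \<and> size M = k}" by auto
  qed
qed

section \<open>Irreducible submodules\<close>

lemma (in lie_algebra) irreducible_module_coordinates:
  fixes \<rho> :: "'a \<Rightarrow> ('i \<Rightarrow>\<^sub>0 complex) \<Rightarrow> ('i \<Rightarrow>\<^sub>0 complex)"
  assumes L: "subspace L"
    and lin: "\<And>x. x \<in> L \<Longrightarrow> lin (\<rho> x)"
    and add: "\<And>x y s. x \<in> L \<Longrightarrow> y \<in> L \<Longrightarrow> \<rho> (x + y) s = \<rho> x s + \<rho> y s"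
    and scale: "\<And>c x s. x \<in> L \<Longrightarrow> \<rho> (scale c x) s = pm_scale c (\<rho> x s)"
    and br: "\<And>x y s. x \<in> L \<Longrightarrow> y \<in> L \<Longrightarrow> \<rho> (br x y) s = \<rho> x (\<rho> y s) - \<rho> y (\<rho> x s)"
    and W: "pm.subspace W" "W \<noteq> {0}" "finite B" "W \<subseteq> pm.span B"
      "\<And>x s. x \<in> L \<Longrightarrow> s \<in> W \<Longrightarrow> \<rho> x s \<in> W"
      "\<And>W'. pm.subspace W' \<Longrightarrow> W' \<subseteq> W \<Longrightarrow> (\<And>x v. x \<in> L \<Longrightarrow> v \<in> W' \<Longrightarrow> \<rho> x v \<in> W') \<Longrightarrow> W' = {0} \<or> W' = W"
  obtains e act F where "irreducible_module L e act" "lin F" "bij_betw F (coord e) W"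
    "\<And>x v. x \<in> L \<Longrightarrow> v \<in> coord e \<Longrightarrow> F (act x v) = \<rho> x (F v)"
proof -
  obtain b where b: "b \<subseteq> W" "pm.independent b" "W \<subseteq> pm.span b" "card b = pm.dim W"
    using pm.basis_exists by blast
  have fb: "finite b" using pm.independent_span_bound[OF W(3) b(2)] b(1) W(4) by auto
  define e where "e = card b"
  obtain bb where bb: "bij_betw bb {..<e} b"
    using ex_bij_betw_nat_finite[OF fb] by (auto simp: e_def atLeast0LessThan)
  have bbW: "bb j \<in> W" if "j < e" for j using bb that b(1) by (auto simp: bij_betw_def)
  define F where "F = lin_ext (\<lambda>j. if j < e then bb j else 0)"
  have F: "lin F" unfolding F_def by (rule lin_lin_ext)
  have Fv: "F v = (\<Sum>j<e. pm_scale (Poly_Mapping.lookup v j) (bb j))" if "v \<in> coord e" for v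
    using that unfolding F_def coord_def by (subst lin_ext_superset[of "{..<e}"]) auto
  have FW: "F v \<in> W" if "v \<in> coord e" for v
    unfolding Fv[OF that] by (intro pm.subspace_sum[OF W(1)] pm.subspace_scale[OF W(1)] bbW) auto
  have surj: "\<exists>v\<in>coord e. F v = w" if w: "w \<in> W" for w
  proof -
    obtain u where u: "w = (\<Sum>x\<in>b. pm_scale (u x) x)"
      using subsetD[OF b(3) w] unfolding pm.span_finite[OF fb] by auto
    define v where "v = (\<Sum>j<e. pm_scale (u (bb j)) (Poly_Mapping.single j 1))"
    have "Poly_Mapping.keys v \<subseteq> {..<e}" unfolding v_def
      by (intro keys_sum_subset order_trans[OF keys_pm_scale_subset]) auto
    then have "v \<in> coord e" by (simp add: coord_def)
    moreover have "F v = (\<Sum>j<e. pm_scale (u (bb j)) (bb j))"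
      unfolding v_def pmp.linear_sum[OF F] pmp.linear_scale[OF F] by (simp add: F_def)
    then have "F v = w" unfolding u using sum.reindex_bij_betw[OF bb, of "\<lambda>x. pm_scale (u x) x"] by simp
    ultimately show ?thesis by blast
  qed
  have zero: "v = 0" if "v \<in> coord e" "F v = 0" for v
  proof -
    define u where "u x = Poly_Mapping.lookup v (inv_into {..<e} bb x)" for x
    have u: "u (bb j) = Poly_Mapping.lookup v j" if "j < e" for j
      using bb that by (auto simp: u_def bij_betw_def)
    have "(\<Sum>x\<in>b. pm_scale (u x) x) = F v"
      unfolding Fv[OF that(1)] sum.reindex_bij_betw[OF bb, of "\<lambda>x. pm_scale (u x) x", symmetric]
      by (simp add: u)
    then have "u x = 0" if "x \<in> b" for x
      using pm.independentD[OF b(2) fb, of u x] that \<open>F v = 0\<close> by auto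
    then have "Poly_Mapping.lookup v j = 0" if "j < e" for j
      using u[OF that] bb that by (auto simp: bij_betw_def)
    moreover have "Poly_Mapping.lookup v j = 0" if "\<not> j < e" for j
      using that \<open>v \<in> coord e\<close> by (auto simp: coord_def in_keys_iff)
    ultimately show ?thesis by (intro poly_mapping_eqI) (auto simp: lookup_zero)
  qed
  have inj: "inj_on F (coord e)"
  proof (rule inj_onI)
    fix v w assume vw: "v \<in> coord e" "w \<in> coord e" "F v = F w"
    then have "v - w = 0"
      by (intro zero pm.subspace_diff[OF coord_subspace]) (auto simp: pmp.linear_diff[OF F])
    then show "v = w" by simp
  qed
  define G where "G = inv_into (coord e) F"
  have G: "G w \<in> coord e" "F (G w) = w" if "w \<in> W" for w
    using surj[OF that] unfolding G_def by (auto intro: inv_into_into f_inv_into_f)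
  define act where "act x v = G (\<rho> x (F v))" for x v
  have act: "act x v \<in> coord e" "F (act x v) = \<rho> x (F v)" if "x \<in> L" "v \<in> coord e" for x v
    using that by (auto simp: act_def intro!: G W FW)
  note C = pm.subspace_add[OF coord_subspace] pm.subspace_scale[OF coord_subspace] pm.subspace_diff[OF coord_subspace]
  have fd: "fd_module L e act"
    unfolding fd_module_def
  proof (intro conjI ballI)
    fix x assume x: "x \<in> L"
    show "act x ` coord e \<subseteq> coord e" using act x by auto
    show "linear_on pm_scale pm_scale (coord e) (act x)"
      unfolding linear_on_def
      by (intro conjI ballI allI inj_onD[OF inj] C act x)
        (simp_all add: act x C pmp.linear_add[OF F] pmp.linear_scale[OF F]
          pmp.linear_add[OF lin[OF x]] pmp.linear_scale[OF lin[OF x]])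
  next
    fix v assume v: "v \<in> coord e"
    show "linear_on scale pm_scale L (\<lambda>x. act x v)"
      unfolding linear_on_def
    proof (intro conjI ballI allI)
      fix x y assume "x \<in> L" "y \<in> L"
      then show "act (x + y) v = act x v + act y v"
        by (intro inj_onD[OF inj] C act v) (simp_all add: subspace_add[OF L] act v add pmp.linear_add[OF F])
    next
      fix c x assume "x \<in> L"
      then show "act (scale c x) v = pm_scale c (act x v)"
        by (intro inj_onD[OF inj] C act v) (simp_all add: subspace_scale[OF L] act v scale pmp.linear_scale[OF F])
    qed
  next
    fix x y v assume xyv: "x \<in> L" "y \<in> L" "v \<in> coord e"
    \<comment> \<open>\<open>L\<close> is only known to be a subspace, so \<open>br x y\<close> may
      lie outside it; the commutator formula still keeps the value in \<open>W\<close>.\<close>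
    then have "\<rho> (br x y) (F v) \<in> W"
      unfolding br[OF xyv(1,2)] by (intro pm.subspace_diff[OF W(1)] W(5) FW)
    then have *: "act (br x y) v \<in> coord e" "F (act (br x y) v) = \<rho> (br x y) (F v)"
      unfolding act_def by (rule G)+
    then show "act (br x y) v = act x (act y v) - act y (act x v)"
      using xyv by (intro inj_onD[OF inj _ *(1)] C act) (simp_all add: * act br pmp.linear_diff[OF F])
  qed
  have irr: "W0 = {0} \<or> W0 = coord e"
    if W0: "pm.subspace W0" "W0 \<subseteq> coord e" "\<forall>x\<in>L. act x ` W0 \<subseteq> W0" for W0
  proof -
    have "F ` W0 = {0} \<or> F ` W0 = W"
    proof (rule W(6))
      show "pm.subspace (F ` W0)" by (rule pmp.linear_subspace_image[OF F W0(1)])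
      show "F ` W0 \<subseteq> W" using FW W0(2) by auto
      fix x w assume x: "x \<in> L" and "w \<in> F ` W0"
      then obtain v where v: "v \<in> W0" "w = F v" by auto
      then have "\<rho> x w = F (act x v)" using act x W0(2) by auto
      then show "\<rho> x w \<in> F ` W0" using v W0(3) x by auto
    qed
    then show ?thesis
    proof
      assume "F ` W0 = {0}"
      then have "\<forall>v\<in>W0. v = 0" using zero W0(2) by blast
      then show ?thesis using pm.subspace_0[OF W0(1)] by auto
    next
      assume *: "F ` W0 = W"
      have "v \<in> W0" if v: "v \<in> coord e" for v
      proof -
        obtain v' where v': "v' \<in> W0" "F v' = F v" using FW[OF v] * by (metis imageE)
        then have "v' = v" using inj_onD[OF inj, of v' v] W0(2) v by auto
        then show ?thesis using v' by simp
      qed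
      then show ?thesis using W0(2) by auto
    qed
  qed
  have "e \<noteq> 0"
  proof
    assume "e = 0"
    then have "b = {}" using fb by (simp add: e_def)
    then have "W \<subseteq> {0}" using b(3) by simp
    then show False using W(2) pm.subspace_0[OF W(1)] by auto
  qed
  with fd irr have "irreducible_module L e act" unfolding irreducible_module_def by blast
  moreover have "bij_betw F (coord e) W" using inj FW surj by (auto simp: bij_betw_def)
  ultimately show ?thesis using that F act(2) by blast
qed

text \<open>The finite set \<open>K\<close> indexes a basis of weight vectors, and
  \<open>deg\<close> is the eigenvalue of \<open>h0\<close>. In a minimal invariant subspace, an
  element that involves the highest occurring degree and otherwise has as few terms as possible is a
  weight vector, and whatever raises the degree kills it. The condition \<open>raise\<close> says
  that the positive root vectors of \<open>L\<close> are sums of such raising elements.\<close>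

lemma (in lie_algebra) highest_weight_submodule:
  fixes \<rho> :: "'a \<Rightarrow> ('i \<Rightarrow>\<^sub>0 complex) \<Rightarrow> ('i \<Rightarrow>\<^sub>0 complex)"
    and K :: "'i set" and deg :: "'i \<Rightarrow> real"
  assumes L: "subspace L"
    and lin: "\<And>x. x \<in> L \<Longrightarrow> lin (\<rho> x)"
    and add: "\<And>x y s. x \<in> L \<Longrightarrow> y \<in> L \<Longrightarrow> \<rho> (x + y) s = \<rho> x s + \<rho> y s"
    and scale: "\<And>c x s. x \<in> L \<Longrightarrow> \<rho> (scale c x) s = pm_scale c (\<rho> x s)"
    and br: "\<And>x y s. x \<in> L \<Longrightarrow> y \<in> L \<Longrightarrow> \<rho> (br x y) s = \<rho> x (\<rho> y s) - \<rho> y (\<rho> x s)"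
    and stable: "\<And>x s. x \<in> L \<Longrightarrow> Poly_Mapping.keys s \<subseteq> K \<Longrightarrow> Poly_Mapping.keys (\<rho> x s) \<subseteq> K"
    and K: "finite K" "K \<noteq> {}"
    and H: "H \<subseteq> L"
    and wt: "\<And>h M. h \<in> H \<Longrightarrow> M \<in> K \<Longrightarrow> \<rho> h (Poly_Mapping.single M 1) = pm_scale (wt M h) (Poly_Mapping.single M 1)"
    and h0: "h0 \<in> H" "\<And>M. M \<in> K \<Longrightarrow> wt M h0 = of_real (deg M)"
    and raise: "L \<inter> nilrad G H B \<subseteq> span {y\<in>L. \<exists>c>0. br h0 y = scale (of_real c) y}"
    and \<mu>: "\<And>M h. M \<in> K \<Longrightarrow> h \<in> H \<Longrightarrow> \<mu> M h = wt M h"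
  obtains M e act F where "M \<in> K" "highest_weight_module G H B L (\<mu> M) e act" "lin F"
    "inj_on F (coord e)" "\<forall>v\<in>coord e. Poly_Mapping.keys (F v) \<subseteq> K"
    "\<forall>x\<in>L. \<forall>v\<in>coord e. F (act x v) = \<rho> x (F v)"
proof -
  let ?V = "{s. Poly_Mapping.keys s \<subseteq> K} :: ('i \<Rightarrow>\<^sub>0 complex) set"
  let ?B = "(\<lambda>i. Poly_Mapping.single i (1::complex)) ` K"
  obtain M0 where "M0 \<in> K" using K by auto
  then have "Poly_Mapping.single M0 1 \<in> ?V" "Poly_Mapping.single M0 (1::complex) \<noteq> 0"
    by (simp, metis lookup_single_eq lookup_zero zero_neq_one)
  then have "?V \<noteq> {0}" by blast
  then obtain W where W: "pm.subspace W" "W \<subseteq> ?V" "W \<noteq> {0}" "\<And>x v. x \<in> L \<Longrightarrow> v \<in> W \<Longrightarrow> \<rho> x v \<in> W"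
    "\<And>W'. pm.subspace W' \<Longrightarrow> W' \<subseteq> W \<Longrightarrow> (\<And>x v. x \<in> L \<Longrightarrow> v \<in> W' \<Longrightarrow> \<rho> x v \<in> W') \<Longrightarrow> W' = {0} \<or> W' = W"
    using pm.exists_minimal_invariant_subspace[of ?V ?B L \<rho>] subspace_keys[of K] keys_subset_span[of K] K(1) stable
    by (smt (verit, del_insts) finite_imageI mem_Collect_eq)
  have "W \<subseteq> pm.span ?B" using W(2) keys_subset_span by blast
  then obtain e act F where F: "irreducible_module L e act" "lin F" "bij_betw F (coord e) W"
    "\<And>x v. x \<in> L \<Longrightarrow> v \<in> coord e \<Longrightarrow> F (act x v) = \<rho> x (F v)"
    using irreducible_module_coordinates[OF L lin add scale br W(1,3) finite_imageI[OF K(1)] _ W(4,5)] by blast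
  have weight: "\<rho> h s = (\<Sum>M\<in>Poly_Mapping.keys s. pm_scale (Poly_Mapping.lookup s M * wt M h) (Poly_Mapping.single M 1))"
    if "h \<in> H" "s \<in> W" for h s
    unfolding lin_apply_expansion[OF lin[OF subsetD[OF H that(1)]], of s]
  proof (intro sum.cong refl)
    fix M assume "M \<in> Poly_Mapping.keys s"
    then have "M \<in> K" using W(2) that by blast
    then show "pm_scale (Poly_Mapping.lookup s M) (\<rho> h (Poly_Mapping.single M 1)) =
        pm_scale (Poly_Mapping.lookup s M * wt M h) (Poly_Mapping.single M 1)"
      by (simp add: wt that)
  qed
  have lookup: "Poly_Mapping.lookup (\<rho> h s) M = wt M h * Poly_Mapping.lookup s M" if "h \<in> H" "s \<in> W" for h s M
    unfolding weight[OF that]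
    by (auto simp: lookup_sum lookup_pm_scale lookup_single when_def if_distrib in_keys_iff cong: if_cong)
  define Keys where "Keys = (\<Union>s\<in>W. Poly_Mapping.keys s)"
  have "Keys \<subseteq> K" using W(2) by (auto simp: Keys_def)
  then have "finite Keys" using K finite_subset by blast
  obtain s0 where "s0 \<in> W" "s0 \<noteq> 0" using W(3) pm.subspace_0[OF W(1)] by blast
  then have "Keys \<noteq> {}" unfolding Keys_def using keys_eq_empty by blast
  define D where "D = Max (deg ` Keys)"
  have "D \<in> deg ` Keys" unfolding D_def using \<open>finite Keys\<close> \<open>Keys \<noteq> {}\<close> by auto
  \<comment> \<open>The top degree is built into the competition, so that the element with the
    fewest terms still has a term of degree \<open>D\<close>.\<close>
  define top where "top s \<longleftrightarrow> s \<in> W \<and> (\<exists>M\<in>Poly_Mapping.keys s. deg M = D)" for s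
  have "\<exists>s. top s" using \<open>D \<in> deg ` Keys\<close> by (auto simp: top_def Keys_def)
  then obtain s where s: "top s" "\<And>s'. top s' \<Longrightarrow> card (Poly_Mapping.keys s) \<le> card (Poly_Mapping.keys s')"
    using ex_has_least_nat[of top _ "\<lambda>s. card (Poly_Mapping.keys s)"] by blast
  then obtain M where M: "M \<in> Poly_Mapping.keys s" "deg M = D" by (auto simp: top_def)
  have sW: "s \<in> W" using s by (simp add: top_def)
  have MK: "M \<in> K" using M sW W(2) by auto
  \<comment> \<open>\<open>s\<close> has the fewest terms, and \<open>\<rho> h s - wt M' h s\<close> lies in \<open>W\<close> without the term at \<open>M'\<close>.\<close>
  have wts: "\<rho> h s = pm_scale (wt M h) s" if h: "h \<in> H" for h
  proof (rule poly_mapping_eqI, unfold lookup[OF h sW] lookup_pm_scale)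
    fix M'
    show "wt M' h * Poly_Mapping.lookup s M' = wt M h * Poly_Mapping.lookup s M'"
    proof (rule ccontr)
      assume *: "\<not> ?thesis"
      define s' where "s' = \<rho> h s - pm_scale (wt M' h) s"
      have s'W: "s' \<in> W" unfolding s'_def
        using W(1,4) sW h H by (intro pm.subspace_diff pm.subspace_scale) auto
      have l: "Poly_Mapping.lookup s' N = (wt N h - wt M' h) * Poly_Mapping.lookup s N" for N
        by (simp add: s'_def lookup_minus lookup[OF h sW] lookup_pm_scale algebra_simps)
      have "Poly_Mapping.lookup s' M \<noteq> 0" unfolding l using M(1) * by (auto simp: in_keys_iff)
      then have "top s'" using s'W M by (auto simp: top_def in_keys_iff)
      moreover have "Poly_Mapping.keys s' \<subseteq> Poly_Mapping.keys s - {M'}"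
        by (auto simp: in_keys_iff l)
      moreover have "M' \<in> Poly_Mapping.keys s" using * by (auto simp: in_keys_iff)
      ultimately show False
        using s(2)[of s'] card_mono[of "Poly_Mapping.keys s - {M'}" "Poly_Mapping.keys s'"]
          card_Diff1_less[of "Poly_Mapping.keys s" M'] by auto
    qed
  qed
  \<comment> \<open>\<open>x\<close> shifts the eigenvalue of \<open>h0\<close> by
    \<open>c > 0\<close>, from \<open>D\<close> to \<open>c + D\<close>; this exceeds every degree
    occurring in \<open>W\<close>, so \<open>\<rho> x s\<close> has no terms.\<close>
  have kill1: "\<rho> x s = 0" if x: "x \<in> L" "0 < c" "br h0 x = scale (of_real c) x" for x c
  proof -
    have "\<rho> (br h0 x) s = \<rho> h0 (\<rho> x s) - \<rho> x (\<rho> h0 s)" using x h0 H by (intro br) auto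
    then have eq: "\<rho> h0 (\<rho> x s) = pm_scale (of_real c + of_real D) (\<rho> x s)"
      using x h0 M MK by (simp add: scale wts pmp.linear_scale[OF lin[OF x(1)]] pm.scale_left_distrib)
    have xs: "\<rho> x s \<in> W" using W(4) x sW by auto
    have "Poly_Mapping.keys (\<rho> x s) = {}"
    proof (rule ccontr)
      assume "Poly_Mapping.keys (\<rho> x s) \<noteq> {}"
      then obtain N where N: "N \<in> Poly_Mapping.keys (\<rho> x s)" by blast
      have "N \<in> Keys" using N xs by (auto simp: Keys_def)
      then have "deg N \<le> D" unfolding D_def using \<open>finite Keys\<close> by auto
      have "wt N h0 = of_real c + of_real D"
        using arg_cong[OF eq, of "\<lambda>f. Poly_Mapping.lookup f N"] N
        by (simp add: lookup[OF h0(1) xs] lookup_pm_scale in_keys_iff)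
      then have "complex_of_real (deg N) = of_real (c + D)" using h0(2)[of N] \<open>N \<in> Keys\<close> \<open>Keys \<subseteq> K\<close> by auto
      then have "deg N = c + D" by (simp only: of_real_eq_iff)
      with \<open>deg N \<le> D\<close> x(2) show False by simp
    qed
    then show ?thesis by simp
  qed
  have kill: "\<rho> x s = 0" if "x \<in> span {y\<in>L. \<exists>c>0. br h0 y = scale (of_real c) y}" for x
  proof -
    have "subspace {x\<in>L. \<rho> x s = 0}"
    proof (rule subspaceI)
      have "\<rho> (scale 0 0) s = pm_scale 0 (\<rho> 0 s)" using subspace_0[OF L] by (intro scale)
      then show "0 \<in> {x\<in>L. \<rho> x s = 0}" using subspace_0[OF L] by simp
    qed (use subspace_add[OF L] subspace_scale[OF L] in \<open>auto simp: add scale\<close>)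
    then have "span {y\<in>L. \<exists>c>0. br h0 y = scale (of_real c) y} \<subseteq> {x\<in>L. \<rho> x s = 0}"
      using kill1 by (intro span_minimal) auto
    then show ?thesis using that by auto
  qed
  obtain v where v: "v \<in> coord e" "F v = s" using F(3) sW by (auto simp: bij_betw_def)
  have injF: "inj_on F (coord e)" using F(3) by (simp add: bij_betw_def)
  have fd: "act x v \<in> coord e" if "x \<in> L" for x
    using F(1) v that unfolding irreducible_module_def fd_module_def by blast
  have "highest_weight_module G H B L (\<mu> M) e act"
    unfolding highest_weight_module_def
  proof (intro conjI F(1) bexI[of _ v] ballI v)
    show "v \<noteq> 0" using v M pmp.linear_0[OF F(2)] by auto
    fix h assume h: "h \<in> H"
    show "act h v = pm_scale (\<mu> M h) v"
      using h H by (intro inj_onD[OF injF] fd pm.subspace_scale[OF coord_subspace] v)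
        (auto simp: F(4) v pmp.linear_scale[OF F(2)] wts \<mu> MK)
  next
    fix x assume x: "x \<in> L \<inter> nilrad G H B"
    then have "\<rho> x s = 0" using kill raise by auto
    then show "act x v = 0"
      using x by (intro inj_onD[OF injF] fd pm.subspace_0[OF coord_subspace])
        (auto simp: F(4) v pmp.linear_0[OF F(2)])
  qed
  moreover have "Poly_Mapping.keys (F v) \<subseteq> K" if "v \<in> coord e" for v
    using F(3) W(2) that by (auto simp: bij_betw_def)
  ultimately show ?thesis using that MK F(2,4) injF by blast
qed

text \<open>In the infinite-dimensional case the value is infinity, so only a finite-dimensional
  space with a nonzero vector has to be considered.\<close>

lemma edim_nonzero:
  assumes "vector_space s" "f \<in> S" "f \<noteq> 0"
  shows "edim s S \<noteq> 0"
proof -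
  interpret vector_space s by fact
  show ?thesis
  proof
    assume 0: "edim s S = 0"
    then obtain B where B: "finite B" "S \<subseteq> span B" "dim S = 0"
      unfolding edim_def by (auto split: if_splits simp: zero_enat_def)
    obtain b where b: "b \<subseteq> S" "independent b" "S \<subseteq> span b" "card b = dim S" using basis_exists by blast
    have "finite b" using independent_span_bound[OF B(1) b(2)] b(1) B(2) by auto
    then have "b = {}" using b B by auto
    then show False using b assms by auto
  qed
qed

lemma edim_zero:
  assumes "vector_space s" "S \<subseteq> {0}"
  shows "edim s S = 0"
proof -
  interpret vector_space s by fact
  have "dim S \<le> card ({}::'a set)"
    using assms by (intro dim_le_card) auto
  moreover have "S \<subseteq> span {}" using assms by simp
  ultimately show ?thesis
    unfolding edim_def using exI[of "\<lambda>B. finite B \<and> S \<subseteq> span B" "{}"] by (simp add: zero_enat_def)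
qed

lemma vector_space_fun_scale: "vector_space (\<lambda>c (f :: 'x \<Rightarrow> ('j \<Rightarrow>\<^sub>0 complex)) v. pm_scale c (f v))"
  by unfold_locales (auto simp: fun_eq_iff pm.scale_right_distrib pm.scale_left_distrib)

section \<open>Parabolic subalgebras of so(7)\<close>

lemma UNIV_7: "(UNIV :: 7 set) = {1, 2, 3, 4, 5, 6, 7}"
  by (rule sym, rule card_subset_eq) simp_all

lemma forall_7: "(\<forall>k::7. P k) \<longleftrightarrow> P 1 \<and> P 2 \<and> P 3 \<and> P 4 \<and> P 5 \<and> P 6 \<and> P 7"
proof -
  have "(\<forall>k::7. P k) \<longleftrightarrow> (\<forall>k\<in>UNIV. P k)" by simp
  also have "\<dots> \<longleftrightarrow> P 1 \<and> P 2 \<and> P 3 \<and> P 4 \<and> P 5 \<and> P 6 \<and> P 7" unfolding UNIV_7 by simp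
  finally show ?thesis .
qed

text \<open>In the type \<open>7\<close> the index \<open>8 - k\<close> dual to \<open>k\<close> is \<open>1 - k\<close>.\<close>

lemma so7_iff: "X \<in> so7 \<longleftrightarrow> (\<forall>a b. X $ (1 - b) $ (1 - a) = - X $ a $ b)"
proof -
  have "(transpose X ** form7 + form7 ** X) $ a $ b = X $ (1 - b) $ a + X $ (1 - a) $ b" for a b
  proof -
    have "(k + b = 8) = (k = 1 - b)" "(a + k = 8) = (k = 1 - a)" for k :: 7
      by (auto simp: algebra_simps)
    then show ?thesis
      by (simp add: matrix_matrix_mult_def transpose_def form7_def if_distrib if_distribR cong: if_cong)
  qed
  then have "X \<in> so7 \<longleftrightarrow> (\<forall>a b. X $ (1 - b) $ a + X $ (1 - a) $ b = 0)"
    by (simp add: so7_def vec_eq_iff)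
  also have "\<dots> \<longleftrightarrow> (\<forall>a b. X $ (1 - b) $ (1 - a) + X $ a $ b = 0)"
  proof safe
    fix a b assume "\<forall>a b. X $ (1 - b) $ a + X $ (1 - a) $ b = 0"
    then have "X $ (1 - b) $ (1 - a) + X $ (1 - (1 - a)) $ b = 0" by blast
    then show "X $ (1 - b) $ (1 - a) + X $ a $ b = 0" by simp
  next
    fix a b assume "\<forall>a b. X $ (1 - b) $ (1 - a) + X $ a $ b = 0"
    then have "X $ (1 - b) $ (1 - (1 - a)) + X $ (1 - a) $ b = 0" by blast
    then show "X $ (1 - b) $ a + X $ (1 - a) $ b = 0" by simp
  qed
  finally show ?thesis by (simp add: eq_neg_iff_add_eq_0)
qed

lemma so7_antidiagonal: "X \<in> so7 \<Longrightarrow> X $ k $ (1 - k) = 0"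
proof -
  assume "X \<in> so7"
  then have "X $ (1 - (1 - k)) $ (1 - k) = - X $ k $ (1 - k)" unfolding so7_iff by blast
  then show ?thesis by simp
qed

lemma commutator_nth: "commutator X Y $ a $ b = (\<Sum>c\<in>UNIV. X $ a $ c * Y $ c $ b - Y $ a $ c * X $ c $ b)"
  by (simp add: commutator_def matrix_matrix_mult_def sum_subtractf)

lemma so7_commutator:
  assumes "X \<in> so7" "Y \<in> so7"
  shows "commutator X Y \<in> so7"
  unfolding so7_iff
proof (intro allI)
  fix a b
  have "commutator X Y $ (1 - b) $ (1 - a) =
      (\<Sum>c\<in>UNIV. X $ (1 - b) $ (1 - c) * Y $ (1 - c) $ (1 - a) - Y $ (1 - b) $ (1 - c) * X $ (1 - c) $ (1 - a))"
    unfolding commutator_nth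
    by (rule sum.reindex_bij_witness[where i = "\<lambda>c. 1 - c" and j = "\<lambda>c. 1 - c"]) auto
  also have "\<dots> = (\<Sum>c\<in>UNIV. X $ c $ b * Y $ a $ c - Y $ c $ b * X $ a $ c)"
    using assms unfolding so7_iff by simp
  also have "\<dots> = - commutator X Y $ a $ b"
    unfolding commutator_nth by (simp add: sum_negf[symmetric] mult.commute)
  finally show "commutator X Y $ (1 - b) $ (1 - a) = - commutator X Y $ a $ b" .
qed

lemma mat_scale_nth [simp]: "mat_scale c X $ a $ b = c * X $ a $ b"
  by (simp add: mat_scale_def)

lemma so7_subspace: "gl7.subspace so7"
  by (rule gl7.subspaceI) (auto simp: so7_iff)

text \<open>The diagonal of a matrix in the Cartan subalgebra of so(7). Integer values describe
  gradings, complex values weights; the polymorphism lets \<open>of_int\<close> pass from one to the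
  other.\<close>

definition wvec :: "'a::{zero,uminus} \<Rightarrow> 'a \<Rightarrow> 'a \<Rightarrow> 7 \<Rightarrow> 'a" where
  "wvec x y z k = (if k = 1 then x else if k = 2 then y else if k = 3 then z else if k = 4 then 0
     else if k = 5 then - z else if k = 6 then - y else - x)"

lemma wvec_simps [simp]:
  "wvec x y z 1 = x" "wvec x y z 2 = y" "wvec x y z 3 = z" "wvec x y z 4 = 0"
  "wvec x y z 5 = - z" "wvec x y z 6 = - y" "wvec x y z 7 = - x" "wvec x y z 0 = - x"
  "wvec x y z (- 1) = - y" "wvec x y z (- 2) = - z" "wvec x y z (- 3) = 0"
  "wvec x y z (- 4) = z" "wvec x y z (- 5) = y" "wvec x y z (- 6) = x"
  by (simp_all add: wvec_def)

lemma wvec_mirror [simp]: "wvec x y z (1 - k) = - wvec x y (z :: 'a::ab_group_add) k"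
proof -
  have "\<forall>k. wvec x y z (1 - k) = - wvec x y z k" unfolding forall_7 by simp
  then show ?thesis by blast
qed

lemma of_int_wvec: "of_int (wvec x y z k) = wvec (of_int x) (of_int y) (of_int z) k"
  by (simp add: wvec_def)

text \<open>The matrix unit at \<open>(k, l)\<close> antisymmetrised about the antidiagonal, a root
  vector for \<open>eps k - eps l\<close> in general. Each root vector appears twice up to sign,
  since mirroring both indices and swapping them gives \<open>- R k l\<close>.\<close>

definition R :: "7 \<Rightarrow> 7 \<Rightarrow> complex^7^7" where
  "R k l = (\<chi> a b. (if a = k \<and> b = l then 1 else 0) - (if a = 1 - l \<and> b = 1 - k then 1 else 0))"

lemma R_nth: "R k l $ a $ b = (if a = k \<and> b = l then 1 else 0) - (if a = 1 - l \<and> b = 1 - k then 1 else 0)"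
  by (simp add: R_def)

lemma mirror_eq: "1 - a = b \<longleftrightarrow> a = 1 - b" for a b :: 7
  by (metis diff_diff_eq2 add_diff_cancel_left')

lemma R_so7: "R k l \<in> so7"
  unfolding so7_iff R_nth by (simp add: mirror_eq[of _ k] mirror_eq[of _ l] conj_commute)

lemma R_mirror: "R (1 - l) (1 - k) = - R k l"
  by (simp add: vec_eq_iff R_nth)

lemma R_antidiagonal: "R k (1 - k) = 0"
  by (simp add: vec_eq_iff R_nth)

text \<open>With \<open>R k l\<close> written as a matrix unit minus its mirror image, the four
  terms belong to the two ways in which the index pairs match directly and the two in which they
  match after mirroring.\<close>

lemma commutator_R:
  "commutator (R k l) (R m n) = (if l = m then R k n else 0) - (if n = k then R m l else 0)
     - (if l = 1 - n then R k (1 - m) else 0) + (if m = 1 - k then R (1 - n) l else 0)"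
proof -
  define E :: "7 \<Rightarrow> 7 \<Rightarrow> complex^7^7" where "E k l = (\<chi> a b. if a = k \<and> b = l then 1 else 0)" for k l
  have RE: "R k l = E k l - E (1 - l) (1 - k)" for k l by (simp add: R_def E_def vec_eq_iff)
  have EE: "E k l ** E m n = (if l = m then E k n else 0)" for k l m n
  proof -
    have "(\<Sum>c\<in>UNIV. (if a = k \<and> c = l then 1 else 0) * (if c = m \<and> b = n then 1 else (0::complex))) =
        (\<Sum>c\<in>UNIV. if c = l then (if a = k \<and> l = m \<and> b = n then 1 else 0) else 0)" for a b
      by (rule sum.cong) auto
    then show ?thesis by (auto simp: vec_eq_iff E_def matrix_matrix_mult_def)
  qed
  have dist: "(A - B) ** C = A ** C - B ** C" "C ** (A - B) = C ** A - C ** B" for A B C :: "complex^7^7"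
    by (simp_all add: vec_eq_iff matrix_matrix_mult_def sum_subtractf algebra_simps)
  have eqs: "(1 - k = m) = (m = 1 - k)" "(1 - m = k) = (m = 1 - k)" "(n = 1 - l) = (l = 1 - n)"
    "(1 - k = 1 - n) = (n = k)" "(1 - m = 1 - l) = (l = m)"
    by auto
  show ?thesis
    unfolding commutator_def RE dist EE eqs
    by (cases "l = m"; cases "n = k"; cases "l = 1 - n"; cases "m = 1 - k") simp_all
qed

text \<open>The sum over all index pairs meets every root vector twice, as \<open>R k l\<close> and
  as its mirror image; hence the division by 2.\<close>

lemma so7_expansion:
  assumes "X \<in> so7"
  shows "X = (\<Sum>k\<in>UNIV. \<Sum>l\<in>UNIV. mat_scale (X $ k $ l / 2) (R k l))"
proof -
  have "(\<Sum>k\<in>UNIV. \<Sum>l\<in>UNIV. mat_scale (X $ k $ l / 2) (R k l)) $ a $ b = X $ a $ b" for a b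
  proof -
    have "(\<Sum>k\<in>UNIV. \<Sum>l\<in>UNIV. mat_scale (X $ k $ l / 2) (R k l)) $ a $ b =
       (\<Sum>k\<in>UNIV. \<Sum>l\<in>UNIV. (if l = b then if k = a then X $ a $ b / 2 else 0 else 0) -
          (if l = 1 - a then if k = 1 - b then X $ (1 - b) $ (1 - a) / 2 else 0 else 0))"
      by (simp add: R_nth) (intro sum.cong refl, auto)
    also have "\<dots> = X $ a $ b / 2 - X $ (1 - b) $ (1 - a) / 2"
      by (simp add: sum_subtractf)
    finally show ?thesis using assms unfolding so7_iff by simp
  qed
  then show ?thesis by (simp add: vec_eq_iff)
qed

lemma cartan7_commutator:
  assumes "T \<in> cartan7"
  shows "commutator T X $ a $ b = (T $ a $ a - T $ b $ b) * X $ a $ b"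
proof -
  have T: "T $ i $ j = 0" if "i \<noteq> j" for i j using assms that by (simp add: cartan7_def)
  have "commutator T X $ a $ b = (\<Sum>c\<in>UNIV. (if c = a then T $ a $ a * X $ a $ b else 0)
      - (if c = b then X $ a $ b * T $ b $ b else 0))"
    unfolding commutator_nth by (intro sum.cong refl) (simp add: T)
  then show ?thesis by (simp add: sum_subtractf algebra_simps)
qed

lemma cartan7_mirror: "T \<in> cartan7 \<Longrightarrow> T $ (1 - k) $ (1 - k) = - T $ k $ k"
  by (auto simp: cartan7_def so7_iff)

definition D :: "complex \<Rightarrow> complex \<Rightarrow> complex \<Rightarrow> complex^7^7" where
  "D x y z = (\<chi> a b. if a = b then wvec x y z a else 0)"

lemma D_nth: "D x y z $ a $ b = (if a = b then wvec x y z a else 0)"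
  by (simp add: D_def)

lemma D_cartan7: "D x y z \<in> cartan7"
  by (auto simp: cartan7_def so7_iff D_nth)

lemma cartan7_subspace: "gl7.subspace cartan7"
  by (rule gl7.subspaceI) (auto simp: cartan7_def so7_iff)

lemma root_space_so7_iff:
  "X \<in> gl7.root_space so7 cartan7 \<beta> \<longleftrightarrow>
     X \<in> so7 \<and> (\<forall>T\<in>cartan7. \<forall>a b. X $ a $ b \<noteq> 0 \<longrightarrow> T $ a $ a - T $ b $ b = \<beta> T)"
  unfolding gl7.root_space_def by (auto simp: vec_eq_iff cartan7_commutator)

lemma wvec_inject:
  assumes "wvec x y z a = wvec x y z b" "0 < z" "z < y" "y < (x::int)"
  shows "a = b"
proof -
  have "\<forall>a b. wvec x y z a = wvec x y z b \<longrightarrow> a = b" unfolding forall_7 using assms(2-4) by simp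
  then show ?thesis using assms(1) by blast
qed

text \<open>A difference \<open>p - q\<close> determines the product \<open>p * q\<close>, hence the unordered pair \<open>p, - q\<close>.\<close>

lemma wvec_9_3_1_difference:
  fixes a b k l :: 7
  assumes eq: "wvec 9 3 (1::int) a - wvec 9 3 1 b = wvec 9 3 1 k - wvec 9 3 1 l"
    and "k \<noteq> l" "k \<noteq> 1 - l" "a \<noteq> 1 - b"
  shows "a = k \<and> b = l \<or> a = 1 - l \<and> b = 1 - k"
proof -
  let ?w = "wvec 9 3 (1::int)"
  \<comment> \<open>The positive roots take the distinct values 1, 2, 3, 4, 6, 8, 9, 10, 12 on
    \<open>D 9 3 1\<close>, and \<open>F\<close> lists the corresponding products of two entries.
    Antidiagonal pairs must be left out, since 3 - (-3) = 9 - 3 and 1 - (-1) = 3 - 1.\<close>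
  define F :: "int \<Rightarrow> int" where
    "F d = (if d = 2 then 3 else if d = 4 then -3 else if d = 6 then 27 else if d = 8 then 9
       else if d = 10 then -9 else if d = 12 then -27 else 0)" for d
  have "\<forall>a b. a \<noteq> b \<longrightarrow> a \<noteq> 1 - b \<longrightarrow> ?w a * ?w b = F \<bar>?w a - ?w b\<bar>"
    unfolding forall_7 F_def by simp
  moreover have "a \<noteq> b" using eq assms(2) wvec_inject[of 9 3 1 k l] by auto
  ultimately have "?w a * ?w b = ?w k * ?w l" using assms by simp
  moreover have "(?w a - ?w k) * (?w a + ?w l) = ?w a * (?w a - ?w b - (?w k - ?w l)) + (?w a * ?w b - ?w k * ?w l)"
    by (simp add: algebra_simps)
  ultimately have "(?w a - ?w k) * (?w a + ?w l) = 0" using eq by simp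
  then consider "?w a = ?w k" "?w b = ?w l" | "?w a = ?w (1 - l)" "?w b = ?w (1 - k)"
    using eq by auto
  then show ?thesis using wvec_inject[of 9 3 1] by cases auto
qed

definition root7 :: "7 \<Rightarrow> 7 \<Rightarrow> complex^7^7 \<Rightarrow> complex" where
  "root7 k l = eps k - eps l"

lemma root7_apply: "root7 k l T = (if T \<in> cartan7 then T $ k $ k - T $ l $ l else 0)"
  by (simp add: root7_def eps_def)

lemma uminus_root7: "- root7 k l = root7 l k"
  by (simp add: root7_def)

lemma R_nth_self: "k \<noteq> 1 - l \<Longrightarrow> R k l $ k $ l = 1"
  by (simp add: R_nth)

lemma R_in_root_space: "R k l \<in> gl7.root_space so7 cartan7 (root7 k l)"
  unfolding root_space_so7_iff
  by (auto simp: R_so7 R_nth root7_apply cartan7_mirror split: if_splits)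

lemma so7_eq_scale_R:
  assumes "X \<in> so7" "k \<noteq> l" "k \<noteq> 1 - l"
    and "\<And>a b. X $ a $ b \<noteq> 0 \<Longrightarrow> a = k \<and> b = l \<or> a = 1 - l \<and> b = 1 - k"
  shows "X = mat_scale (X $ k $ l) (R k l)"
proof -
  have "X $ (1 - l) $ (1 - k) = - X $ k $ l" using assms(1) so7_iff by blast
  moreover have "X $ a $ b = 0" if "\<not> (a = k \<and> b = l)" "\<not> (a = 1 - l \<and> b = 1 - k)" for a b
    using assms(4) that by blast
  ultimately show ?thesis
    using assms(3) by (auto simp: vec_eq_iff R_nth mirror_eq)
qed

text \<open>By the choice of 9, 3, 1 a single Cartan element separates the roots, so a root vector
  has no entries outside the position \<open>(k, l)\<close> and its mirror image.\<close>

lemma root_space_root7: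
  assumes "k \<noteq> l" "k \<noteq> 1 - l"
  shows "gl7.root_space so7 cartan7 (root7 k l) = range (\<lambda>c. mat_scale c (R k l))"
proof (intro equalityI subsetI)
  fix X assume X: "X \<in> gl7.root_space so7 cartan7 (root7 k l)"
  have "X = mat_scale (X $ k $ l) (R k l)"
  proof (rule so7_eq_scale_R[OF _ assms])
    show "X \<in> so7" using X by (simp add: root_space_so7_iff)
    fix a b assume ab: "X $ a $ b \<noteq> 0"
    then have "a \<noteq> 1 - b" using X so7_antidiagonal[of X "1 - b"] by (auto simp: root_space_so7_iff)
    have "D 9 3 1 $ a $ a - D 9 3 1 $ b $ b = root7 k l (D 9 3 1)"
      using X ab D_cartan7[of 9 3 1] unfolding root_space_so7_iff by blast
    then have "of_int (wvec 9 3 1 a - wvec 9 3 1 b) = (of_int (wvec 9 3 1 k - wvec 9 3 1 l) :: complex)"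
      by (simp add: root7_apply D_cartan7 D_nth of_int_wvec)
    then have "wvec 9 3 1 a - wvec 9 3 1 b = wvec 9 3 (1::int) k - wvec 9 3 1 l"
      by (simp only: of_int_eq_iff)
    then show "a = k \<and> b = l \<or> a = 1 - l \<and> b = 1 - k"
      using wvec_9_3_1_difference assms \<open>a \<noteq> 1 - b\<close> by blast
  qed
  then show "X \<in> range (\<lambda>c. mat_scale c (R k l))" by blast
next
  fix X assume "X \<in> range (\<lambda>c. mat_scale c (R k l))"
  then show "X \<in> gl7.root_space so7 cartan7 (root7 k l)"
    using R_in_root_space[of k l] gl7.subspace_scale[OF so7_subspace] by (auto simp: root_space_so7_iff)
qed

text \<open>Any nonzero entry of a root vector names its root; conversely these functionals are
  nonzero because they are nonzero on \<open>D 9 3 1\<close>.\<close>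

lemma roots_so7: "gl7.roots so7 cartan7 = {root7 k l |k l. k \<noteq> l \<and> k \<noteq> 1 - l}"
proof (intro equalityI subsetI)
  fix \<beta> assume \<beta>: "\<beta> \<in> gl7.roots so7 cartan7"
  have "0 \<in> gl7.root_space so7 cartan7 \<beta>"
    using gl7.subspace_0[OF so7_subspace] by (simp add: root_space_so7_iff)
  then obtain X where X: "X \<in> gl7.root_space so7 cartan7 \<beta>" "X \<noteq> 0"
    using \<beta> unfolding gl7.roots_def by blast
  then obtain a b where ab: "X $ a $ b \<noteq> 0" by (auto simp: vec_eq_iff)
  have eq: "T $ a $ a - T $ b $ b = \<beta> T" if "T \<in> cartan7" for T
    using X(1) ab that unfolding root_space_so7_iff by blast
  have off: "\<beta> T = 0" if "T \<notin> cartan7" for T using \<beta> that by (auto simp: gl7.roots_def gl7.dual_def)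
  have "\<beta> = root7 a b" using eq off by (auto simp: fun_eq_iff root7_apply)
  moreover have "a \<noteq> b" using \<beta> calculation by (auto simp: gl7.roots_def root7_def fun_eq_iff)
  moreover have "a \<noteq> 1 - b" using X(1) ab so7_antidiagonal[of X "1 - b"] by (auto simp: root_space_so7_iff)
  ultimately show "\<beta> \<in> {root7 k l |k l. k \<noteq> l \<and> k \<noteq> 1 - l}" by blast
next
  fix \<beta> assume "\<beta> \<in> {root7 k l |k l. k \<noteq> l \<and> k \<noteq> 1 - l}"
  then obtain k l where kl: "\<beta> = root7 k l" "k \<noteq> l" "k \<noteq> 1 - l" by blast
  have "root7 k l (D 9 3 1) = of_int (wvec 9 3 1 k - wvec 9 3 1 l)"
    by (simp add: root7_apply D_cartan7 D_nth of_int_wvec)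
  also have "\<dots> \<noteq> 0" using wvec_inject[of 9 3 1 k l] kl(2) by (simp only: of_int_eq_0_iff) auto
  finally have "\<beta> \<noteq> (\<lambda>_. 0)" unfolding kl(1) by (auto simp: fun_eq_iff)
  moreover have "\<beta> \<in> gl7.dual cartan7"
    using gl7.subspace_add[OF cartan7_subspace] gl7.subspace_scale[OF cartan7_subspace]
    by (auto simp: kl(1) gl7.dual_def linear_on_def root7_apply algebra_simps)
  moreover have "R k l \<in> gl7.root_space so7 cartan7 \<beta>" "R k l \<noteq> 0"
    using R_in_root_space R_nth_self[OF kl(3)] by (auto simp: kl(1))
  ultimately show "\<beta> \<in> gl7.roots so7 cartan7"
    unfolding gl7.roots_def by auto
qed

text \<open>The part of so(7) whose degrees satisfy \<open>Q\<close>, in the grading where \<open>R k l\<close> has degree \<open>w k - w l\<close>.\<close>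

definition graded :: "(7 \<Rightarrow> int) \<Rightarrow> (int \<Rightarrow> bool) \<Rightarrow> (complex^7^7) set" where
  "graded w Q = {X\<in>so7. \<forall>a b. X $ a $ b \<noteq> 0 \<longrightarrow> Q (w a - w b)}"

lemma gradedD: "X \<in> graded w Q \<Longrightarrow> X $ a $ b \<noteq> 0 \<Longrightarrow> Q (w a - w b)"
  by (simp add: graded_def)

lemma gradedI: "X \<in> so7 \<Longrightarrow> (\<And>a b. X $ a $ b \<noteq> 0 \<Longrightarrow> Q (w a - w b)) \<Longrightarrow> X \<in> graded w Q"
  by (simp add: graded_def)

lemma graded_so7: "X \<in> graded w Q \<Longrightarrow> X \<in> so7"
  by (simp add: graded_def)

lemma graded_subspace: "gl7.subspace (graded w Q)"
proof (rule gl7.subspaceI)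
  fix X Y assume XY: "X \<in> graded w Q" "Y \<in> graded w Q"
  have "(X + Y) $ a $ b \<noteq> 0 \<Longrightarrow> X $ a $ b \<noteq> 0 \<or> Y $ a $ b \<noteq> 0" for a b by auto
  then show "X + Y \<in> graded w Q"
    using XY gl7.subspace_add[OF so7_subspace] unfolding graded_def by blast
qed (use gl7.subspace_0[OF so7_subspace] gl7.subspace_scale[OF so7_subspace] in \<open>auto simp: graded_def\<close>)

lemma graded_commutator:
  assumes "X \<in> graded w Q1" "Y \<in> graded w Q2"
    and "\<And>m n. Q1 m \<Longrightarrow> Q2 n \<Longrightarrow> Q3 (m + n)"
  shows "commutator X Y \<in> graded w Q3"
proof -
  have "Q3 (w a - w b)" if ab: "commutator X Y $ a $ b \<noteq> 0" for a b
  proof -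
    obtain c where "X $ a $ c * Y $ c $ b - Y $ a $ c * X $ c $ b \<noteq> 0"
      using ab unfolding commutator_nth by (meson sum.not_neutral_contains_not_neutral)
    then have "X $ a $ c \<noteq> 0 \<and> Y $ c $ b \<noteq> 0 \<or> Y $ a $ c \<noteq> 0 \<and> X $ c $ b \<noteq> 0" by auto
    then have "(Q1 (w a - w c) \<and> Q2 (w c - w b)) \<or> (Q1 (w c - w b) \<and> Q2 (w a - w c))"
      using gradedD[OF assms(1)] gradedD[OF assms(2)] by meson
    then show ?thesis
      using assms(3)[of "w a - w c" "w c - w b"] assms(3)[of "w c - w b" "w a - w c"] by auto
  qed
  then show ?thesis
    by (intro gradedI so7_commutator graded_so7[OF assms(1)] graded_so7[OF assms(2)])
qed

definition antisym7 :: "(7 \<Rightarrow> int) \<Rightarrow> bool" where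
  "antisym7 w \<longleftrightarrow> (\<forall>k. w (1 - k) = - w k)"

lemma antisym7_wvec: "antisym7 (wvec x y z)"
  by (simp add: antisym7_def)

lemma R_in_graded:
  assumes "antisym7 w" "Q (w k - w l)"
  shows "R k l \<in> graded w Q"
  using assms by (auto simp: graded_def R_so7 R_nth antisym7_def split: if_splits)

lemma R_in_graded_iff:
  assumes "antisym7 w" "k \<noteq> 1 - l"
  shows "R k l \<in> graded w Q \<longleftrightarrow> Q (w k - w l)"
proof
  assume "R k l \<in> graded w Q"
  moreover have "R k l $ k $ l \<noteq> 0" using R_nth_self[OF assms(2)] by simp
  ultimately show "Q (w k - w l)" by (rule gradedD)
qed (rule R_in_graded[OF assms(1)])

lemma in_subspace_if_R:
  assumes "gl7.subspace S" "X \<in> so7" "\<And>k l. X $ k $ l \<noteq> 0 \<Longrightarrow> k \<noteq> 1 - l \<Longrightarrow> R k l \<in> S"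
  shows "X \<in> S"
proof (subst so7_expansion[OF assms(2)], intro gl7.subspace_sum[OF assms(1)])
  fix k l
  show "mat_scale (X $ k $ l / 2) (R k l) \<in> S"
  proof (cases "X $ k $ l = 0 \<or> k = 1 - l")
    case True
    then have "mat_scale (X $ k $ l / 2) (R k l) = 0"
      using R_antidiagonal[of "1 - l"] by auto
    then show ?thesis using gl7.subspace_0[OF assms(1)] by (simp only:)
  qed (use assms(3) gl7.subspace_scale[OF assms(1)] in auto)
qed

lemma graded_subset:
  assumes "gl7.subspace S" "\<And>k l. Q (w k - w l) \<Longrightarrow> k \<noteq> 1 - l \<Longrightarrow> R k l \<in> S"
  shows "graded w Q \<subseteq> S"
proof
  fix X assume X: "X \<in> graded w Q"
  show "X \<in> S"
    by (rule in_subspace_if_R[OF assms(1) graded_so7[OF X]]) (rule assms(2)[OF gradedD[OF X]])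
qed

lemma R_diagonal: "R k k \<in> cartan7"
  by (auto simp: cartan7_def R_so7 R_nth)

lemma cartan7_graded: "Q 0 \<Longrightarrow> cartan7 \<subseteq> graded w Q"
  by (rule subsetI, rule gradedI) (auto simp: cartan7_def, metis diff_self)

lemma root_space_subset_graded:
  assumes "antisym7 w" "k \<noteq> l" "k \<noteq> 1 - l"
  shows "gl7.root_space so7 cartan7 (root7 k l) \<subseteq> graded w Q \<longleftrightarrow> Q (w k - w l)"
proof
  assume "gl7.root_space so7 cartan7 (root7 k l) \<subseteq> graded w Q"
  then show "Q (w k - w l)" using R_in_root_space R_in_graded_iff[OF assms(1,3)] by blast
next
  assume "Q (w k - w l)"
  then show "gl7.root_space so7 cartan7 (root7 k l) \<subseteq> graded w Q"
    using R_in_graded[OF assms(1)] gl7.subspace_scale[OF graded_subspace]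
    by (auto simp: root_space_root7[OF assms(2,3)])
qed

section \<open>Levi part and nilradicals of the part of degree \<ge> 0\<close>

context
  fixes w :: "7 \<Rightarrow> int" and p :: "(complex^7^7) set"
  assumes w: "antisym7 w" and p: "p = graded w (\<lambda>n. 0 \<le> n)"
begin

private lemma root_cases:
  assumes "k \<noteq> l" "k \<noteq> 1 - l"
  shows "gl7.root_space so7 cartan7 (root7 k l) \<subseteq> p \<longleftrightarrow> w l \<le> w k"
    "gl7.root_space so7 cartan7 (- root7 k l) \<subseteq> p \<longleftrightarrow> w k \<le> w l"
proof -
  have "l \<noteq> k" "l \<noteq> 1 - k" using assms by auto
  then show "gl7.root_space so7 cartan7 (root7 k l) \<subseteq> p \<longleftrightarrow> w l \<le> w k"
    "gl7.root_space so7 cartan7 (- root7 k l) \<subseteq> p \<longleftrightarrow> w k \<le> w l"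
    unfolding p uminus_root7
    using root_space_subset_graded[OF w assms, of "\<lambda>n. 0 \<le> n"]
      root_space_subset_graded[OF w, of l k "\<lambda>n. 0 \<le> n"] by simp_all
qed

lemma levi_graded: "gl7.levi so7 cartan7 p = graded w (\<lambda>n. n = 0)"
  unfolding gl7.levi_def
proof (rule equalityI[OF gl7.span_minimal[OF _ graded_subspace] graded_subset[OF gl7.subspace_span]])
  show "cartan7 \<union> \<Union> (gl7.root_space so7 cartan7 ` {\<beta> \<in> gl7.roots so7 cartan7.
      gl7.root_space so7 cartan7 \<beta> \<subseteq> p \<and> gl7.root_space so7 cartan7 (- \<beta>) \<subseteq> p}) \<subseteq> graded w (\<lambda>n. n = 0)"
  proof (intro Un_least UN_least cartan7_graded)
    fix \<beta> assume \<beta>: "\<beta> \<in> {\<beta> \<in> gl7.roots so7 cartan7.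
      gl7.root_space so7 cartan7 \<beta> \<subseteq> p \<and> gl7.root_space so7 cartan7 (- \<beta>) \<subseteq> p}"
    then obtain k l where kl: "\<beta> = root7 k l" "k \<noteq> l" "k \<noteq> 1 - l" unfolding roots_so7 by blast
    show "gl7.root_space so7 cartan7 \<beta> \<subseteq> graded w (\<lambda>n. n = 0)"
      using \<beta> root_cases[OF kl(2,3)] unfolding kl(1) root_space_subset_graded[OF w kl(2,3)] by simp
  qed simp
  fix k l assume kl: "w k - w l = 0" "k \<noteq> 1 - l"
  show "R k l \<in> gl7.span (cartan7 \<union> \<Union> (gl7.root_space so7 cartan7 ` {\<beta> \<in> gl7.roots so7 cartan7.
      gl7.root_space so7 cartan7 \<beta> \<subseteq> p \<and> gl7.root_space so7 cartan7 (- \<beta>) \<subseteq> p}))"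
  proof (cases "k = l")
    case False
    then have "root7 k l \<in> {\<beta> \<in> gl7.roots so7 cartan7.
      gl7.root_space so7 cartan7 \<beta> \<subseteq> p \<and> gl7.root_space so7 cartan7 (- \<beta>) \<subseteq> p}"
      using kl root_cases[of k l] unfolding roots_so7 by auto
    then show ?thesis using R_in_root_space[of k l] by (intro gl7.span_base) blast
  qed (use R_diagonal in \<open>auto intro: gl7.span_base\<close>)
qed

lemma nilrad_graded: "gl7.nilrad so7 cartan7 p = graded w (\<lambda>n. 0 < n)"
  unfolding gl7.nilrad_def
proof (rule equalityI[OF gl7.span_minimal[OF _ graded_subspace] graded_subset[OF gl7.subspace_span]])
  show "\<Union> (gl7.root_space so7 cartan7 ` {\<beta> \<in> gl7.roots so7 cartan7.
      gl7.root_space so7 cartan7 \<beta> \<subseteq> p \<and> \<not> gl7.root_space so7 cartan7 (- \<beta>) \<subseteq> p}) \<subseteq> graded w (\<lambda>n. 0 < n)"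
  proof (intro UN_least)
    fix \<beta> assume \<beta>: "\<beta> \<in> {\<beta> \<in> gl7.roots so7 cartan7.
      gl7.root_space so7 cartan7 \<beta> \<subseteq> p \<and> \<not> gl7.root_space so7 cartan7 (- \<beta>) \<subseteq> p}"
    then obtain k l where kl: "\<beta> = root7 k l" "k \<noteq> l" "k \<noteq> 1 - l" unfolding roots_so7 by blast
    show "gl7.root_space so7 cartan7 \<beta> \<subseteq> graded w (\<lambda>n. 0 < n)"
      using \<beta> root_cases[OF kl(2,3)] unfolding kl(1) root_space_subset_graded[OF w kl(2,3)] by simp
  qed
  fix k l assume kl: "0 < w k - w l" "k \<noteq> 1 - l"
  then have "k \<noteq> l" by auto
  then have "root7 k l \<in> {\<beta> \<in> gl7.roots so7 cartan7.
      gl7.root_space so7 cartan7 \<beta> \<subseteq> p \<and> \<not> gl7.root_space so7 cartan7 (- \<beta>) \<subseteq> p}"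
    using kl root_cases[of k l] unfolding roots_so7 by auto
  then show "R k l \<in> gl7.span (\<Union> (gl7.root_space so7 cartan7 ` {\<beta> \<in> gl7.roots so7 cartan7.
      gl7.root_space so7 cartan7 \<beta> \<subseteq> p \<and> \<not> gl7.root_space so7 cartan7 (- \<beta>) \<subseteq> p}))"
    using R_in_root_space[of k l] by (intro gl7.span_base) blast
qed

lemma opp_nilrad_graded: "gl7.opp_nilrad so7 cartan7 p = graded w (\<lambda>n. n < 0)"
  unfolding gl7.opp_nilrad_def
proof (rule equalityI[OF gl7.span_minimal[OF _ graded_subspace] graded_subset[OF gl7.subspace_span]])
  show "(\<Union>\<beta>\<in>{\<beta> \<in> gl7.roots so7 cartan7. gl7.root_space so7 cartan7 \<beta> \<subseteq> p \<and>
      \<not> gl7.root_space so7 cartan7 (- \<beta>) \<subseteq> p}. gl7.root_space so7 cartan7 (- \<beta>)) \<subseteq> graded w (\<lambda>n. n < 0)"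
  proof (intro UN_least)
    fix \<beta> assume \<beta>: "\<beta> \<in> {\<beta> \<in> gl7.roots so7 cartan7. gl7.root_space so7 cartan7 \<beta> \<subseteq> p \<and>
      \<not> gl7.root_space so7 cartan7 (- \<beta>) \<subseteq> p}"
    then obtain k l where kl: "\<beta> = root7 k l" "k \<noteq> l" "k \<noteq> 1 - l" unfolding roots_so7 by blast
    moreover have "l \<noteq> 1 - k" using kl(3) by auto
    ultimately show "gl7.root_space so7 cartan7 (- \<beta>) \<subseteq> graded w (\<lambda>n. n < 0)"
      using \<beta> root_cases[OF kl(2,3)] root_space_subset_graded[OF w kl(2)[symmetric], of "\<lambda>n. n < 0"]
      unfolding kl(1) by (simp add: uminus_root7)
  qed
  fix k l assume kl: "w k - w l < 0" "k \<noteq> 1 - l"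
  then have lk: "l \<noteq> k" "l \<noteq> 1 - k" by auto
  then have "root7 l k \<in> {\<beta> \<in> gl7.roots so7 cartan7.
      gl7.root_space so7 cartan7 \<beta> \<subseteq> p \<and> \<not> gl7.root_space so7 cartan7 (- \<beta>) \<subseteq> p}"
    using kl root_cases[of l k] unfolding roots_so7 by auto
  then show "R k l \<in> gl7.span (\<Union>\<beta>\<in>{\<beta> \<in> gl7.roots so7 cartan7. gl7.root_space so7 cartan7 \<beta> \<subseteq> p \<and>
      \<not> gl7.root_space so7 cartan7 (- \<beta>) \<subseteq> p}. gl7.root_space so7 cartan7 (- \<beta>))"
    using R_in_root_space[of k l, folded uminus_root7[of l k]] by (intro gl7.span_base) blast
qed

end

lemma negative_7: "(- 1 :: 7) = 6" "(- 2 :: 7) = 5" "(- 3 :: 7) = 4" "(- 4 :: 7) = 3" "(- 5 :: 7) = 2" "(- 6 :: 7) = 1" "(0 :: 7) = 7"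
  by simp_all

lemma cartan7_entries:
  assumes "T \<in> cartan7"
  shows "T $ 4 $ 4 = 0" "T $ 5 $ 5 = - T $ 3 $ 3" "T $ 6 $ 6 = - T $ 2 $ 2" "T $ 7 $ 7 = - T $ 1 $ 1"
  using cartan7_mirror[OF assms, of 1] cartan7_mirror[OF assms, of 2] cartan7_mirror[OF assms, of 3]
    cartan7_mirror[OF assms, of 4] by (simp_all add: negative_7)

lemma eta_root7: "eta 1 = root7 1 2" "eta 2 = root7 2 3" "eta 3 = root7 3 4"
proof -
  note cartan7_entries(1)
  then show "eta 1 = root7 1 2" "eta 2 = root7 2 3" "eta 3 = root7 3 4"
    by (auto simp: eta_def root7_def eps_def fun_eq_iff)
qed

text \<open>All three simple roots have degree 1 here, so \<open>ht k - ht l\<close> is the height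
  of the root \<open>eps k - eps l\<close>.\<close>

abbreviation ht :: "7 \<Rightarrow> int" where
  "ht \<equiv> wvec 3 2 1"

lemma borel7_graded: "borel7 = graded ht (\<lambda>n. 0 \<le> n)"
  unfolding borel7_def gl7.borel_def
proof (rule equalityI[OF gl7.span_minimal[OF _ graded_subspace] graded_subset[OF gl7.subspace_span]])
  let ?S = "{\<beta> \<in> gl7.roots so7 cartan7. \<exists>n. \<beta> = (\<lambda>x. \<Sum>k\<in>{1, 2, 3}. of_nat (n k) * eta k x)}"
  show "cartan7 \<union> \<Union> (gl7.root_space so7 cartan7 ` ?S) \<subseteq> graded ht (\<lambda>n. 0 \<le> n)"
  proof (intro Un_least UN_least cartan7_graded)
    fix \<beta> assume "\<beta> \<in> ?S"
    then obtain n k l where \<beta>: "\<beta> = (\<lambda>x. \<Sum>k\<in>{1, 2, 3}. of_nat (n k) * eta k x)"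
      "\<beta> = root7 k l" "k \<noteq> l" "k \<noteq> 1 - l" unfolding roots_so7 by blast
    have "root7 k l (D 3 2 1) = of_nat (n 1 + n 2 + n 3)"
      using fun_cong[OF \<beta>(1), of "D 3 2 1"] unfolding \<beta>(2)
      by (simp add: eta_root7[simplified] root7_apply D_cartan7 D_nth)
    then have "of_int (ht k - ht l) = (of_int (int (n 1 + n 2 + n 3)) :: complex)"
      by (simp add: root7_apply D_cartan7 D_nth of_int_wvec)
    then have "ht k - ht l = int (n 1 + n 2 + n 3)" by (simp only: of_int_eq_iff)
    then show "gl7.root_space so7 cartan7 \<beta> \<subseteq> graded ht (\<lambda>n. 0 \<le> n)"
      using root_space_subset_graded[OF antisym7_wvec \<beta>(3,4)] \<beta>(2) by simp
  qed simp
  fix k l :: 7 assume kl: "0 \<le> ht k - ht l" "k \<noteq> 1 - l"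
  show "R k l \<in> gl7.span (cartan7 \<union> \<Union> (gl7.root_space so7 cartan7 ` ?S))"
  proof (cases "k = l")
    case False
    \<comment> \<open>If the root is x \<open>eps 1\<close> + y \<open>eps 2\<close> + z
      \<open>eps 3\<close>, its coefficients at the simple roots are the partial sums x, x + y, x +
      y + z.\<close>
    define n :: "nat \<Rightarrow> int" where "n j = (if j = 1 then wvec 1 0 0 k - wvec 1 0 0 l
      else if j = 2 then wvec 1 1 0 k - wvec 1 1 0 l else wvec 1 1 1 k - wvec 1 1 1 l)" for j
    \<comment> \<open>A root of nonnegative height has no negative coefficient at a simple root;
      there are only finitely many index pairs to check.\<close>
    have "\<forall>k l. 0 \<le> ht k - ht l \<longrightarrow> 0 \<le> wvec 1 0 0 k - wvec 1 0 (0::int) l \<and>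
        0 \<le> wvec 1 1 0 k - wvec 1 1 (0::int) l \<and> 0 \<le> wvec 1 1 1 k - wvec 1 1 (1::int) l"
      unfolding forall_7 by simp
    then have n: "0 \<le> n j" for j using kl by (simp add: n_def)
    have "root7 k l = (\<lambda>x. \<Sum>k\<in>{1, 2, 3}. of_nat (nat (n k)) * eta k x)"
    proof
      fix T
      have T: "T $ j $ j = of_int (wvec 1 0 0 j) * T $ 1 $ 1 + of_int (wvec 0 1 0 j) * T $ 2 $ 2 + of_int (wvec 0 0 1 j) * T $ 3 $ 3"
        if "T \<in> cartan7" for j
      proof -
        have "\<forall>j. T $ j $ j = of_int (wvec 1 0 0 j) * T $ 1 $ 1 + of_int (wvec 0 1 0 j) * T $ 2 $ 2 + of_int (wvec 0 0 1 j) * T $ 3 $ 3"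
          unfolding forall_7 by (simp add: cartan7_entries[OF that])
        then show ?thesis by blast
      qed
      have wv: "wvec 1 1 0 j = wvec 1 0 0 j + wvec 0 1 (0::int) j" "wvec 1 1 1 j = wvec 1 0 0 j + wvec 0 1 0 j + wvec 0 0 (1::int) j" for j
        by (simp_all add: wvec_def)
      have of_nat: "of_nat (nat (n j)) = (of_int (n j) :: complex)" for j using n[of j] by simp
      show "root7 k l T = (\<Sum>k\<in>{1, 2, 3}. of_nat (nat (n k)) * eta k T)"
      proof (cases "T \<in> cartan7")
        case True
        show ?thesis
          using T[OF True, of k] T[OF True, of l] cartan7_entries(1)[OF True]
          by (simp add: eta_root7[simplified] root7_apply True of_nat) (simp add: n_def wv algebra_simps)
      qed (simp add: eta_root7[simplified] root7_apply)
    qed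
    then have "\<exists>n. root7 k l = (\<lambda>x. \<Sum>k\<in>{1, 2, 3}. of_nat (n k) * eta k x)"
      by (intro exI[of _ "\<lambda>k. nat (n k)"])
    moreover have "root7 k l \<in> gl7.roots so7 cartan7" using False kl(2) unfolding roots_so7 by blast
    ultimately have "root7 k l \<in> ?S" by simp
    then show ?thesis using R_in_root_space[of k l] by (intro gl7.span_base) blast
  qed (use R_diagonal in \<open>auto intro: gl7.span_base\<close>)
qed

text \<open>The grading in which the simple roots \<open>eta 1\<close>, \<open>eta 2\<close>,
  \<open>eta 3\<close> have the degrees \<open>a\<close>, \<open>b\<close>, \<open>c\<close>. A
  simple root belongs to the Levi part of the associated parabolic when its degree is 0 and to the
  nilradical when it is positive.\<close>

definition parabolic_degree :: "nat \<Rightarrow> nat \<Rightarrow> nat \<Rightarrow> 7 \<Rightarrow> int" where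
  "parabolic_degree a b c = wvec (int (a + b + c)) (int (b + c)) (int c)"

abbreviation par :: "nat \<Rightarrow> nat \<Rightarrow> nat \<Rightarrow> (complex^7^7) set" where
  "par a b c \<equiv> graded (parabolic_degree a b c) (\<lambda>n. 0 \<le> n)"

lemma antisym7_parabolic_degree: "antisym7 (parabolic_degree a b c)"
  by (simp add: parabolic_degree_def antisym7_wvec)

lemma parabolic_degree_mono: "ht l \<le> ht k \<Longrightarrow> parabolic_degree a b c l \<le> parabolic_degree a b c k"
proof -
  have "\<forall>k l. ht l \<le> ht k \<longrightarrow> parabolic_degree a b c l \<le> parabolic_degree a b c k"
    unfolding forall_7 parabolic_degree_def by simp
  then show "ht l \<le> ht k \<Longrightarrow> parabolic_degree a b c l \<le> parabolic_degree a b c k" by blast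
qed

lemma parabolic7_par: "parabolic7 (par a b c)"
  unfolding parabolic7_def gl7.subalgebra_def borel7_graded
proof (intro conjI ballI graded_subspace)
  show "commutator X Y \<in> par a b c" if "X \<in> par a b c" "Y \<in> par a b c" for X Y
    using that by (rule graded_commutator) simp
  show "graded ht (\<lambda>n. 0 \<le> n) \<subseteq> par a b c"
  proof
    fix X assume X: "X \<in> graded ht (\<lambda>n. 0 \<le> n)"
    show "X \<in> par a b c"
      by (rule gradedI[OF graded_so7[OF X]]) (use gradedD[OF X] parabolic_degree_mono in force)
  qed
  show "par a b c \<subseteq> so7" using graded_so7 by blast
qed

lemma par_0_0_0: "par 0 0 0 = so7"
  by (auto simp: graded_def parabolic_degree_def wvec_def)

section \<open>Classification of the parabolic subalgebras\<close>

context
  fixes p assumes p: "parabolic7 p"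
begin

private lemma sub: "gl7.subspace p" and br: "X \<in> p \<Longrightarrow> Y \<in> p \<Longrightarrow> commutator X Y \<in> p"
  and bor: "borel7 \<subseteq> p" and so7: "p \<subseteq> so7"
  using p by (auto simp: parabolic7_def gl7.subalgebra_def)

text \<open>The side conditions rule out the other three terms of the commutator, leaving
  \<open>R k m\<close> alone.\<close>

private lemma R_trans:
  assumes "R k l \<in> p" "R l m \<in> p" "k \<noteq> m" "l \<noteq> 1 - m" "l \<noteq> 1 - k"
  shows "R k m \<in> p"
  using br[OF assms(1,2)] assms(3-5) by (auto simp: commutator_R)

private lemma R_mirror_in: "R (1 - l) (1 - k) \<in> p \<longleftrightarrow> R k l \<in> p"
  unfolding R_mirror using gl7.subspace_neg[OF sub, of "R k l"] gl7.subspace_neg[OF sub, of "- R k l"] by auto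

private lemma R_pos: "ht l \<le> ht k \<Longrightarrow> R k l \<in> p"
  using bor R_in_graded[OF antisym7_wvec] unfolding borel7_graded by auto

text \<open>\<open>p\<close> contains the Cartan subalgebra, so the components of \<open>X\<close>
  for the eigenvalues of \<open>D 9 3 1\<close> stay in \<open>p\<close>; for a root, the component
  is a multiple of \<open>R k l\<close>.\<close>

lemma R_in_parabolic:
  assumes X: "X \<in> p" "X $ k $ l \<noteq> 0"
  shows "R k l \<in> p"
proof (cases "k = l")
  case False
  have Xso: "X \<in> so7" using X so7 by auto
  then have kl: "k \<noteq> 1 - l" using X(2) so7_antidiagonal[of X "1 - l"] by auto
  let ?w = "wvec 9 3 1 :: 7 \<Rightarrow> int" and ?T = "D 9 3 1"
  define J where "J = (\<lambda>(a, b). ?w a - ?w b) ` UNIV"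
  define x where "x d = (\<chi> a b. if ?w a - ?w b = d then X $ a $ b else 0)" for d
  have "finite J" by (simp add: J_def)
  have "X = (\<Sum>d\<in>J. x d)"
  proof -
    have "(\<Sum>d\<in>J. x d) $ a $ b = X $ a $ b" for a b
    proof -
      have "?w a - ?w b \<in> J" unfolding J_def by (rule image_eqI[of _ _ "(a, b)"]) auto
      then show ?thesis using \<open>finite J\<close> by (simp add: x_def)
    qed
    then show ?thesis by (simp add: vec_eq_iff)
  qed
  have "\<forall>d\<in>J. x d \<in> p"
  proof (rule eigencomponents_in_invariant_subspace[OF gl7.vector_space_axioms \<open>finite J\<close> _ sub,
        where c = of_int and U = UNIV and T = "commutator ?T"])
    show "linear_on mat_scale mat_scale UNIV (commutator ?T)"
      by (simp add: linear_on_def gl7.br_add_right gl7.br_scale_right)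
    have "?T \<in> p"
      using subsetD[OF cartan7_graded[of "\<lambda>n. 0 \<le> n" ht] D_cartan7] bor by (auto simp: borel7_graded)
    then show "commutator ?T Y \<in> p" if "Y \<in> p" for Y using br that by blast
    show "commutator ?T (x d) = mat_scale (of_int d) (x d)" for d
      by (auto simp: vec_eq_iff cartan7_commutator[OF D_cartan7] x_def D_nth of_int_wvec)
    show "(\<Sum>d\<in>J. x d) \<in> p" using X(1) \<open>X = _\<close> by simp
  qed (auto simp: inj_on_def)
  then have "x (?w k - ?w l) \<in> p" unfolding J_def by (rule bspec) (rule image_eqI[of _ _ "(k, l)"], auto)
  moreover have "x (?w k - ?w l) = mat_scale (x (?w k - ?w l) $ k $ l) (R k l)"
  proof (rule so7_eq_scale_R[OF _ False kl])
    show "x (?w k - ?w l) \<in> so7" using Xso unfolding so7_iff by (simp add: x_def algebra_simps)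
    fix a b assume "x (?w k - ?w l) $ a $ b \<noteq> 0"
    then have *: "?w a - ?w b = ?w k - ?w l" "X $ a $ b \<noteq> 0" by (auto simp: x_def split: if_splits)
    then have "a \<noteq> 1 - b" using so7_antidiagonal[OF Xso, of "1 - b"] by auto
    then show "a = k \<and> b = l \<or> a = 1 - l \<and> b = 1 - k"
      using wvec_9_3_1_difference *(1) False kl by blast
  qed
  ultimately have "mat_scale (X $ k $ l) (R k l) \<in> p" by (simp add: x_def)
  from gl7.subspace_scale[OF sub this, of "1 / (X $ k $ l)"] show ?thesis
    using X(2) by simp
qed (use R_pos in simp)

text \<open>Brackets with positive root vectors strip simple roots off a negative root, so a
  negative root vector lies in \<open>p\<close> exactly if the negatives of all simple roots in its
  support do. Degree 0 is given to the simple roots whose negatives are present, degree 1 to the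
  others.\<close>

lemma parabolic7_cases:
  obtains a b c where "a \<le> 1" "b \<le> 1" "c \<le> 1" "p = par a b c"
proof -
  define a b c :: nat where "a = (if R 2 1 \<in> p then 0 else 1)" and "b = (if R 3 2 \<in> p then 0 else 1)"
    and "c = (if R 4 3 \<in> p then 0 else 1)"
  let ?w = "parabolic_degree a b c"
  have m: "R 7 6 \<in> p \<longleftrightarrow> R 2 1 \<in> p" "R 6 5 \<in> p \<longleftrightarrow> R 3 2 \<in> p" "R 5 4 \<in> p \<longleftrightarrow> R 4 3 \<in> p"
    "R 7 5 \<in> p \<longleftrightarrow> R 3 1 \<in> p" "R 7 4 \<in> p \<longleftrightarrow> R 4 1 \<in> p" "R 7 3 \<in> p \<longleftrightarrow> R 5 1 \<in> p"
    "R 7 2 \<in> p \<longleftrightarrow> R 6 1 \<in> p" "R 6 4 \<in> p \<longleftrightarrow> R 4 2 \<in> p" "R 6 3 \<in> p \<longleftrightarrow> R 5 2 \<in> p"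
    using R_mirror_in[of 1 2] R_mirror_in[of 2 3] R_mirror_in[of 3 4] R_mirror_in[of 1 3] R_mirror_in[of 1 4]
      R_mirror_in[of 1 5] R_mirror_in[of 1 6] R_mirror_in[of 2 4] R_mirror_in[of 2 5] by (simp_all add: negative_7)
  have pos: "R 1 2 \<in> p" "R 1 3 \<in> p" "R 2 3 \<in> p" "R 3 4 \<in> p" "R 4 5 \<in> p" "R 5 6 \<in> p"
    by (simp_all add: R_pos)
  \<comment> \<open>\<open>R 3 1\<close> is the bracket of \<open>R 3 2\<close> and
    \<open>R 2 1\<close>; conversely, bracketing it with \<open>R 2 3\<close> and with
    \<open>R 1 2\<close> recovers the two factors. The next cases follow the same pattern.\<close>
  have r31: "R 3 1 \<in> p \<longleftrightarrow> R 2 1 \<in> p \<and> R 3 2 \<in> p"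
    using R_trans[of 3 2 1] R_trans[of 2 3 1] R_trans[of 3 1 2] pos by auto
  have r41: "R 4 1 \<in> p \<longleftrightarrow> R 3 1 \<in> p \<and> R 4 3 \<in> p"
    using R_trans[of 4 3 1] R_trans[of 3 4 1] R_trans[of 4 1 3] pos by auto
  have r42: "R 4 2 \<in> p \<longleftrightarrow> R 3 2 \<in> p \<and> R 4 3 \<in> p"
    using R_trans[of 4 3 2] R_trans[of 3 4 2] R_trans[of 4 2 3] pos by auto
  \<comment> \<open>The root of \<open>R 5 1\<close> differs from that of \<open>R 4 1\<close> only
    by a second copy of \<open>eta 3\<close>, which adds nothing to the support.\<close>
  have r51: "R 5 1 \<in> p \<longleftrightarrow> R 4 1 \<in> p"
    using R_trans[of 5 4 1] R_trans[of 4 5 1] pos m r41 by auto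
  have r52: "R 5 2 \<in> p \<longleftrightarrow> R 4 2 \<in> p"
    using R_trans[of 5 4 2] R_trans[of 4 5 2] pos m r42 by auto
  have r61: "R 6 1 \<in> p \<longleftrightarrow> R 5 1 \<in> p"
  proof -
    have "R 6 5 \<in> p \<Longrightarrow> R 5 1 \<in> p \<Longrightarrow> R 6 1 \<in> p" by (erule (1) R_trans) simp_all
    moreover have "R 6 1 \<in> p \<Longrightarrow> R 5 1 \<in> p" by (rule R_trans[OF pos(6)]) simp_all
    ultimately show ?thesis using m(2) r51 r41 r31 by blast
  qed
  have neg: "R k l \<in> p \<longleftrightarrow> ?w l \<le> ?w k" if "ht k < ht l" "k \<noteq> 1 - l" for k l
  proof -
    have "\<forall>k l. ht k < ht l \<longrightarrow> k \<noteq> 1 - l \<longrightarrow> (R k l \<in> p \<longleftrightarrow> ?w l \<le> ?w k)"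
      unfolding forall_7 by (simp add: m r31 r41 r42 r51 r52 r61 parabolic_degree_def a_def b_def c_def)
    then show ?thesis using that by blast
  qed
  have iff: "R k l \<in> p \<longleftrightarrow> ?w l \<le> ?w k" if "k \<noteq> 1 - l" for k l
    using neg[OF _ that] R_pos[of l k] parabolic_degree_mono[of l k a b c] by (cases "ht k < ht l") auto
  have "p = par a b c"
  proof
    show "par a b c \<subseteq> p" by (rule graded_subset[OF sub]) (simp add: iff)
    show "p \<subseteq> par a b c"
    proof
      fix X assume X: "X \<in> p"
      then have "X \<in> so7" using so7 by auto
      then show "X \<in> par a b c"
      proof (rule gradedI)
        fix k l assume kl: "X $ k $ l \<noteq> 0"
        then have "k \<noteq> 1 - l" using so7_antidiagonal[OF \<open>X \<in> so7\<close>, of "1 - l"] by auto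
        then show "0 \<le> ?w k - ?w l" using R_in_parabolic[OF X kl] iff by simp
      qed
    qed
  qed
  moreover have "a \<le> 1" "b \<le> 1" "c \<le> 1" by (simp_all add: a_def b_def c_def)
  ultimately show ?thesis using that by blast
qed

end

text \<open>By the classification it remains to compare degrees: the conditions on the simple root
  spaces say exactly which of them vanish, and this settles both existence and uniqueness for the
  definite description.\<close>

lemma std_parabolic7_par:
  assumes "a1 \<le> 1" "a2 \<le> 1" "a3 \<le> 1"
  shows "std_parabolic7 a1 a2 a3 = par a1 a2 a3"
proof -
  let ?C = "\<lambda>p. \<forall>(j, a) \<in> {(1, a1), (2, a2), (3, a3)}.
        (a = 1 \<longrightarrow> gl7.root_space so7 cartan7 (eta j) \<subseteq> gl7.nilrad so7 cartan7 p) \<and>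
        (a = 0 \<longrightarrow> gl7.root_space so7 cartan7 (eta j) \<subseteq> gl7.levi so7 cartan7 p)"
  have C: "?C (par a b c) \<longleftrightarrow> (a1 = 1 \<longrightarrow> 0 < a) \<and> (a1 = 0 \<longrightarrow> a = 0) \<and>
      (a2 = 1 \<longrightarrow> 0 < b) \<and> (a2 = 0 \<longrightarrow> b = 0) \<and> (a3 = 1 \<longrightarrow> 0 < c) \<and> (a3 = 0 \<longrightarrow> c = 0)" for a b c
    unfolding levi_graded[OF antisym7_parabolic_degree refl] nilrad_graded[OF antisym7_parabolic_degree refl]
    by (simp add: eta_root7[simplified] root_space_subset_graded[OF antisym7_parabolic_degree])
      (auto simp: parabolic_degree_def)
  show ?thesis
    unfolding std_parabolic7_def
  proof (rule the_equality)
    show "parabolic7 (par a1 a2 a3) \<and> ?C (par a1 a2 a3)"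
      unfolding C using parabolic7_par by simp
    fix p assume p: "parabolic7 p \<and> ?C p"
    then obtain a b c where abc: "a \<le> 1" "b \<le> 1" "c \<le> 1" "p = par a b c"
      using parabolic7_cases by blast
    have "a = a1" "b = a2" "c = a3"
      using conjunct2[OF p] assms abc(1-3) unfolding abc(4) C by linarith+
    then show "p = par a1 a2 a3" using abc by simp
  qed
qed

section \<open>The embedded Lie algebra of type G2\<close>

text \<open>Bracketing with \<open>R k l\<close> is a combination of row and column operations; in
  this entrywise form the linear equations for G2 can be checked by simplification.\<close>

lemma commutator_scale_R_nth:
  "commutator (mat_scale u (R k l)) X $ a $ b = u * ((if a = k then X $ l $ b else 0) - (if a = 1 - l then X $ (1 - k) $ b else 0)
     - (if b = l then X $ a $ k else 0) + (if b = 1 - k then X $ a $ (1 - l) else 0))"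
proof -
  have ite: "(if P \<and> Q then 1 else 0) * y = (if Q then if P then y else 0 else 0)"
    "y * (if P \<and> Q then 1 else 0) = (if P then if Q then y else 0 else 0)" for P Q and y :: complex
    by simp_all
  have "(R k l ** X) $ a $ b = (\<Sum>c\<in>UNIV. (if c = l then if a = k then X $ c $ b else 0 else 0)
      - (if c = 1 - k then if a = 1 - l then X $ c $ b else 0 else 0))"
    by (simp only: matrix_matrix_mult_def vec_lambda_beta R_nth left_diff_distrib ite)
  moreover have "(X ** R k l) $ a $ b = (\<Sum>c\<in>UNIV. (if c = k then if b = l then X $ a $ c else 0 else 0)
      - (if c = 1 - l then if b = 1 - k then X $ a $ c else 0 else 0))"
    by (simp only: matrix_matrix_mult_def vec_lambda_beta R_nth right_diff_distrib ite)
  ultimately have "commutator (R k l) X $ a $ b = (if a = k then X $ l $ b else 0) - (if a = 1 - l then X $ (1 - k) $ b else 0)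
     - (if b = l then X $ a $ k else 0) + (if b = 1 - k then X $ a $ (1 - l) else 0)"
    by (simp add: commutator_def sum_subtractf)
  then show ?thesis by (simp only: gl7.br_scale_left mat_scale_nth)
qed

lemma commutator_diff: "commutator X (Y - Z) = commutator X Y - commutator X Z" "commutator X (- Y) = - commutator X Y"
  by (simp_all add: vec_eq_iff commutator_nth sum_subtractf[symmetric] sum_negf[symmetric] algebra_simps)

lemma commutator_zero: "commutator 0 X = 0"
  by (simp add: vec_eq_iff commutator_nth)

lemma commutator_commutator:
  "commutator (commutator X Y) Z = commutator X (commutator Y Z) - commutator Y (commutator X Z)"
proof -
  have swap: "commutator A B = - commutator B A" for A B by (simp add: commutator_def)
  have "commutator Y (commutator Z X) = - commutator Y (commutator X Z)"
    by (subst swap[of Z X]) (rule commutator_diff(2))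
  then have "commutator X (commutator Y Z) - commutator Y (commutator X Z) - commutator (commutator X Y) Z = 0"
    using gl7.jacobi[of X Y Z] swap[of Z "commutator X Y"] by simp
  then show ?thesis by simp
qed

lemma so7_entries:
  assumes "X \<in> so7"
  shows "X $ 1 $ 7 = 0" "X $ 2 $ 6 = 0" "X $ 3 $ 5 = 0" "X $ 4 $ 4 = 0" "X $ 5 $ 3 = 0" "X $ 6 $ 2 = 0" "X $ 7 $ 1 = 0"
    "X $ 7 $ 7 = - X $ 1 $ 1" "X $ 6 $ 6 = - X $ 2 $ 2" "X $ 5 $ 5 = - X $ 3 $ 3"
    "X $ 6 $ 7 = - X $ 1 $ 2" "X $ 5 $ 7 = - X $ 1 $ 3" "X $ 4 $ 7 = - X $ 1 $ 4" "X $ 3 $ 7 = - X $ 1 $ 5" "X $ 2 $ 7 = - X $ 1 $ 6"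
    "X $ 5 $ 6 = - X $ 2 $ 3" "X $ 4 $ 6 = - X $ 2 $ 4" "X $ 3 $ 6 = - X $ 2 $ 5" "X $ 4 $ 5 = - X $ 3 $ 4"
    "X $ 7 $ 6 = - X $ 2 $ 1" "X $ 7 $ 5 = - X $ 3 $ 1" "X $ 7 $ 4 = - X $ 4 $ 1" "X $ 7 $ 3 = - X $ 5 $ 1" "X $ 7 $ 2 = - X $ 6 $ 1"
    "X $ 6 $ 5 = - X $ 3 $ 2" "X $ 6 $ 4 = - X $ 4 $ 2" "X $ 6 $ 3 = - X $ 5 $ 2" "X $ 5 $ 4 = - X $ 4 $ 3"
proof -
  have m: "X $ (1 - b) $ (1 - a) = - X $ a $ b" for a b using assms so7_iff by blast
  show "X $ 1 $ 7 = 0" "X $ 2 $ 6 = 0" "X $ 3 $ 5 = 0" "X $ 4 $ 4 = 0" "X $ 5 $ 3 = 0" "X $ 6 $ 2 = 0" "X $ 7 $ 1 = 0"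
    using so7_antidiagonal[OF assms, of 1] so7_antidiagonal[OF assms, of 2] so7_antidiagonal[OF assms, of 3]
      so7_antidiagonal[OF assms, of 4] so7_antidiagonal[OF assms, of 5] so7_antidiagonal[OF assms, of 6]
      so7_antidiagonal[OF assms, of 7] by (simp_all add: negative_7)
  show "X $ 7 $ 7 = - X $ 1 $ 1" "X $ 6 $ 6 = - X $ 2 $ 2" "X $ 5 $ 5 = - X $ 3 $ 3"
    "X $ 6 $ 7 = - X $ 1 $ 2" "X $ 5 $ 7 = - X $ 1 $ 3" "X $ 4 $ 7 = - X $ 1 $ 4" "X $ 3 $ 7 = - X $ 1 $ 5" "X $ 2 $ 7 = - X $ 1 $ 6"
    using m[of 1 1] m[of 2 2] m[of 3 3] m[of 2 1] m[of 3 1] m[of 4 1] m[of 5 1] m[of 6 1] by (simp_all add: negative_7)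
  show "X $ 5 $ 6 = - X $ 2 $ 3" "X $ 4 $ 6 = - X $ 2 $ 4" "X $ 3 $ 6 = - X $ 2 $ 5" "X $ 4 $ 5 = - X $ 3 $ 4"
    using m[of 3 2] m[of 4 2] m[of 5 2] m[of 4 3] by (simp_all add: negative_7)
  show "X $ 7 $ 6 = - X $ 2 $ 1" "X $ 7 $ 5 = - X $ 3 $ 1" "X $ 7 $ 4 = - X $ 4 $ 1" "X $ 7 $ 3 = - X $ 5 $ 1" "X $ 7 $ 2 = - X $ 6 $ 1"
    using m[of 1 2] m[of 1 3] m[of 1 4] m[of 1 5] m[of 1 6] by (simp_all add: negative_7)
  show "X $ 6 $ 5 = - X $ 3 $ 2" "X $ 6 $ 4 = - X $ 4 $ 2" "X $ 6 $ 3 = - X $ 5 $ 2" "X $ 5 $ 4 = - X $ 4 $ 3"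
    using m[of 2 3] m[of 2 4] m[of 2 5] m[of 3 4] by (simp_all add: negative_7)
qed

text \<open>Linear equations for the subalgebra of type G2 generated by \<open>c1 R12 + c3 R34\<close>, \<open>c2 R23\<close> and
  their negatives: one for each short root and one for the Cartan part.\<close>

definition G2_matrices :: "complex \<Rightarrow> complex \<Rightarrow> (complex^7^7) set" where
  "G2_matrices c1 c3 = {X\<in>so7. X $ 1 $ 1 = X $ 2 $ 2 + X $ 3 $ 3 \<and>
     X $ 3 $ 4 = c3 / c1 * X $ 1 $ 2 \<and> X $ 2 $ 4 = - (c3 / c1) * X $ 1 $ 3 \<and> X $ 2 $ 5 = c3 / (2 * c1) * X $ 1 $ 4 \<and>
     X $ 4 $ 3 = 2 * c1 / c3 * X $ 2 $ 1 \<and> X $ 4 $ 2 = - (2 * c1 / c3) * X $ 3 $ 1 \<and> X $ 5 $ 2 = c1 / c3 * X $ 4 $ 1}"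

lemma G2_matrices_subspace: "gl7.subspace (G2_matrices c1 c3)"
proof (rule gl7.subspaceI)
  fix X Y assume "X \<in> G2_matrices c1 c3" "Y \<in> G2_matrices c1 c3"
  then show "X + Y \<in> G2_matrices c1 c3"
    using gl7.subspace_add[OF so7_subspace] by (simp add: G2_matrices_def distrib_left add_divide_distrib)
qed (use gl7.subspace_0[OF so7_subspace] gl7.subspace_scale[OF so7_subspace] in \<open>auto simp: G2_matrices_def distrib_left\<close>)

text \<open>Seven equations with distinct leading entries cut so(7), of dimension 21, down to
  dimension 14. Their coefficients are the ratios found in the short root vectors that arise by
  bracketing the generators, so stability is a comparison of entries.\<close>

lemma G2_matrices_commutator:
  assumes X: "X \<in> G2_matrices c1 c3" and c: "c1 \<noteq> 0" "c3 \<noteq> 0"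
  shows "commutator (mat_scale c1 (R 1 2) + mat_scale c3 (R 3 4)) X \<in> G2_matrices c1 c3"
    "commutator (mat_scale u (R 2 3)) X \<in> G2_matrices c1 c3"
    "commutator (mat_scale (1 / c1) (R 2 1) + mat_scale (2 / c3) (R 4 3)) X \<in> G2_matrices c1 c3"
    "commutator (mat_scale u (R 3 2)) X \<in> G2_matrices c1 c3"
proof -
  have so: "X \<in> so7" using X by (simp add: G2_matrices_def)
  have eqs: "X $ 1 $ 1 = X $ 2 $ 2 + X $ 3 $ 3"
     "X $ 3 $ 4 = c3 / c1 * X $ 1 $ 2" "X $ 2 $ 4 = - (c3 / c1) * X $ 1 $ 3" "X $ 2 $ 5 = c3 / (2 * c1) * X $ 1 $ 4"
     "X $ 4 $ 3 = 2 * c1 / c3 * X $ 2 $ 1" "X $ 4 $ 2 = - (2 * c1 / c3) * X $ 3 $ 1" "X $ 5 $ 2 = c1 / c3 * X $ 4 $ 1"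
    using X by (simp_all add: G2_matrices_def)
  have so_c: "commutator Y X \<in> so7" if "Y \<in> so7" for Y using so7_commutator[OF that so] .
  have sR: "mat_scale u (R k l) \<in> so7" for u k l by (rule gl7.subspace_scale[OF so7_subspace R_so7])
  note S = so7_entries[OF so] commutator_scale_R_nth negative_7 gl7.br_add_left eqs
  show "commutator (mat_scale c1 (R 1 2) + mat_scale c3 (R 3 4)) X \<in> G2_matrices c1 c3"
    unfolding G2_matrices_def
    by (intro CollectI conjI so_c gl7.subspace_add[OF so7_subspace] sR; simp add: S; simp add: c field_simps)
  show "commutator (mat_scale u (R 2 3)) X \<in> G2_matrices c1 c3"
    unfolding G2_matrices_def by (intro CollectI conjI so_c sR; simp add: S; (simp add: c field_simps)?)
  show "commutator (mat_scale (1 / c1) (R 2 1) + mat_scale (2 / c3) (R 4 3)) X \<in> G2_matrices c1 c3"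
    unfolding G2_matrices_def
    by (intro CollectI conjI so_c gl7.subspace_add[OF so7_subspace] sR; simp add: S; (simp add: c field_simps)?)
  show "commutator (mat_scale u (R 3 2)) X \<in> G2_matrices c1 c3"
    unfolding G2_matrices_def by (intro CollectI conjI so_c sR; simp add: S; (simp add: c field_simps)?)
qed

context G2_in_so7
begin

interpretation gp: vector_space_pair scale mat_scale
  by unfold_locales

lemmas i_simps = gp.linear_add[OF i_linear] gp.linear_scale[OF i_linear] gp.linear_0[OF i_linear]
  gp.linear_sum[OF i_linear] gp.linear_diff[OF i_linear] i_br

lemma i_so7: "i x \<in> so7"
  using i_range by auto

lemma i_eq_0: "i x = 0 \<Longrightarrow> x = 0"
  using i_inj gp.linear_0[OF i_linear] by (metis injD)

text \<open>Root spaces are lines, and the normalisation of the generators fixes the product of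
  opposite coefficients. For the long simple roots \<open>eta k\<close> is already 2 on the bracket
  of opposite matrices \<open>R\<close>; \<open>eta 3\<close> is only 1 on the bracket of
  \<open>R 3 4\<close> and \<open>R 4 3\<close>, hence the 2 in \<open>2 / c3\<close>.\<close>

lemma generators:
  obtains c1 c2 c3 where "c1 \<noteq> 0" "c2 \<noteq> 0" "c3 \<noteq> 0"
    "i (gb 1) = mat_scale c1 (R 1 2) + mat_scale c3 (R 3 4)" "i (gb 2) = mat_scale c2 (R 2 3)"
    "i (gb (- 1)) = mat_scale (1 / c1) (R 2 1) + mat_scale (2 / c3) (R 4 3)" "i (gb (- 2)) = mat_scale (1 / c2) (R 3 2)"
proof -
  have G: "g (int k) \<in> gl7.root_space so7 cartan7 (eta k)" "g (- int k) \<in> gl7.root_space so7 cartan7 (- eta k)"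
    "eta k (commutator (g (int k)) (g (- int k))) = 2" if "k \<in> {1, 2, 3}" for k
    using g_chevalley that unfolding gl7.chevalley_generators_def by blast+
  obtain c1 d1 where 1: "g 1 = mat_scale c1 (R 1 2)" "g (- 1) = mat_scale d1 (R 2 1)"
    using G(1,2)[of 1] by (auto simp: eta_root7[simplified] uminus_root7 root_space_root7)
  obtain c2 d2 where 2: "g 2 = mat_scale c2 (R 2 3)" "g (- 2) = mat_scale d2 (R 3 2)"
    using G(1,2)[of 2] by (auto simp: eta_root7 uminus_root7 root_space_root7)
  obtain c3 d3 where 3: "g 3 = mat_scale c3 (R 3 4)" "g (- 3) = mat_scale d3 (R 4 3)"
    using G(1,2)[of 3] by (auto simp: eta_root7 uminus_root7 root_space_root7)
  have cart: "mat_scale u (R k k) \<in> cartan7" "mat_scale u (R k k - R l l) \<in> cartan7" for u k l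
    by (intro gl7.subspace_scale[OF cartan7_subspace] gl7.subspace_diff[OF cartan7_subspace] R_diagonal)+
  note E = gl7.br_scale_left gl7.br_scale_right commutator_R negative_7 root7_apply R_nth cart
  have "c1 * d1 = 1" using G(3)[of 1] by (simp add: eta_root7[simplified] 1 E mult.commute)
  moreover have "c2 * d2 = 1" using G(3)[of 2] by (simp add: eta_root7 2 E mult.commute)
  moreover have "c3 * d3 = 2" using G(3)[of 3] by (simp add: eta_root7 3 E mult.commute)
  moreover from calculation have "c1 \<noteq> 0" "c2 \<noteq> 0" "c3 \<noteq> 0" by auto
  ultimately have "c1 \<noteq> 0" "c2 \<noteq> 0" "c3 \<noteq> 0" "d1 = 1 / c1" "d2 = 1 / c2" "d3 = 2 / c3"
    by (simp_all add: eq_divide_eq mult.commute)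
  then show ?thesis using that 1 2 3 i_gb by auto
qed

definition h :: "complex \<Rightarrow> complex \<Rightarrow> 'b" where
  "h x y = scale x (br (gb 1) (gb (- 1))) + scale y (br (gb 2) (gb (- 2)))"

text \<open>On the image of \<open>H\<close> the first diagonal entry is the sum of the next two.
  Through this single relation different roots of so(7) acquire the same restriction.\<close>

lemma i_h: "i (h x y) = D x (y - x) (2 * x - y)"
proof -
  obtain c1 c2 c3 where c: "c1 \<noteq> 0" "c2 \<noteq> 0" "c3 \<noteq> 0"
    "i (gb 1) = mat_scale c1 (R 1 2) + mat_scale c3 (R 3 4)" "i (gb 2) = mat_scale c2 (R 2 3)"
    "i (gb (- 1)) = mat_scale (1 / c1) (R 2 1) + mat_scale (2 / c3) (R 4 3)" "i (gb (- 2)) = mat_scale (1 / c2) (R 3 2)"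
    by (rule generators)
  have "i (br (gb 1) (gb (- 1))) = R 1 1 - R 2 2 + mat_scale 2 (R 3 3 - R 4 4)"
    by (simp add: i_br c gl7.br_add_left gl7.br_add_right gl7.br_scale_left gl7.br_scale_right commutator_R)
  moreover have "i (br (gb 2) (gb (- 2))) = R 2 2 - R 3 3"
    by (simp add: i_br c gl7.br_scale_left gl7.br_scale_right commutator_R)
  moreover have "mat_scale x (R 1 1 - R 2 2 + mat_scale 2 (R 3 3 - R 4 4)) + mat_scale y (R 2 2 - R 3 3) =
      D x (y - x) (2 * x - y)"
    unfolding vec_eq_iff forall_7 by (simp add: R_nth D_nth algebra_simps)
  ultimately show ?thesis by (simp add: h_def i_simps)
qed

lemma H_iff: "x \<in> H \<longleftrightarrow> (\<exists>s t. x = h s t)"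
proof -
  have "x \<in> H \<longleftrightarrow> (\<exists>s. x - scale s (br (gb 1) (gb (- 1))) \<in> range (\<lambda>t. scale t (br (gb 2) (gb (- 2)))))"
    unfolding H_def by (auto simp: span_insert span_singleton)
  then show ?thesis by (auto simp: h_def algebra_simps image_iff)
qed

lemma h_in_H: "h s t \<in> H"
  using H_iff by blast

lemma H_subspace: "subspace H"
  unfolding H_def by (rule subspace_span)

lemma i_H_cartan7: "x \<in> H \<Longrightarrow> i x \<in> cartan7"
  using i_h D_cartan7 by (auto simp: H_iff)

text \<open>The restriction of \<open>root7 k l\<close> along \<open>i\<close>. Besides mirror
  images, the two index pairs belonging to a short root of G2 give the same functional.\<close>

definition rt :: "7 \<Rightarrow> 7 \<Rightarrow> 'b \<Rightarrow> complex" where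
  "rt k l x = (if x \<in> H then i x $ k $ k - i x $ l $ l else 0)"

lemma rt_h: "rt k l (h x y) = wvec x (y - x) (2 * x - y) k - wvec x (y - x) (2 * x - y) l"
  by (simp add: rt_def h_in_H i_h D_nth)

lemma uminus_rt: "- rt k l = rt l k"
  by (auto simp: rt_def fun_eq_iff)

lemma rt_dual: "rt k l \<in> dual H"
  unfolding dual_def linear_on_def
  using subspace_add[OF H_subspace] subspace_scale[OF H_subspace]
  by (auto simp: rt_def i_simps algebra_simps)

lemma root_space_iff:
  "x \<in> root_space UNIV H \<beta> \<longleftrightarrow> (\<forall>y\<in>H. \<forall>a b. i x $ a $ b \<noteq> 0 \<longrightarrow> i y $ a $ a - i y $ b $ b = \<beta> y)"
proof -
  have "br y x = scale (\<beta> y) x \<longleftrightarrow> i (br y x) = i (scale (\<beta> y) x)" for y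
    using i_inj by (auto dest: injD)
  then have "br y x = scale (\<beta> y) x \<longleftrightarrow> (\<forall>a b. i x $ a $ b \<noteq> 0 \<longrightarrow> i y $ a $ a - i y $ b $ b = \<beta> y)" if "y \<in> H" for y
    using cartan7_commutator[OF i_H_cartan7[OF that]] by (simp add: i_simps vec_eq_iff) blast
  then show ?thesis unfolding root_space_def by auto
qed

lemma root_eq_rt:
  assumes "\<beta> \<in> dual H" "x \<in> root_space UNIV H \<beta>" "i x $ a $ b \<noteq> 0"
  shows "\<beta> = rt a b"
  using assms by (auto simp: fun_eq_iff rt_def root_space_iff dual_def)

lemma root_cases:
  assumes "\<beta> \<in> roots UNIV H" "x \<in> root_space UNIV H \<beta>" "i x $ a $ b \<noteq> 0"
  shows "\<beta> = rt a b" "a \<noteq> b" "a \<noteq> 1 - b"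
proof -
  show \<beta>: "\<beta> = rt a b" using root_eq_rt[OF _ assms(2,3)] assms(1) by (simp add: roots_def)
  have "rt b b = (\<lambda>_. 0)" by (simp add: rt_def fun_eq_iff)
  then show "a \<noteq> b" using \<beta> assms(1) by (auto simp: roots_def)
  show "a \<noteq> 1 - b" using assms(3) so7_antidiagonal[OF i_so7, of x "1 - b"] by auto
qed

lemma in_root_space:
  assumes "i x = mat_scale u (R k l) + mat_scale v (R m n)" "\<And>s t. rt k l (h s t) = rt m n (h s t)"
  shows "x \<in> root_space UNIV H (rt k l)"
proof -
  have "i (br y x) = i (scale (rt k l y) x)" if y: "y \<in> H" for y
  proof -
    obtain s t where st: "y = h s t" using y H_iff by blast
    have "commutator (i y) (R k l) = mat_scale (rt k l y) (R k l)" for k l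
      using R_in_root_space[of k l] i_H_cartan7[OF y]
      by (simp add: gl7.root_space_def root7_apply rt_def y)
    then show ?thesis
      using assms(2)[of s t] by (simp add: i_simps assms(1) gl7.br_add_right gl7.br_scale_right st
        gl7.scale_right_distrib mult.commute)
  qed
  then show ?thesis using i_inj unfolding root_space_def by (auto dest: injD)
qed

text \<open>The root vectors are written down as iterated brackets of generators. For a long root
  the image is a multiple of one \<open>R k l\<close>; for a short root it combines two of them,
  both with nonzero coefficient, so either position may be prescribed.\<close>

lemma root_space_nonzero:
  assumes "k \<noteq> l" "k \<noteq> 1 - l"
  shows "\<exists>x\<in>root_space UNIV H (rt k l). i x $ k $ l \<noteq> 0"
proof -
  obtain c1 c2 c3 where c: "c1 \<noteq> 0" "c2 \<noteq> 0" "c3 \<noteq> 0" and gen: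
    "i (gb 1) = mat_scale c1 (R 1 2) + mat_scale c3 (R 3 4)" "i (gb 2) = mat_scale c2 (R 2 3)"
    "i (gb (- 1)) = mat_scale (1 / c1) (R 2 1) + mat_scale (2 / c3) (R 4 3)" "i (gb (- 2)) = mat_scale (1 / c2) (R 3 2)"
    by (rule generators)
  define G where "G k l \<longleftrightarrow> (\<exists>x\<in>root_space UNIV H (rt k l). i x $ k $ l \<noteq> 0)" for k l
  have G1: "G k l" if "i x = mat_scale u (R k l) + mat_scale v (R m n)" "\<And>s t. rt k l (h s t) = rt m n (h s t)"
    "i x $ k $ l \<noteq> 0" for k l u v m n x
    unfolding G_def using in_root_space[OF that(1,2)] that(3) by blast
  have G2: "G k l" if "i x = mat_scale u (R k l)" "u \<noteq> 0" "k \<noteq> 1 - l" for k l u x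
    by (rule G1[where x = x and u = u and v = 0 and m = k and n = l]) (use that R_nth_self in auto)
  have mir: "G (1 - l) (1 - k)" if "G k l" for k l
  proof -
    have "rt (1 - l) (1 - k) = rt k l" using cartan7_mirror[OF i_H_cartan7] by (auto simp: rt_def fun_eq_iff)
    moreover have "i x $ (1 - l) $ (1 - k) = - i x $ k $ l" for x using i_so7[of x] so7_iff by blast
    ultimately show ?thesis using that by (simp add: G_def)
  qed
  have RR: "R 3 6 = - R 2 5" "R 3 7 = - R 1 5" "R 2 7 = - R 1 6" "R 6 3 = - R 5 2" "R 7 3 = - R 5 1" "R 7 2 = - R 6 1"
    using R_mirror[of 5 2] R_mirror[of 5 1] R_mirror[of 6 1] R_mirror[of 2 5] R_mirror[of 1 5] R_mirror[of 1 6]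
    by (simp_all add: negative_7)
  note S = i_br commutator_diff gl7.br_add_left gl7.br_add_right gl7.br_scale_left gl7.br_scale_right commutator_R negative_7 RR
    gl7.scale_right_distrib gl7.scale_minus_right gl7.scale_minus_left
  \<comment> \<open>The brackets run through the roots \<alpha>1 + \<alpha>2, 2 \<alpha>1 +
    \<alpha>2, 3 \<alpha>1 + \<alpha>2 and the highest root 3 \<alpha>1 + 2 \<alpha>2, then through
    their negatives.\<close>
  have e12: "i (br (gb 1) (gb 2)) = mat_scale (c1 * c2) (R 1 3) + mat_scale (- (c2 * c3)) (R 2 4)"
    by (simp add: S gen vec_eq_iff algebra_simps)
  have e112: "i (br (gb 1) (br (gb 1) (gb 2))) = mat_scale (- 2 * c1 * c2 * c3) (R 1 4) + mat_scale (- c2 * c3 * c3) (R 2 5)"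
    unfolding i_br[of "gb 1" "br (gb 1) (gb 2)"] e12 by (simp add: S gen vec_eq_iff algebra_simps)
  have e1112: "i (br (gb 1) (br (gb 1) (br (gb 1) (gb 2)))) = mat_scale (- 3 * c1 * c2 * c3 * c3) (R 1 5)"
    unfolding i_br[of "gb 1" "br (gb 1) (br (gb 1) (gb 2))"] e112 by (simp add: S gen vec_eq_iff algebra_simps)
  have e21112: "i (br (gb 2) (br (gb 1) (br (gb 1) (br (gb 1) (gb 2))))) = mat_scale (- 3 * c1 * c2 * c2 * c3 * c3) (R 1 6)"
    unfolding i_br[of "gb 2" "br (gb 1) (br (gb 1) (br (gb 1) (gb 2)))"] e1112 by (simp add: S gen vec_eq_iff algebra_simps)
  have f12: "i (br (gb (- 1)) (gb (- 2))) = mat_scale (- 1 / (c1 * c2)) (R 3 1) + mat_scale (2 / (c2 * c3)) (R 4 2)"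
    by (simp add: S gen vec_eq_iff algebra_simps)
  have f112: "i (br (gb (- 1)) (br (gb (- 1)) (gb (- 2)))) =
      mat_scale (- 4 / (c1 * c2 * c3)) (R 4 1) + mat_scale (- 4 / (c2 * c3 * c3)) (R 5 2)"
    unfolding i_br[of "gb (- 1)" "br (gb (- 1)) (gb (- 2))"] f12 by (simp add: S gen vec_eq_iff algebra_simps)
  have f1112: "i (br (gb (- 1)) (br (gb (- 1)) (br (gb (- 1)) (gb (- 2))))) = mat_scale (12 / (c1 * c2 * c3 * c3)) (R 5 1)"
    unfolding i_br[of "gb (- 1)" "br (gb (- 1)) (br (gb (- 1)) (gb (- 2)))"] f112 by (simp add: S gen vec_eq_iff algebra_simps)
  have f21112: "i (br (gb (- 2)) (br (gb (- 1)) (br (gb (- 1)) (br (gb (- 1)) (gb (- 2)))))) = mat_scale (- 12 / (c1 * c2 * c2 * c3 * c3)) (R 6 1)"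
    unfolding i_br[of "gb (- 2)" "br (gb (- 1)) (br (gb (- 1)) (br (gb (- 1)) (gb (- 2))))"] f1112 by (simp add: S gen vec_eq_iff algebra_simps)
  have short: "G k l \<and> G m n" if "i x = mat_scale u (R k l) + mat_scale v (R m n)" "\<And>s t. rt k l (h s t) = rt m n (h s t)"
    "i x $ k $ l \<noteq> 0" "i x $ m $ n \<noteq> 0" for k l u v m n x
    using G1[OF that(1-3)] G1[of x v m n u k l] that by (simp add: add.commute)
  have "G 1 2 \<and> G 3 4" by (rule short[OF gen(1)]) (simp_all add: rt_h gen R_nth c)
  moreover have "G 2 1 \<and> G 4 3" by (rule short[OF gen(3)]) (simp_all add: rt_h gen R_nth c)
  moreover have "G 1 3 \<and> G 2 4" by (rule short[OF e12]) (simp_all add: rt_h e12 R_nth c)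
  moreover have "G 3 1 \<and> G 4 2" by (rule short[OF f12]) (simp_all add: rt_h f12 R_nth c)
  moreover have "G 1 4 \<and> G 2 5" by (rule short[OF e112]) (simp_all add: rt_h e112 R_nth c)
  moreover have "G 4 1 \<and> G 5 2" by (rule short[OF f112]) (simp_all add: rt_h f112 R_nth c)
  moreover have "G 2 3" by (rule G2[OF gen(2)]) (simp_all add: c)
  moreover have "G 3 2" by (rule G2[OF gen(4)]) (simp_all add: c)
  moreover have "G 1 5" by (rule G2[OF e1112]) (simp_all add: c)
  moreover have "G 5 1" by (rule G2[OF f1112]) (simp_all add: c)
  moreover have "G 1 6" by (rule G2[OF e21112]) (simp_all add: c)
  moreover have "G 6 1" by (rule G2[OF f21112]) (simp_all add: c)
  \<comment> \<open>Six short roots with two index pairs each and six long roots with one make up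
    the 18 pairs that exist up to mirroring.\<close>
  ultimately have "\<forall>k l. k \<noteq> l \<longrightarrow> k \<noteq> 1 - l \<longrightarrow> G k l \<or> G (1 - l) (1 - k)"
    unfolding forall_7 by (simp add: negative_7)
  then have "G k l" using assms mir[of "1 - l" "1 - k"] by auto
  then show ?thesis by (simp add: G_def)
qed

text \<open>Closure of the solution space under commutators is not shown directly. The elements
  whose adjoint action preserves it form a subalgebra containing the generators, hence are all
  elements; consequently its preimage is a subalgebra, which again contains the generators.\<close>

lemma i_G2_matrices:
  assumes c: "c1 \<noteq> 0" "c2 \<noteq> 0" "c3 \<noteq> 0" and gen:
    "i (gb 1) = mat_scale c1 (R 1 2) + mat_scale c3 (R 3 4)" "i (gb 2) = mat_scale c2 (R 2 3)"
    "i (gb (- 1)) = mat_scale (1 / c1) (R 2 1) + mat_scale (2 / c3) (R 4 3)" "i (gb (- 2)) = mat_scale (1 / c2) (R 3 2)"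
  shows "i x \<in> G2_matrices c1 c3"
proof -
  let ?M = "G2_matrices c1 c3" and ?gens = "{gb 1, gb (- 1), gb 2, gb (- 2)}"
  have all: "x \<in> T" if "subalgebra T" "?gens \<subseteq> T" for T x
    using hull_minimal[of ?gens T subalgebra] gb_generate that by blast
  have "x \<in> {x. \<forall>X\<in>?M. commutator (i x) X \<in> ?M}" for x
  proof (rule all)
    show "subalgebra {x. \<forall>X\<in>?M. commutator (i x) X \<in> ?M}"
      unfolding subalgebra_def
    proof (intro conjI ballI)
      show "subspace {x. \<forall>X\<in>?M. commutator (i x) X \<in> ?M}"
        by (rule subspaceI) (auto simp: i_simps gl7.br_add_left gl7.br_scale_left
          gl7.subspace_add[OF G2_matrices_subspace] gl7.subspace_scale[OF G2_matrices_subspace]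
          commutator_zero gl7.subspace_0[OF G2_matrices_subspace])
      fix x y assume xy: "x \<in> {x. \<forall>X\<in>?M. commutator (i x) X \<in> ?M}" "y \<in> {x. \<forall>X\<in>?M. commutator (i x) X \<in> ?M}"
      show "br x y \<in> {x. \<forall>X\<in>?M. commutator (i x) X \<in> ?M}"
        using xy by (auto simp: i_br commutator_commutator intro!: gl7.subspace_diff[OF G2_matrices_subspace])
    qed
    show "?gens \<subseteq> {x. \<forall>X\<in>?M. commutator (i x) X \<in> ?M}"
      using G2_matrices_commutator[OF _ c(1,3)] by (simp add: gen)
  qed
  then have "subalgebra {x. i x \<in> ?M}"
    unfolding subalgebra_def
    by (intro conjI subspaceI) (auto simp: i_simps gl7.subspace_add[OF G2_matrices_subspace]
      gl7.subspace_scale[OF G2_matrices_subspace] gl7.subspace_0[OF G2_matrices_subspace])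
  moreover have "?gens \<subseteq> {x. i x \<in> ?M}"
    using c i_so7[of "gb 1"] i_so7[of "gb 2"] i_so7[of "gb (-1)"] i_so7[of "gb (-2)"]
    by (simp add: G2_matrices_def gen R_nth negative_7)
  ultimately show ?thesis using all by blast
qed

end

section \<open>Maps that are linear on a subspace\<close>

lemma linear_on_0:
  assumes "vector_space s1" "vector_space s2" "module.subspace s1 S" "linear_on s1 s2 S f"
  shows "f 0 = 0"
proof -
  interpret v1: vector_space s1 by fact
  interpret v2: vector_space s2 by fact
  have "f (s1 0 0) = s2 0 (f 0)"
    using assms(4) v1.subspace_0[OF assms(3)] unfolding linear_on_def by blast
  then show ?thesis by simp
qed

lemma linear_on_sum:
  assumes "vector_space s1" "vector_space s2" "module.subspace s1 S" "linear_on s1 s2 S f"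
    and "\<And>j. j \<in> J \<Longrightarrow> x j \<in> S"
  shows "f (\<Sum>j\<in>J. s1 (c j) (x j)) = (\<Sum>j\<in>J. s2 (c j) (f (x j)))"
proof -
  interpret v1: vector_space s1 by fact
  interpret v2: vector_space s2 by fact
  show ?thesis
    using assms(5)
  proof (induction J rule: infinite_finite_induct)
    case (insert a J)
    have "s1 (c a) (x a) \<in> S" "(\<Sum>j\<in>J. s1 (c j) (x j)) \<in> S"
      using insert.prems by (auto intro!: v1.subspace_scale[OF assms(3)] v1.subspace_sum[OF assms(3)])
    then have "f (s1 (c a) (x a) + (\<Sum>j\<in>J. s1 (c j) (x j))) = s2 (c a) (f (x a)) + f (\<Sum>j\<in>J. s1 (c j) (x j))"
      using assms(4) insert.prems unfolding linear_on_def by auto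
    then show ?case using insert by simp
  qed (use linear_on_0[OF assms(1-4)] in auto)
qed

lemma linear_on_diff:
  assumes "vector_space s1" "vector_space s2" "module.subspace s1 S" "linear_on s1 s2 S f" "x \<in> S" "y \<in> S"
  shows "f (x - y) = f x - f y"
proof -
  interpret v1: vector_space s1 by fact
  interpret v2: vector_space s2 by fact
  have "f ((x - y) + y) = f (x - y) + f y"
    using assms(4-6) v1.subspace_diff[OF assms(3,5,6)] unfolding linear_on_def by blast
  then show ?thesis by simp
qed

section \<open>Levi part, Borel subalgebra and root spaces of the embedded algebra\<close>

context G2_in_so7
begin

lemma ht_bounds: "ht a - ht b \<in> {- 6..6}"
proof -
  have "\<forall>a. -3 \<le> ht a \<and> ht a \<le> 3" unfolding forall_7 by simp
  then have "-3 \<le> ht a \<and> ht a \<le> 3" "-3 \<le> ht b \<and> ht b \<le> 3" by blast+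
  then show ?thesis by auto
qed

lemma rt_ht: "rt k l (h 3 5) = of_int (ht k - ht l)"
  by (simp add: rt_h of_int_wvec)

lemma br_root_space: "x \<in> root_space UNIV H \<beta> \<Longrightarrow> y \<in> H \<Longrightarrow> br y x = scale (\<beta> y) x"
  by (simp add: root_space_def)

lemma i_preimage_subspace: "gl7.subspace S \<Longrightarrow> subspace {x. i x \<in> S}"
  by (rule subspaceI) (auto simp: i_simps gl7.subspace_add gl7.subspace_scale gl7.subspace_0)

lemma p_bar_iff: "x \<in> p_bar p \<longleftrightarrow> i x \<in> p"
  by (simp add: p_bar_def)

lemma root_in_roots:
  assumes "k \<noteq> l" "k \<noteq> 1 - l"
  shows "rt k l \<in> roots UNIV H"
proof -
  have "ht k \<noteq> ht l" using wvec_inject[of 3 2 1 k l] assms(1) by auto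
  then have "rt k l (h 3 5) \<noteq> 0" unfolding rt_ht by (simp only: of_int_eq_0_iff)
  then have "rt k l \<noteq> (\<lambda>_. 0)" by auto
  moreover obtain x where x: "x \<in> root_space UNIV H (rt k l)" "i x $ k $ l \<noteq> 0"
    using root_space_nonzero[OF assms] by blast
  then have "x \<noteq> 0" by (intro notI) (simp add: i_simps)
  with x(1) have "root_space UNIV H (rt k l) \<noteq> {0}" by blast
  ultimately show ?thesis by (simp add: roots_def rt_dual)
qed

lemma l_bar_subspace: "subspace (l_bar p)"
  unfolding l_bar_def levi_def by (rule subspace_span)

lemma H_subset_l_bar: "H \<subseteq> l_bar p"
  unfolding l_bar_def levi_def using span_superset by blast

text \<open>If a root vector has a nonzero entry at \<open>(a, b)\<close>, the opposite root has a
  vector with a nonzero entry at \<open>(b, a)\<close>. Both lie in \<open>p\<close>, so the degree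
  of that position is both \<ge> 0 and \<le> 0.\<close>

lemma i_l_bar_graded:
  assumes p: "p = graded w (\<lambda>n. 0 \<le> n)" and x: "x \<in> l_bar p"
  shows "i x \<in> graded w (\<lambda>n. n = 0)"
proof -
  have "l_bar p \<subseteq> {x. i x \<in> graded w (\<lambda>n. n = 0)}"
    unfolding l_bar_def levi_def
  proof (rule span_minimal[OF _ i_preimage_subspace[OF graded_subspace]], intro Un_least UN_least)
    show "H \<subseteq> {x. i x \<in> graded w (\<lambda>n. n = 0)}"
      using i_H_cartan7 cartan7_graded[of "\<lambda>n. n = 0" w] by auto
    fix \<beta> assume "\<beta> \<in> {\<beta> \<in> roots UNIV H. root_space UNIV H \<beta> \<subseteq> p_bar p \<and> root_space UNIV H (- \<beta>) \<subseteq> p_bar p}"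
    then have \<beta>: "\<beta> \<in> roots UNIV H" "root_space UNIV H \<beta> \<subseteq> p_bar p" "root_space UNIV H (- \<beta>) \<subseteq> p_bar p" by auto
    show "root_space UNIV H \<beta> \<subseteq> {x. i x \<in> graded w (\<lambda>n. n = 0)}"
    proof (intro subsetI CollectI gradedI[OF i_so7])
      fix x a b assume x: "x \<in> root_space UNIV H \<beta>" "i x $ a $ b \<noteq> 0"
      have ab: "\<beta> = rt a b" "a \<noteq> b" "a \<noteq> 1 - b" using root_cases[OF \<beta>(1) x] by auto
      have "i x \<in> p" using x \<beta>(2) p_bar_iff by blast
      then have 1: "0 \<le> w a - w b" unfolding p using x(2) by (rule gradedD)
      have "b \<noteq> 1 - a" using ab(3) by auto
      then obtain y where y: "y \<in> root_space UNIV H (rt b a)" "i y $ b $ a \<noteq> 0"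
        using root_space_nonzero[OF ab(2)[symmetric]] by blast
      then have "i y \<in> p" using \<beta>(3) p_bar_iff by (auto simp: ab(1) uminus_rt)
      then have "0 \<le> w b - w a" unfolding p using y(2) by (rule gradedD)
      with 1 show "w a - w b = 0" by simp
    qed
  qed
  with x show ?thesis by auto
qed

text \<open>The spanning elements of \<open>l_bar p\<close> are eigenvectors of \<open>h 3 5\<close>
  whose eigenvalues are heights. A fixed index range, with zero components allowed, lets
  decompositions be added termwise.\<close>

lemma l_bar_weight_components:
  assumes "x \<in> l_bar p"
  shows "\<exists>y. (\<forall>d. y d \<in> l_bar p \<and> br (h 3 5) (y d) = scale (of_int d) (y d)) \<and> x = (\<Sum>d\<in>{- 6..6::int}. y d)"
    (is "?P x")
proof -
  have hom: "?P x" if x: "x \<in> l_bar p" "br (h 3 5) x = scale (of_int d) x" "d \<in> {- 6..6}" for x d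
  proof (intro exI[of _ "\<lambda>d'. if d' = d then x else 0"] conjI allI)
    have "br (h 3 5) (scale 0 0) = scale 0 (br (h 3 5) 0)" by (rule br_scale_right)
    then show "br (h 3 5) (if d' = d then x else 0) = scale (of_int d') (if d' = d then x else 0)" for d'
      using x by simp
  qed (use x subspace_0[OF l_bar_subspace] in auto)
  have "subspace {x. ?P x}"
  proof (rule subspaceI)
    show "0 \<in> {x. ?P x}"
      using hom[of 0 0] subspace_0[OF l_bar_subspace] br_scale_right[of "h 3 5" 0 0] by simp
    fix x y assume "x \<in> {x. ?P x}" "y \<in> {x. ?P x}"
    then obtain u v where "\<forall>d. u d \<in> l_bar p \<and> br (h 3 5) (u d) = scale (of_int d) (u d)" "x = (\<Sum>d\<in>{- 6..6::int}. u d)"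
      "\<forall>d. v d \<in> l_bar p \<and> br (h 3 5) (v d) = scale (of_int d) (v d)" "y = (\<Sum>d\<in>{- 6..6::int}. v d)" by blast
    then show "x + y \<in> {x. ?P x}"
      by (intro CollectI exI[of _ "\<lambda>d. u d + v d"])
        (simp add: br_add_right scale_right_distrib sum.distrib subspace_add[OF l_bar_subspace])
  next
    fix c x assume "x \<in> {x. ?P x}"
    then obtain u where "\<forall>d. u d \<in> l_bar p \<and> br (h 3 5) (u d) = scale (of_int d) (u d)" "x = (\<Sum>d\<in>{- 6..6::int}. u d)"
      by blast
    then show "scale c x \<in> {x. ?P x}"
      by (intro CollectI exI[of _ "\<lambda>d. scale c (u d)"])
        (simp add: br_scale_right scale_sum_right subspace_scale[OF l_bar_subspace] mult.commute)
  qed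
  moreover have "H \<subseteq> {x. ?P x}"
  proof
    fix x assume x: "x \<in> H"
    then have "br (h 3 5) x = scale (of_int 0) x" using H_abelian h_in_H by simp
    from hom[OF subsetD[OF H_subset_l_bar x] this] show "x \<in> {x. ?P x}" by simp
  qed
  moreover have "root_space UNIV H \<beta> \<subseteq> {x. ?P x}"
    if \<beta>: "\<beta> \<in> {\<beta> \<in> roots UNIV H. root_space UNIV H \<beta> \<subseteq> p_bar p \<and> root_space UNIV H (- \<beta>) \<subseteq> p_bar p}" for \<beta>
  proof
    fix x assume x: "x \<in> root_space UNIV H \<beta>"
    have xl: "x \<in> l_bar p"
      unfolding l_bar_def levi_def using x \<beta> by (intro span_base) blast
    show "x \<in> {x. ?P x}"
    proof (cases "x = 0")
      case True
      then show ?thesis using subspace_0[OF \<open>subspace {x. ?P x}\<close>] by (simp only:)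
    next
      case False
      then obtain a b where "i x $ a $ b \<noteq> 0" using i_eq_0[of x] by (auto simp: vec_eq_iff)
      then have "\<beta> = rt a b" using root_cases \<beta> x by blast
      then have "br (h 3 5) x = scale (of_int (ht a - ht b)) x" using br_root_space[OF x h_in_H] rt_ht by simp
      then show ?thesis using hom[OF xl _ ht_bounds] by blast
    qed
  qed
  ultimately have "l_bar p \<subseteq> {x. ?P x}"
    unfolding l_bar_def levi_def by (intro span_minimal Un_least UN_least)
  with assms show ?thesis by auto
qed

text \<open>3 and 5 solve the system given by the Cartan matrix: 3 * 2 - 5 = 1 and - 3 * 3 + 5 * 2 =
  1.\<close>

lemma simple_root_h: "k \<in> {1, 2} \<Longrightarrow> \<alpha> k (h 3 5) = 1"
proof -
  have diag: "\<alpha> k (br (gb (int k)) (gb (- int k))) = 2" if "k \<in> {1, 2}" for k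
    using gb_chevalley that unfolding chevalley_generators_def by blast
  have "br (gb 1) (gb (- 1)) \<in> H" "br (gb 2) (gb (- 2)) \<in> H"
    unfolding H_def by (auto intro: span_base)
  then have "\<alpha> k (h 3 5) = 3 * \<alpha> k (br (gb 1) (gb (- 1))) + 5 * \<alpha> k (br (gb 2) (gb (- 2)))" if "k \<in> {1, 2}" for k
    using \<alpha>_dual that subspace_scale[OF H_subspace] unfolding dual_def linear_on_def h_def by auto
  from this[of 1] this[of 2] show "k \<in> {1, 2} \<Longrightarrow> \<alpha> k (h 3 5) = 1"
    using diag[of 1] diag[of 2] cartan_matrix by auto
qed

lemma borel_bar_upper:
  assumes "x \<in> borel_bar"
  shows "i x \<in> graded ht (\<lambda>n. 0 \<le> n)"
proof -
  have "borel_bar \<subseteq> {x. i x \<in> graded ht (\<lambda>n. 0 \<le> n)}"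
    unfolding borel_bar_def borel_def
  proof (rule span_minimal[OF _ i_preimage_subspace[OF graded_subspace]], intro Un_least UN_least)
    show "H \<subseteq> {x. i x \<in> graded ht (\<lambda>n. 0 \<le> n)}"
      using i_H_cartan7 cartan7_graded[of "\<lambda>n. 0 \<le> n" ht] by auto
    fix \<beta> assume "\<beta> \<in> {\<beta> \<in> roots UNIV H. \<exists>n. \<beta> = (\<lambda>x. \<Sum>k\<in>{1, 2}. of_nat (n k) * \<alpha> k x)}"
    then obtain n where \<beta>: "\<beta> \<in> roots UNIV H" "\<beta> = (\<lambda>x. \<Sum>k\<in>{1, 2}. of_nat (n k) * \<alpha> k x)" by blast
    have "\<beta> (h 3 5) = of_nat (n 1 + n 2)"
      unfolding \<beta>(2) using simple_root_h[of 1] simple_root_h[of 2] by simp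
    then have ge: "\<beta> (h 3 5) = of_int (int (n 1 + n 2))" by simp
    show "root_space UNIV H \<beta> \<subseteq> {x. i x \<in> graded ht (\<lambda>n. 0 \<le> n)}"
    proof (intro subsetI CollectI gradedI[OF i_so7])
      fix x a b assume "x \<in> root_space UNIV H \<beta>" "i x $ a $ b \<noteq> 0"
      then have "\<beta> = rt a b" using root_cases \<beta>(1) by blast
      then have "of_int (ht a - ht b) = (of_int (int (n 1 + n 2)) :: complex)" using ge rt_ht by metis
      then have "ht a - ht b = int (n 1 + n 2)" by (simp only: of_int_eq_iff)
      then show "0 \<le> ht a - ht b" by simp
    qed
  qed
  with assms show ?thesis by auto
qed

lemma nilrad_bar_upper:
  assumes "x \<in> nilrad UNIV H borel_bar"
  shows "i x \<in> graded ht (\<lambda>n. 0 < n)"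
proof -
  have "nilrad UNIV H borel_bar \<subseteq> {x. i x \<in> graded ht (\<lambda>n. 0 < n)}"
    unfolding nilrad_def
  proof (rule span_minimal[OF _ i_preimage_subspace[OF graded_subspace]], intro UN_least)
    fix \<beta> assume "\<beta> \<in> {\<beta> \<in> roots UNIV H. root_space UNIV H \<beta> \<subseteq> borel_bar \<and> \<not> root_space UNIV H (- \<beta>) \<subseteq> borel_bar}"
    then have \<beta>: "\<beta> \<in> roots UNIV H" "root_space UNIV H \<beta> \<subseteq> borel_bar" by auto
    show "root_space UNIV H \<beta> \<subseteq> {x. i x \<in> graded ht (\<lambda>n. 0 < n)}"
    proof (intro subsetI CollectI gradedI[OF i_so7])
      fix x a b assume x: "x \<in> root_space UNIV H \<beta>" "i x $ a $ b \<noteq> 0"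
      then have "0 \<le> ht a - ht b" using borel_bar_upper \<beta>(2) gradedD by blast
      moreover have "ht a \<noteq> ht b" using root_cases(2)[OF \<beta>(1) x] wvec_inject[of 3 2 1 a b] by auto
      ultimately show "0 < ht a - ht b" by simp
    qed
  qed
  with assms show ?thesis by auto
qed

text \<open>This is the condition \<open>raise\<close> of the highest weight argument. The component
  of eigenvalue \<open>d\<close> has entries only at positions of height \<open>d\<close>, and an
  element of the nilradical has none at heights \<le> 0; so only components with positive eigenvalue
  survive.\<close>

lemma positive_part_of_l_bar:
  "l_bar p \<inter> nilrad UNIV H borel_bar \<subseteq> span {y\<in>l_bar p. \<exists>c>0. br (h 3 5) y = scale (of_real c) y}"
proof
  fix x assume x: "x \<in> l_bar p \<inter> nilrad UNIV H borel_bar"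
  then obtain y where y: "\<And>d. y d \<in> l_bar p" "\<And>d. br (h 3 5) (y d) = scale (of_int d) (y d)"
    "x = (\<Sum>d\<in>{- 6..6::int}. y d)" using l_bar_weight_components[of x p] by blast
  have supp: "i (y d) $ a $ b = 0" if "d \<noteq> ht a - ht b" for d a b
  proof -
    have "i (br (h 3 5) (y d)) $ a $ b = (i (h 3 5) $ a $ a - i (h 3 5) $ b $ b) * i (y d) $ a $ b"
      unfolding i_br by (rule cartan7_commutator[OF i_H_cartan7[OF h_in_H]])
    also have "i (h 3 5) $ a $ a - i (h 3 5) $ b $ b = of_int (ht a - ht b)"
      using rt_ht[of a b] by (simp add: rt_def h_in_H)
    finally have "of_int d * i (y d) $ a $ b = of_int (ht a - ht b) * i (y d) $ a $ b"
      unfolding y(2) i_simps by simp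
    moreover have "of_int d \<noteq> (of_int (ht a - ht b) :: complex)" using that by (simp only: of_int_eq_iff) simp
    ultimately show ?thesis by simp
  qed
  have "y d = 0" if d: "d \<in> {- 6..6}" "d \<le> 0" for d
  proof -
    have "i (y d) $ a $ b = 0" for a b
    proof (rule ccontr)
      assume nz: "i (y d) $ a $ b \<noteq> 0"
      then have eq: "d = ht a - ht b" using supp by blast
      have "i x $ a $ b = (\<Sum>d'\<in>{- 6..6}. if d' = d then i (y d) $ a $ b else 0)"
        unfolding y(3) i_simps sum_component by (intro sum.cong refl) (use supp eq in auto)
      then have "i x $ a $ b \<noteq> 0" using d(1) nz by simp
      then have "0 < ht a - ht b" using nilrad_bar_upper x gradedD by blast
      then show False using eq d(2) by simp
    qed
    then show ?thesis by (intro i_eq_0) (simp add: vec_eq_iff)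
  qed
  then have "y d \<in> span {y\<in>l_bar p. \<exists>c>0. br (h 3 5) y = scale (of_real c) y}" if "d \<in> {- 6..6}" for d
  proof (cases "d \<le> 0")
    case False
    then have "br (h 3 5) (y d) = scale (of_real (of_int d)) (y d)" "0 < (of_int d :: real)" using y(2) by auto
    then show ?thesis using y(1) by (intro span_base CollectI) blast
  qed (use that span_zero in auto)
  then show "x \<in> span {y\<in>l_bar p. \<exists>c>0. br (h 3 5) y = scale (of_real c) y}"
    unfolding y(3) by (rule span_sum)
qed

lemma opp_nilrad_bar:
  fixes p defines "n \<equiv> opp_nilrad UNIV H (p_bar p)"
  shows "subspace n" and "y \<in> n \<Longrightarrow> x \<in> H \<Longrightarrow> br x y \<in> n"
proof -
  show n: "subspace n" unfolding n_def opp_nilrad_def by (rule subspace_span)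
  assume y: "y \<in> n" and x: "x \<in> H"
  have "n \<subseteq> {y\<in>n. br x y \<in> n}"
  proof (subst (1) n_def, subst opp_nilrad_def, rule span_minimal, intro UN_least subsetI CollectI conjI)
    fix \<beta> y assume \<beta>: "\<beta> \<in> {\<beta> \<in> roots UNIV H. root_space UNIV H \<beta> \<subseteq> p_bar p \<and> \<not> root_space UNIV H (- \<beta>) \<subseteq> p_bar p}"
      and y: "y \<in> root_space UNIV H (- \<beta>)"
    then show "y \<in> n" unfolding n_def opp_nilrad_def by (intro span_base) blast
    then show "br x y \<in> n" using br_root_space[OF y x] subspace_scale[OF n] subspace_neg[OF n] by simp
  next
    have "br x (scale 0 0) = scale 0 (br x 0)" by (rule br_scale_right)
    then show "subspace {y\<in>n. br x y \<in> n}"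
      using subspace_add[OF n] subspace_scale[OF n] subspace_0[OF n]
      by (intro subspaceI) (auto simp: br_add_right br_scale_right)
  qed
  then show "br x y \<in> n" using y by blast
qed

text \<open>The weight \<open>rt 4 1 = rt 5 2\<close> has multiplicity 2 in so(7), but 1 in the Lie algebra of type G2.\<close>

lemma rt_4_1: "rt 5 2 = rt 4 1"
proof
  fix x
  show "rt 5 2 x = rt 4 1 x"
  proof (cases "x \<in> H")
    case True
    then obtain s t where "x = h s t" using H_iff by blast
    then show ?thesis by (simp add: rt_h)
  qed (simp add: rt_def)
qed

text \<open>One of the equations for G2 ties the entry at \<open>(4, 1)\<close> to the one at
  \<open>(5, 2)\<close>, and no other entries, up to mirroring, can occur in this weight.\<close>

lemma root_space_4_1:
  assumes x: "x \<in> root_space UNIV H (rt 4 1)" and 0: "i x $ 5 $ 2 = 0"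
  shows "x = 0"
proof -
  obtain c1 c2 c3 where c: "c1 \<noteq> 0" "c2 \<noteq> 0" "c3 \<noteq> 0" and gen:
    "i (gb 1) = mat_scale c1 (R 1 2) + mat_scale c3 (R 3 4)" "i (gb 2) = mat_scale c2 (R 2 3)"
    "i (gb (- 1)) = mat_scale (1 / c1) (R 2 1) + mat_scale (2 / c3) (R 4 3)" "i (gb (- 2)) = mat_scale (1 / c2) (R 3 2)"
    by (rule generators)
  have "i x $ 5 $ 2 = c1 / c3 * i x $ 4 $ 1"
    using i_G2_matrices[OF c gen, of x] by (simp add: G2_matrices_def)
  then have 41: "i x $ 4 $ 1 = 0" using 0 c by simp
  have "i x $ a $ b = 0" for a b
  proof (rule ccontr)
    assume ab: "i x $ a $ b \<noteq> 0"
    \<comment> \<open>The image of \<open>h 4 7\<close> is \<open>D 4 3 1\<close>, on which the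
      weight -4 occurs only at \<open>(4, 1)\<close>, \<open>(5, 2)\<close> and their mirror
      images.\<close>
    then have "rt a b (h 4 7) = rt 4 1 (h 4 7)"
      using x h_in_H[of 4 7] unfolding root_space_iff by (auto simp: rt_def)
    then have "of_int (wvec 4 3 1 a - wvec 4 3 1 b) = (of_int (- 4) :: complex)"
      by (simp add: rt_h of_int_wvec)
    then have "wvec 4 3 1 a - wvec 4 3 1 b = (- 4 :: int)" by (simp only: of_int_eq_iff)
    moreover have "\<forall>a b. wvec 4 3 1 a - wvec 4 3 1 b = (- 4 :: int) \<longrightarrow>
        (a = 4 \<and> b = 1) \<or> (a = 7 \<and> b = 4) \<or> (a = 5 \<and> b = 2) \<or> (a = 6 \<and> b = 3)"
      unfolding forall_7 by simp
    ultimately have "(a = 4 \<and> b = 1) \<or> (a = 7 \<and> b = 4) \<or> (a = 5 \<and> b = 2) \<or> (a = 6 \<and> b = 3)" by blast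
    then show False using ab 41 0 so7_entries[OF i_so7, of x] by auto
  qed
  then show ?thesis by (intro i_eq_0) (simp add: vec_eq_iff)
qed

section \<open>The submodule \<open>N\<close> of the opposite nilradical\<close>

context
  fixes p N and w :: "7 \<Rightarrow> int"
  assumes w: "antisym7 w" and p: "p = graded w (\<lambda>n. 0 \<le> n)" and N: "admissible_N p N"
begin

lemma admissible_N_subset: "gl7.subspace N" "N \<subseteq> graded w (\<lambda>n. n < 0)"
  "\<And>x y. x \<in> l_bar p \<Longrightarrow> y \<in> N \<Longrightarrow> commutator (i x) y \<in> N"
  using N unfolding admissible_N_def opp_nilrad_graded[OF w p] by blast+

lemma admissible_N_iso:
  obtains \<phi> where "linear_on scale mat_scale (opp_nilrad UNIV H (p_bar p)) \<phi>"
    "bij_betw \<phi> (opp_nilrad UNIV H (p_bar p)) N"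
    "\<And>x y. x \<in> l_bar p \<Longrightarrow> y \<in> opp_nilrad UNIV H (p_bar p) \<Longrightarrow> \<phi> (br x y) = commutator (i x) (\<phi> y)"
  using N unfolding admissible_N_def by blast

lemma R_4_1_R_5_2_not_both_in_N: "\<not> (R 4 1 \<in> N \<and> R 5 2 \<in> N)"
proof
  assume R: "R 4 1 \<in> N \<and> R 5 2 \<in> N"
  obtain \<phi> where \<phi>: "linear_on scale mat_scale (opp_nilrad UNIV H (p_bar p)) \<phi>"
    "bij_betw \<phi> (opp_nilrad UNIV H (p_bar p)) N"
    "\<And>x y. x \<in> l_bar p \<Longrightarrow> y \<in> opp_nilrad UNIV H (p_bar p) \<Longrightarrow> \<phi> (br x y) = commutator (i x) (\<phi> y)"
    using admissible_N_iso by blast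
  let ?n = "opp_nilrad UNIV H (p_bar p)"
  note n = opp_nilrad_bar[where p = p]
  \<comment> \<open>\<open>\<phi>\<close> is equivariant under \<open>H\<close> and injective, so
    the preimage of a root vector is a weight vector for the restricted root.\<close>
  have weight: "y \<in> root_space UNIV H (rt k l)" if y: "y \<in> ?n" "\<phi> y = R k l" for y k l
  proof -
    have "br x y = scale (rt k l x) y" if x: "x \<in> H" for x
    proof -
      have "\<phi> (br x y) = commutator (i x) (R k l)" using \<phi>(3)[OF subsetD[OF H_subset_l_bar x] y(1)] y(2) by simp
      also have "\<dots> = mat_scale (rt k l x) (R k l)"
        using R_in_root_space[of k l] i_H_cartan7[OF x] by (simp add: gl7.root_space_def root7_apply rt_def x)
      also have "\<dots> = \<phi> (scale (rt k l x) y)" using \<phi>(1) y unfolding linear_on_def by simp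
      finally show ?thesis
        using \<phi>(2) n(2)[OF y(1) x] subspace_scale[OF n(1) y(1)] unfolding bij_betw_def inj_on_def by blast
    qed
    then show ?thesis by (simp add: root_space_def)
  qed
  obtain y1 y2 where y: "y1 \<in> ?n" "\<phi> y1 = R 4 1" "y2 \<in> ?n" "\<phi> y2 = R 5 2"
  proof -
    have "R 4 1 \<in> \<phi> ` ?n" "R 5 2 \<in> \<phi> ` ?n" using R \<phi>(2) by (simp_all add: bij_betw_def)
    then show ?thesis using that by (auto elim!: imageE)
  qed
  have rs: "y1 \<in> root_space UNIV H (rt 4 1)" "y2 \<in> root_space UNIV H (rt 4 1)"
    using weight[OF y(1,2)] weight[OF y(3,4)] by (simp_all add: rt_4_1)
  \<comment> \<open>These coefficients cancel the entry at \<open>(5, 2)\<close> of the combination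
    of \<open>y1\<close> and \<open>y2\<close>, which is thereby 0; applying \<open>\<phi>\<close>
    then gives a relation between the independent matrices \<open>R 4 1\<close> and
    \<open>R 5 2\<close>.\<close>
  define s t where "s = i y2 $ 5 $ 2" and "t = - i y1 $ 5 $ 2"
  have "scale s y1 + scale t y2 \<in> root_space UNIV H (rt 4 1)"
    using rs by (simp add: root_space_def br_add_right br_scale_right scale_right_distrib mult.commute)
  then have 0: "scale s y1 + scale t y2 = 0"
    by (rule root_space_4_1) (simp add: i_simps s_def t_def)
  have "\<phi> (scale s y1 + scale t y2) = mat_scale s (R 4 1) + mat_scale t (R 5 2)"
    using \<phi>(1) y subspace_scale[OF n(1)] unfolding linear_on_def by simp
  moreover have "\<phi> 0 = 0"
    using linear_on_0[OF vector_space_axioms gl7.vector_space_axioms n(1) \<phi>(1)] .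
  ultimately have "mat_scale s (R 4 1) + mat_scale t (R 5 2) = 0" using 0 by simp
  from arg_cong[OF this, of "\<lambda>X. X $ 4 $ 1"] have "s = 0" by (simp add: R_nth)
  then have "y2 = 0" using root_space_4_1[OF rs(2)] by (simp add: s_def)
  then have "R 5 2 = 0" using y \<open>\<phi> 0 = 0\<close> by simp
  from arg_cong[OF this, of "\<lambda>X. X $ 5 $ 2"] show False by (simp add: R_nth)
qed

end

text \<open>The opposite nilradical is spanned by \<open>R k 1\<close> for k = 2, ..., 6, of heights
  -1, ..., -5, so \<open>h 3 5\<close> alone separates its weights. The image under the isomorphism
  of a vector of weight \<open>rt k 1\<close> must therefore be a multiple of
  \<open>R k 1\<close>.\<close>

lemma N_par_1_0_0:
  assumes N: "admissible_N (par 1 0 0) N"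
  shows "N = graded (parabolic_degree 1 0 0) (\<lambda>n. n < 0)"
proof
  let ?w = "parabolic_degree 1 0 0" and ?n = "opp_nilrad UNIV H (p_bar (par 1 0 0))"
  note A = admissible_N_subset[OF antisym7_parabolic_degree refl N]
  note n = opp_nilrad_bar[where p = "par 1 0 0"]
  show "N \<subseteq> graded ?w (\<lambda>n. n < 0)" by (rule A(2))
  obtain \<phi> where \<phi>: "linear_on scale mat_scale ?n \<phi>" "bij_betw \<phi> ?n N"
    "\<And>x y. x \<in> l_bar (par 1 0 0) \<Longrightarrow> y \<in> ?n \<Longrightarrow> \<phi> (br x y) = commutator (i x) (\<phi> y)"
    using admissible_N_iso[OF antisym7_parabolic_degree refl N] by blast
  have \<phi>0: "\<phi> 0 = 0"
    using linear_on_0[OF vector_space_axioms gl7.vector_space_axioms n(1) \<phi>(1)] .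
  have w0: "?w k = (if k = 1 then 1 else if k = 7 then -1 else 0)" for k
  proof -
    have "\<forall>k. ?w k = (if k = 1 then 1 else if k = 7 then -1 else 0)"
      unfolding forall_7 by (simp add: parabolic_degree_def)
    then show ?thesis by blast
  qed
  note w = w0 w0[simplified]
  have mirrors: "(1 :: 7) - 1 = 7" "(1 :: 7) - 7 = 1" by simp_all
  have htle: "ht k \<le> ht 1" for k
  proof -
    have "\<forall>k. ht k \<le> ht 1" unfolding forall_7 by simp
    then show ?thesis by blast
  qed
  have col: "R k 1 \<in> N" if k: "k \<noteq> 1" "k \<noteq> 7" for k
  proof -
    have k': "k \<noteq> 1 - 1" "1 \<noteq> k" "1 \<noteq> 1 - k"
      using k mirrors mirror_eq[of k 1] by metis+
    obtain y where y: "y \<in> root_space UNIV H (rt k 1)" "i y $ k $ 1 \<noteq> 0"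
      using root_space_nonzero[OF k(1) k'(1)] by blast
    \<comment> \<open>Several positions may share this restricted root, but all have the height of
      \<open>(1, k)\<close>, which is nonnegative, and nonnegative height implies nonnegative
      degree.\<close>
    have "root_space UNIV H (rt 1 k) \<subseteq> p_bar (par 1 0 0)"
    proof
      fix x assume x: "x \<in> root_space UNIV H (rt 1 k)"
      show "x \<in> p_bar (par 1 0 0)"
        unfolding p_bar_iff
      proof (rule gradedI[OF i_so7])
        fix a b assume "i x $ a $ b \<noteq> 0"
        then have "rt 1 k = rt a b" using root_cases(1)[OF root_in_roots[OF k'(2,3)] x] by blast
        then have "of_int (ht a - ht b) = (of_int (ht 1 - ht k) :: complex)" using rt_ht by metis
        then have "ht a - ht b = ht 1 - ht k" by (simp only: of_int_eq_iff)
        then show "0 \<le> ?w a - ?w b" using htle[of k] parabolic_degree_mono[of b a 1 0 0] by simp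
      qed
    qed
    moreover have "\<not> root_space UNIV H (- rt 1 k) \<subseteq> p_bar (par 1 0 0)"
    proof
      assume "root_space UNIV H (- rt 1 k) \<subseteq> p_bar (par 1 0 0)"
      then have "i y \<in> par 1 0 0" using y(1) by (auto simp: uminus_rt p_bar_iff)
      from gradedD[OF this y(2)] show False using k by (simp add: w)
    qed
    ultimately have yn: "y \<in> ?n"
      unfolding opp_nilrad_def using root_in_roots[OF k'(2,3)] y(1)
      by (intro span_base UN_I[of "rt 1 k"]) (simp_all add: uminus_rt)
    define Y where "Y = \<phi> y"
    have YN: "Y \<in> N" using \<phi>(2) yn by (auto simp: Y_def bij_betw_def)
    have Ybr: "commutator (i x) Y = mat_scale (rt k 1 x) Y" if x: "x \<in> H" for x
      using \<phi>(1) \<phi>(3)[OF subsetD[OF H_subset_l_bar x] yn] yn br_root_space[OF y(1) x]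
      unfolding linear_on_def Y_def by auto
    have "Y \<noteq> 0"
    proof
      assume "Y = 0"
      then have "y = 0" using \<phi>(2) \<phi>0 yn subspace_0[OF n(1)] unfolding bij_betw_def inj_on_def Y_def by auto
      then show False using y(2) by (simp add: i_simps)
    qed
    have "Y = mat_scale (Y $ k $ 1) (R k 1)"
    proof (rule so7_eq_scale_R[OF _ k(1) k'(1)])
      show "Y \<in> so7" using YN A(2) graded_so7 by blast
      fix a b assume ab: "Y $ a $ b \<noteq> 0"
      have "(i (h 3 5) $ a $ a - i (h 3 5) $ b $ b) * Y $ a $ b = commutator (i (h 3 5)) Y $ a $ b"
        by (rule cartan7_commutator[OF i_H_cartan7[OF h_in_H], symmetric])
      also have "\<dots> = rt k 1 (h 3 5) * Y $ a $ b"
        unfolding Ybr[OF h_in_H] by (rule mat_scale_nth)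
      finally have "(i (h 3 5) $ a $ a - i (h 3 5) $ b $ b) * Y $ a $ b = rt k 1 (h 3 5) * Y $ a $ b" .
      then have "rt a b (h 3 5) = rt k 1 (h 3 5)" using ab by (simp add: rt_def h_in_H)
      then have "of_int (ht a - ht b) = (of_int (ht k - ht 1) :: complex)" unfolding rt_ht .
      then have eq: "ht a - ht b = ht k - ht 1" by (simp only: of_int_eq_iff)
      \<comment> \<open>Negative degree confines the entry to the first column or the last row,
        where the height determines the remaining index.\<close>
      have "?w a - ?w b < 0" using YN A(2) ab gradedD by blast
      then have "b = 1 \<or> a = 7" by (auto simp: w split: if_splits)
      then show "a = k \<and> b = 1 \<or> a = 1 - 1 \<and> b = 1 - k"
      proof
        assume "b = 1"
        then show ?thesis using eq wvec_inject[of 3 2 1 a k] by simp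
      next
        assume "a = 7"
        then have "ht b = ht (1 - k)" using eq by simp
        then have "b = 1 - k" by (rule wvec_inject) simp_all
        then show ?thesis using \<open>a = 7\<close> by (simp add: negative_7)
      qed
    qed
    moreover from this have "Y $ k $ 1 \<noteq> 0" using \<open>Y \<noteq> 0\<close> by (metis gl7.scale_zero_left)
    ultimately have "R k 1 = mat_scale (1 / Y $ k $ 1) Y"
      by (metis gl7.scale_scale gl7.scale_one nonzero_divide_eq_eq)
    then show ?thesis using gl7.subspace_scale[OF A(1) YN] by simp
  qed
  show "graded ?w (\<lambda>n. n < 0) \<subseteq> N"
  proof (rule graded_subset[OF A(1)])
    fix k l assume kl: "?w k - ?w l < 0" "k \<noteq> 1 - l"
    then consider "l = 1" "k \<noteq> 1" "k \<noteq> 7" | "k = 7" "l \<noteq> 1" "l \<noteq> 7"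
      by (auto simp: w negative_7 split: if_splits)
    then show "R k l \<in> N"
    proof cases
      case 2
      have "1 - l \<noteq> 1" "1 - l \<noteq> 7" using 2 mirrors unfolding mirror_eq[of l] by auto
      then have "R (1 - l) 1 \<in> N" by (rule col)
      moreover have "R (1 - l) 1 = - R k l" using R_mirror[of l 7] 2 by (simp add: negative_7)
      ultimately have "- (- R k l) \<in> N" using gl7.subspace_neg[OF A(1)] by metis
      then show ?thesis by simp
    qed (use col in simp)
  qed
qed

end

section \<open>The branching problem\<close>

lemma tensor_single_left: "tensor (Poly_Mapping.single k 1) v = lin_ext (\<lambda>j. Poly_Mapping.single (k, j) 1) v"
  by (simp add: tensor_def)

lemma tensor_single_right: "tensor u (Poly_Mapping.single l 1) = lin_ext (\<lambda>k. Poly_Mapping.single (k, l) 1) u"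
  by (simp add: tensor_def)

lemma lin_ext_0 [simp]: "lin_ext b 0 = 0"
  by (simp add: lin_ext_def)

lemma tensor_act_single:
  "tensor_act T E (Poly_Mapping.single (k, l) 1) =
     lin_ext (\<lambda>k. Poly_Mapping.single (k, l) 1) (T (Poly_Mapping.single k 1)) +
     lin_ext (\<lambda>j. Poly_Mapping.single (k, j) 1) (E (Poly_Mapping.single l 1))"
  by (simp add: tensor_act_def tensor_single_left tensor_single_right)

lemma lin_tensor_act: "lin (tensor_act T E)"
  unfolding tensor_act_def by (rule lin_lin_ext)

text \<open>Under the trivial action on the first factor each copy of the second factor is a
  submodule; this carries submodules of the symmetric algebra over to the tensor product.\<close>

lemma tensor_act_zero_left:
  "tensor_act (\<lambda>v. 0) E (lin_ext (\<lambda>j. Poly_Mapping.single (k, j) 1) s) =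
     lin_ext (\<lambda>j. Poly_Mapping.single (k, j) 1) (E s)" if "lin E"
  by (rule lin_eq_on[OF lin_comp[OF lin_tensor_act lin_lin_ext] lin_comp[OF lin_lin_ext that]])
    (simp add: tensor_act_single)

text \<open>If \<open>r = 0\<close> then \<open>V \<otimes> S(\<complex>\<^sup>r)\<close> is \<open>V\<close>.\<close>

lemma tensor_act_sym_trivial:
  assumes T: "linear_on pm_scale pm_scale (coord d) T" and t: "t \<in> coord_tensor_sym d 0"
  defines "P \<equiv> lin_ext (\<lambda>(k, M). Poly_Mapping.single k 1)"
  shows "P (tensor_act T (sym_act E) t) = T (P t)" "P t \<in> coord d" "P t = 0 \<Longrightarrow> t = 0"
proof -
  have P: "lin P" unfolding P_def by (rule lin_lin_ext)
  have keys: "k < d \<and> M = {#}" if "(k, M) \<in> Poly_Mapping.keys t" for k M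
    using t that by (auto simp: coord_tensor_sym_def)
  have P_single: "P (Poly_Mapping.single km 1) = Poly_Mapping.single (fst km) 1" for km
    by (simp add: P_def case_prod_beta)
  have PJ: "P (lin_ext (\<lambda>k. Poly_Mapping.single (k, M) 1) u) = u" for u and M :: "nat multiset"
    by (rule lin_eq_on[OF lin_comp[OF P lin_lin_ext] lin_id]) (simp add: P_single)
  have "P (tensor_act T (sym_act E) t) =
      (\<Sum>km\<in>Poly_Mapping.keys t. pm_scale (Poly_Mapping.lookup t km) (P (tensor_act T (sym_act E) (Poly_Mapping.single km 1))))"
    by (rule lin_apply_expansion[OF lin_comp[OF P lin_tensor_act]])
  also have "\<dots> = (\<Sum>km\<in>Poly_Mapping.keys t. pm_scale (Poly_Mapping.lookup t km) (T (Poly_Mapping.single (fst km) 1)))"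
  proof (intro sum.cong refl)
    fix km assume "km \<in> Poly_Mapping.keys t"
    then obtain k where "km = (k, {#})" using keys by (cases km) auto
    then show "pm_scale (Poly_Mapping.lookup t km) (P (tensor_act T (sym_act E) (Poly_Mapping.single km 1))) =
        pm_scale (Poly_Mapping.lookup t km) (T (Poly_Mapping.single (fst km) 1))"
      by (simp add: tensor_act_single sym_act_one PJ)
  qed
  also have "\<dots> = T (\<Sum>km\<in>Poly_Mapping.keys t. pm_scale (Poly_Mapping.lookup t km) (Poly_Mapping.single (fst km) 1))"
    by (rule linear_on_sum[OF pm.vector_space_axioms pm.vector_space_axioms coord_subspace T, symmetric])
      (use keys in \<open>auto simp: coord_def\<close>)
  also have "(\<Sum>km\<in>Poly_Mapping.keys t. pm_scale (Poly_Mapping.lookup t km) (Poly_Mapping.single (fst km) 1)) = P t"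
    by (simp add: lin_apply_expansion[OF P, of t] P_single)
  finally show "P (tensor_act T (sym_act E) t) = T (P t)" .
  show "P t \<in> coord d"
    unfolding coord_def
  proof (rule CollectI, rule keys_lin_subset[OF P])
    fix km assume "km \<in> Poly_Mapping.keys t"
    then show "Poly_Mapping.keys (P (Poly_Mapping.single km 1)) \<subseteq> {..<d}"
      using keys[of "fst km" "snd km"] by (simp add: P_single)
  qed
  have "lin_ext (\<lambda>k. Poly_Mapping.single (k, {#}) 1) (P t) = t"
  proof (rule lin_eq_on[OF lin_comp[OF lin_lin_ext P] lin_id])
    fix km assume "km \<in> Poly_Mapping.keys t"
    then obtain k where "km = (k, {#})" using keys by (cases km) auto
    then show "lin_ext (\<lambda>k. Poly_Mapping.single (k, {#}) 1) (P (Poly_Mapping.single km 1)) = Poly_Mapping.single km 1"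
      by (simp add: P_single)
  qed
  then show "P t = 0 \<Longrightarrow> t = 0" by (metis lin_ext_0)
qed

lemma finite_multisets: "finite {M. set_mset M \<subseteq> {..<r::nat} \<and> size M = n}"
proof -
  have "{M. set_mset M \<subseteq> {..<r} \<and> size M = n} \<subseteq> mset ` {xs. set xs \<subseteq> {..<r} \<and> length xs = n}"
  proof
    fix M assume M: "M \<in> {M. set_mset M \<subseteq> {..<r} \<and> size M = n}"
    obtain xs where "mset xs = M" using ex_mset by blast
    then show "M \<in> mset ` {xs. set xs \<subseteq> {..<r} \<and> length xs = n}" using M by force
  qed
  then show ?thesis by (rule finite_subset) (auto intro: finite_lists_length_eq)
qed

text \<open>The complement of \<open>N\<close> can be chosen to be spanned by root vectors.\<close>

lemma quotient_coordinates:
  assumes N: "gl7.subspace N" "N \<subseteq> graded w (\<lambda>n. n < 0)" "N \<noteq> graded w (\<lambda>n. n < 0)" and w: "antisym7 w"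
  obtains r kk ll \<pi> where "0 < r" "\<forall>j<r. w (kk j) < w (ll j)"
    "linear_on mat_scale pm_scale (graded w (\<lambda>n. n < 0)) \<pi>" "\<pi> ` graded w (\<lambda>n. n < 0) = coord r"
    "{y\<in>graded w (\<lambda>n. n < 0). \<pi> y = 0} = N"
    "\<forall>j<r. \<pi> (R (kk j) (ll j)) = Poly_Mapping.single j 1"
proof -
  let ?n = "graded w (\<lambda>n. n < 0)"
  define Rs where "Rs = (\<lambda>(k, l). R k l) ` {(k, l). w k < w l}"
  have Rs: "finite Rs" "Rs \<subseteq> ?n" using R_in_graded[OF w, of "\<lambda>n. n < 0"] by (auto simp: Rs_def)
  obtain BN where BN: "BN \<subseteq> N" "gl7.independent BN" "N \<subseteq> gl7.span BN"
    using gl7.basis_exists[of N] by metis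
  obtain B where B: "BN \<subseteq> B" "B \<subseteq> BN \<union> Rs" "gl7.independent B" "BN \<union> Rs \<subseteq> gl7.span B"
    using gl7.maximal_independent_subset_extend[OF Un_upper1[of BN Rs] BN(2)] by metis
  have nB: "?n \<subseteq> gl7.span B"
    using B(4) by (intro graded_subset[OF gl7.subspace_span]) (auto simp: Rs_def)
  have spanBN: "gl7.span BN = N" using BN N(1) gl7.span_minimal by blast
  define C where "C = B - BN"
  have C: "C \<subseteq> Rs" "finite C"
  proof -
    show "C \<subseteq> Rs" using B(2) by (auto simp: C_def)
    then show "finite C" using Rs(1) by (rule finite_subset)
  qed
  define r where "r = card C"
  obtain bb where bb: "bij_betw bb {..<r} C"
    using ex_bij_betw_nat_finite[OF C(2)] by (auto simp: r_def atLeast0LessThan)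
  have bbC: "bb j \<in> C" if "j < r" for j using bb that by (auto simp: bij_betw_def)
  have bbn: "bb j \<in> ?n" if "j < r" for j using bbC[OF that] C(1) Rs(2) by auto
  have "\<forall>j. \<exists>k l. j < r \<longrightarrow> bb j = R k l \<and> w k < w l"
  proof (intro allI)
    fix j
    show "\<exists>k l. j < r \<longrightarrow> bb j = R k l \<and> w k < w l"
    proof (cases "j < r")
      case True
      then have "bb j \<in> Rs" using bbC C(1) by blast
      then show ?thesis unfolding Rs_def by auto
    qed simp
  qed
  then obtain kk ll where kl: "\<And>j. j < r \<Longrightarrow> bb j = R (kk j) (ll j) \<and> w (kk j) < w (ll j)" by metis
  \<comment> \<open>\<open>\<pi>\<close> reads off the coordinates at the added root vectors
    \<open>C\<close>, so its kernel is the span of \<open>BN\<close>.\<close>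
  define \<pi> where "\<pi> X = (\<Sum>j<r. pm_scale (gl7.representation B X (bb j)) (Poly_Mapping.single j 1))" for X
  have lookup: "Poly_Mapping.lookup (\<pi> X) j = (if j < r then gl7.representation B X (bb j) else 0)" for X j
    by (simp add: \<pi>_def lookup_sum lookup_pm_scale lookup_single when_def if_distrib cong: if_cong)
  have lin: "linear_on mat_scale pm_scale ?n \<pi>"
    unfolding linear_on_def
  proof (intro conjI ballI allI)
    fix X Y assume "X \<in> ?n" "Y \<in> ?n"
    then have "gl7.representation B (X + Y) = (\<lambda>b. gl7.representation B X b + gl7.representation B Y b)"
      using nB by (intro gl7.representation_add[OF B(3)]) auto
    then show "\<pi> (X + Y) = \<pi> X + \<pi> Y"
      by (intro poly_mapping_eqI) (simp add: lookup lookup_add)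
  next
    fix c X assume "X \<in> ?n"
    then have "gl7.representation B (mat_scale c X) = (\<lambda>b. c * gl7.representation B X b)"
      using nB by (intro gl7.representation_scale[OF B(3)]) auto
    then show "\<pi> (mat_scale c X) = pm_scale c (\<pi> X)"
      by (intro poly_mapping_eqI) (simp add: lookup lookup_pm_scale)
  qed
  have \<pi>bb: "\<pi> (bb j) = Poly_Mapping.single j 1" if "j < r" for j
  proof (rule poly_mapping_eqI)
    fix j'
    have "bb j \<in> B" using bbC[OF that] by (simp add: C_def)
    then have "gl7.representation B (bb j) (bb j') = (if bb j' = bb j then 1 else 0)"
      using gl7.representation_basis[OF B(3)] by simp
    moreover have "bb j' = bb j \<longleftrightarrow> j' = j" if "j' < r"
      using bb that \<open>j < r\<close> unfolding bij_betw_def inj_on_def by auto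
    ultimately show "Poly_Mapping.lookup (\<pi> (bb j)) j' = Poly_Mapping.lookup (Poly_Mapping.single j 1) j'"
      using that by (auto simp: lookup lookup_single when_def)
  qed
  have image: "\<pi> ` ?n = coord r"
  proof (intro equalityI subsetI)
    fix v assume "v \<in> \<pi> ` ?n"
    then show "v \<in> coord r" by (auto simp: coord_def in_keys_iff lookup split: if_splits)
  next
    fix v assume v: "v \<in> coord r"
    let ?X = "\<Sum>j<r. mat_scale (Poly_Mapping.lookup v j) (bb j)"
    have X: "?X \<in> ?n" using bbn by (intro gl7.subspace_sum[OF graded_subspace] gl7.subspace_scale[OF graded_subspace]) auto
    have "\<pi> ?X = (\<Sum>j<r. pm_scale (Poly_Mapping.lookup v j) (\<pi> (bb j)))"
      by (rule linear_on_sum[OF gl7.vector_space_axioms pm.vector_space_axioms graded_subspace lin]) (use bbn in auto)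
    also have "\<dots> = (\<Sum>j<r. pm_scale (Poly_Mapping.lookup v j) (Poly_Mapping.single j 1))"
      by (simp add: \<pi>bb)
    also have "\<dots> = lin_ext (\<lambda>j. Poly_Mapping.single j 1) v"
      using v by (intro lin_ext_superset[symmetric]) (auto simp: coord_def)
    also have "\<dots> = v" by (rule lin_eq_on[OF lin_lin_ext lin_id]) simp
    finally show "v \<in> \<pi> ` ?n" using X by (intro image_eqI[of _ _ ?X]) auto
  qed
  have kernel: "{y\<in>?n. \<pi> y = 0} = N"
  proof (intro equalityI subsetI)
    fix X assume "X \<in> {y\<in>?n. \<pi> y = 0}"
    then have X: "X \<in> gl7.span B" "\<pi> X = 0" using nB by auto
    have zero: "gl7.representation B X c = 0" if "c \<in> C" for c
    proof -
      obtain j where j: "j < r" "c = bb j" using bb \<open>c \<in> C\<close> by (auto simp: bij_betw_def)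
      then show ?thesis using lookup[of X j] X(2) by (simp add: lookup_zero)
    qed
    have "X = (\<Sum>b | gl7.representation B X b \<noteq> 0. mat_scale (gl7.representation B X b) b)"
      using gl7.sum_nonzero_representation_eq[OF B(3) X(1)] by simp
    also have "\<dots> \<in> gl7.span BN"
    proof (intro gl7.span_sum gl7.span_scale gl7.span_base)
      fix b assume "b \<in> {b. gl7.representation B X b \<noteq> 0}"
      then show "b \<in> BN" using zero gl7.representation_ne_zero[of B X b] by (auto simp: C_def)
    qed
    finally show "X \<in> N" using spanBN by simp
  next
    fix X assume X: "X \<in> N"
    then have "gl7.representation B X = gl7.representation BN X"
      using spanBN gl7.representation_extend[OF B(3) _ B(1)] by simp
    then have "gl7.representation B X (bb j) = 0" if "j < r" for j
      using bbC[OF that] gl7.representation_ne_zero[of BN X "bb j"] by (auto simp: C_def)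
    then have "\<pi> X = 0" by (intro poly_mapping_eqI) (simp add: lookup lookup_zero)
    then show "X \<in> {y\<in>?n. \<pi> y = 0}" using X N(2) by auto
  qed
  have "r \<noteq> 0"
  proof
    assume "r = 0"
    then have "B = BN" using B(1) C(2) by (auto simp: r_def C_def)
    then show False using nB spanBN N(2,3) by auto
  qed
  then show ?thesis
    using that[of r kk ll \<pi>] kl lin image kernel \<pi>bb by (metis gr0I)
qed

lemma trivial_module:
  assumes "gl7.subspace L"
  shows "gl7.highest_weight_module G K B L (\<lambda>_. 0) 1 (\<lambda>x v. 0)"
proof -
  have coord1: "W = {0} \<or> W = coord 1" if W: "pm.subspace W" "W \<subseteq> coord 1" for W
  proof (rule disjCI)
    assume "W \<noteq> coord 1"
    show "W = {0}"
    proof (rule ccontr)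
      assume "W \<noteq> {0}"
      then obtain v where v: "v \<in> W" "v \<noteq> 0" using pm.subspace_0[OF W(1)] by blast
      have lookup: "Poly_Mapping.lookup u j = 0" if "u \<in> coord 1" "j \<noteq> 0" for u j
        using that by (auto simp: coord_def in_keys_iff)
      have "v \<in> coord 1" using v W by auto
      then have "Poly_Mapping.lookup v 0 \<noteq> 0"
        using v(2) lookup by (metis lookup_zero poly_mapping_eqI)
      have "u \<in> W" if u: "u \<in> coord 1" for u
      proof -
        have "u = pm_scale (Poly_Mapping.lookup u 0 / Poly_Mapping.lookup v 0) v"
        proof (rule poly_mapping_eqI)
          fix j
          show "Poly_Mapping.lookup u j = Poly_Mapping.lookup (pm_scale (Poly_Mapping.lookup u 0 / Poly_Mapping.lookup v 0) v) j"
            using lookup[OF u, of j] lookup[OF \<open>v \<in> coord 1\<close>, of j] \<open>Poly_Mapping.lookup v 0 \<noteq> 0\<close>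
            by (cases "j = 0") (simp_all add: lookup_pm_scale)
        qed
        then show ?thesis using pm.subspace_scale[OF W(1) v(1)] by metis
      qed
      then show False using \<open>W \<noteq> coord 1\<close> W(2) by auto
    qed
  qed
  have zero: "0 \<in> coord 1" by (rule pm.subspace_0[OF coord_subspace])
  have "gl7.fd_module L 1 (\<lambda>x v. 0)"
    unfolding gl7.fd_module_def linear_on_def using zero by auto
  moreover have "Poly_Mapping.single 0 1 \<in> coord 1" by (simp add: coord_def)
  moreover have "Poly_Mapping.single 0 (1::complex) \<noteq> (0 :: nat \<Rightarrow>\<^sub>0 complex)"
    by (metis lookup_single_eq lookup_zero zero_neq_one)
  ultimately show ?thesis
    unfolding gl7.highest_weight_module_def gl7.irreducible_module_def
    using coord1 by (intro conjI bexI[of _ "Poly_Mapping.single 0 1"]) auto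
qed

section \<open>Finiteness and infinitude of the set of highest weights\<close>

context G2_in_so7
begin

text \<open>By irreducibility of its source a nonzero homomorphism is injective, so it maps the
  highest weight vector to a nonzero eigenvector of every \<open>actl (i x)\<close> with
  \<open>x\<close> in \<open>H\<close>, and each such operator has finitely many
  eigenvalues.\<close>

lemma finite_branching_if_zero_quotient:
  assumes p: "p = graded w (\<lambda>n. 0 \<le> n)" "antisym7 w" and N: "N = graded w (\<lambda>n. n < 0)"
  shows "finite_branching p N"
  unfolding finite_branching_def
proof (intro ballI allI impI)
  fix \<Lambda> d actl r q
  assume hw: "gl7.highest_weight_module so7 cartan7 borel7 (gl7.levi so7 cartan7 p) \<Lambda> d actl"
    and "quotient_module p N r q"
  then obtain \<pi> where \<pi>: "\<pi> ` N = coord r" "{y\<in>N. \<pi> y = 0} = N"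
    unfolding quotient_module_def opp_nilrad_graded[OF p(2,1)] N[symmetric] by blast
  \<comment> \<open>\<open>\<pi>\<close> maps \<open>N\<close> onto \<open>coord r\<close> and at
    the same time vanishes on \<open>N\<close>.\<close>
  have "r = 0"
  proof (rule ccontr)
    assume "r \<noteq> 0"
    then have "Poly_Mapping.single 0 1 \<in> coord r" by (simp add: coord_def)
    moreover have "coord r \<subseteq> {0}" using \<pi> by force
    ultimately have "Poly_Mapping.single 0 (1::complex) = (0 :: nat \<Rightarrow>\<^sub>0 complex)" by blast
    then show False by (metis lookup_single_eq lookup_zero zero_neq_one)
  qed
  define E where "E x = {c. \<exists>v\<in>coord d. v \<noteq> 0 \<and> actl (i x) v = pm_scale c v}" for x
  have lin: "linear_on pm_scale pm_scale (coord d) (actl (i x))" if "x \<in> H" for x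
  proof -
    have "i x \<in> gl7.levi so7 cartan7 p"
      unfolding gl7.levi_def using i_H_cartan7[OF that] by (intro gl7.span_base) blast
    then show ?thesis
      using hw unfolding gl7.highest_weight_module_def gl7.irreducible_module_def gl7.fd_module_def by blast
  qed
  have finE: "finite (E x)" if "x \<in> H" for x
    unfolding E_def by (rule finite_eigenvalues[OF lin[OF that]])
  let ?M = "{\<mu> \<in> dual H. \<exists>e actm. highest_weight_module UNIV H borel_bar (l_bar p) \<mu> e actm \<and>
      multiplicity p e actm d actl r q \<noteq> 0}"
  have ev: "\<mu> x \<in> E x" if \<mu>: "\<mu> \<in> ?M" and x: "x \<in> H" for \<mu> x
  proof -
    obtain e actm where em: "highest_weight_module UNIV H borel_bar (l_bar p) \<mu> e actm"
      "multiplicity p e actm d actl r q \<noteq> 0" using \<mu> by blast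
    have irr: "irreducible_module (l_bar p) e actm"
      using em(1) by (simp add: highest_weight_module_def)
    obtain v where v: "v \<in> coord e" "v \<noteq> 0" "\<forall>h\<in>H. actm h v = pm_scale (\<mu> h) v"
      using em(1) unfolding highest_weight_module_def by blast
    let ?A = "\<lambda>x. tensor_act (actl (i x)) (sym_act (q x))"
    let ?homs = "module_homs (l_bar p) (coord e) actm (coord_tensor_sym d r) ?A"
    have "\<not> ?homs \<subseteq> {0}"
      using em(2) edim_zero[OF vector_space_fun_scale] unfolding multiplicity_def by blast
    then obtain f where f: "f \<in> ?homs" "f \<noteq> 0" by blast
    then have f_lin: "linear_on pm_scale pm_scale (coord e) f" and f_im: "f ` coord e \<subseteq> coord_tensor_sym d r"
      and f_act: "\<And>x v. x \<in> l_bar p \<Longrightarrow> v \<in> coord e \<Longrightarrow> f (actm x v) = ?A x (f v)"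
      and f_off: "\<And>v. v \<notin> coord e \<Longrightarrow> f v = 0"
      unfolding module_homs_def by blast+
    have A0: "?A x 0 = 0" for x by (rule pmp.linear_0[OF lin_tensor_act])
    have f0: "f 0 = 0"
      by (rule linear_on_0[OF pm.vector_space_axioms pm.vector_space_axioms coord_subspace f_lin])
    let ?W = "{v\<in>coord e. f v = 0}"
    have act: "actm x v \<in> coord e" if "x \<in> l_bar p" "v \<in> coord e" for x v
      using irr that unfolding irreducible_module_def fd_module_def by blast
    have "pm.subspace ?W"
      using f_lin f0 pm.subspace_0[OF coord_subspace] pm.subspace_add[OF coord_subspace] pm.subspace_scale[OF coord_subspace]
      by (intro pm.subspaceI) (auto simp: linear_on_def)
    moreover have "\<forall>x\<in>l_bar p. actm x ` ?W \<subseteq> ?W" using act f_act A0 by auto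
    ultimately have "?W = {0} \<or> ?W = coord e"
      using irr unfolding irreducible_module_def by blast
    moreover have "?W \<noteq> coord e"
    proof
      assume "?W = coord e"
      then have "f v = 0" for v using f_off by (cases "v \<in> coord e") auto
      then show False using f(2) by (auto simp: fun_eq_iff)
    qed
    ultimately have fv: "f v \<noteq> 0" using v by blast
    have t: "f v \<in> coord_tensor_sym d 0" using f_im v(1) \<open>r = 0\<close> by auto
    note T = tensor_act_sym_trivial[OF lin[OF x] t]
    let ?P = "lin_ext (\<lambda>(k, M). Poly_Mapping.single k 1)"
    have "?A x (f v) = f (pm_scale (\<mu> x) v)" using f_act[OF subsetD[OF H_subset_l_bar x] v(1)] v(3) x by simp
    also have "\<dots> = pm_scale (\<mu> x) (f v)" using f_lin v(1) unfolding linear_on_def by blast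
    finally have "actl (i x) (?P (f v)) = pm_scale (\<mu> x) (?P (f v))"
      using T(1)[of "q x"] pmp.linear_scale[OF lin_lin_ext] by metis
    then show ?thesis unfolding E_def using T(2,3) fv by blast
  qed
  \<comment> \<open>\<open>H\<close> is spanned by \<open>h 1 0\<close> and \<open>h 0 1\<close>, so
    \<mu> is determined by two values, each taken from a finite set.\<close>
  let ?f = "\<lambda>\<mu>. (\<mu> (h 1 0), \<mu> (h 0 1))"
  have "?f ` ?M \<subseteq> E (h 1 0) \<times> E (h 0 1)" using ev h_in_H by blast
  then have "finite (?f ` ?M)" using finE h_in_H by (meson finite_SigmaI finite_subset)
  moreover have "inj_on ?f ?M"
  proof (rule inj_onI, rule ext)
    fix \<mu> \<nu> x assume \<mu>: "\<mu> \<in> ?M" and \<nu>: "\<nu> \<in> ?M" and eq: "?f \<mu> = ?f \<nu>"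
    show "\<mu> x = \<nu> x"
    proof (cases "x \<in> H")
      case True
      then obtain s t where "x = h s t" using H_iff by blast
      then have x: "x = scale s (h 1 0) + scale t (h 0 1)" by (simp add: h_def)
      have "\<kappa> x = s * \<kappa> (h 1 0) + t * \<kappa> (h 0 1)" if "\<kappa> \<in> dual H" for \<kappa>
        unfolding x using that h_in_H subspace_scale[OF H_subspace] unfolding dual_def linear_on_def by auto
      from this[of \<mu>] this[of \<nu>] show ?thesis using \<mu> \<nu> eq by simp
    qed (use \<mu> \<nu> in \<open>auto simp: dual_def\<close>)
  qed
  ultimately show "finite ?M" by (rule finite_imageD)
qed

text \<open>By \<open>mono\<close>, root vectors of negative degree have negative height. Hence
  every variable of the symmetric algebra has height at most -1, and the weights found in successive
  symmetric powers are unbounded below on \<open>h 3 5\<close>.\<close>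

lemma not_finite_branching:
  assumes p: "p = graded w (\<lambda>n. 0 \<le> n)" and w: "antisym7 w" and N: "admissible_N p N"
    and neq: "N \<noteq> graded w (\<lambda>n. n < 0)"
    and mono: "\<And>k l. ht l \<le> ht k \<Longrightarrow> w l \<le> w k"
  shows "\<not> finite_branching p N"
proof
  assume fin: "finite_branching p N"
  let ?n = "graded w (\<lambda>n. n < 0)"
  note A = admissible_N_subset[OF w p N]
  obtain r kk ll \<pi> where r: "0 < r" and kl': "\<forall>j<r. w (kk j) < w (ll j)" and
    \<pi>': "linear_on mat_scale pm_scale ?n \<pi>" "\<pi> ` ?n = coord r" "{y\<in>?n. \<pi> y = 0} = N"
    "\<forall>j<r. \<pi> (R (kk j) (ll j)) = Poly_Mapping.single j 1"
    by (rule quotient_coordinates[OF A(1,2) neq w])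
  note kl = kl'[rule_format] and \<pi> = \<pi>'(1-3) \<pi>'(4)[rule_format]
  let ?b = "\<lambda>j. R (kk j) (ll j)"
  have bn: "?b j \<in> ?n" if "j < r" for j using R_in_graded[OF w, of "\<lambda>n. n < 0"] kl[OF that] by simp
  have nst: "commutator (i x) Y \<in> ?n" if "x \<in> l_bar p" "Y \<in> ?n" for x Y
    using i_l_bar_graded[OF p that(1)] that(2) by (rule graded_commutator) simp
  note vs = gl7.vector_space_axioms pm.vector_space_axioms
  \<comment> \<open>The action is prescribed on the classes of the chosen root vectors. Basis
    vectors with index \<ge> \<open>r\<close> go to 0, which makes \<open>q x\<close> linear on the
    whole space, as the results on derivations require.\<close>
  define q where "q x = lin_ext (\<lambda>j. if j < r then \<pi> (commutator (i x) (?b j)) else 0)" for x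
  have q: "lin (q x)" for x unfolding q_def by (rule lin_lin_ext)
  have q_single: "q x (Poly_Mapping.single j 1) = (if j < r then \<pi> (commutator (i x) (?b j)) else 0)" for x j
    by (simp add: q_def)
  have q_\<pi>: "\<pi> (commutator (i x) Y) = q x (\<pi> Y)" if x: "x \<in> l_bar p" and Y: "Y \<in> ?n" for x Y
  proof -
    have \<pi>Y: "\<pi> Y \<in> coord r" using \<pi>(2) Y by blast
    \<comment> \<open>\<open>Z\<close> lifts \<open>\<pi> Y\<close> to a combination of the chosen
      root vectors. Then \<open>Y - Z\<close> lies in the stable subspace \<open>N\<close>, so the
      bracket may be computed on \<open>Z\<close>.\<close>
    define Z where "Z = (\<Sum>j<r. mat_scale (Poly_Mapping.lookup (\<pi> Y) j) (?b j))"
    have Z: "Z \<in> ?n" unfolding Z_def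
      using bn by (intro gl7.subspace_sum[OF graded_subspace] gl7.subspace_scale[OF graded_subspace]) auto
    have "\<pi> Z = (\<Sum>j<r. pm_scale (Poly_Mapping.lookup (\<pi> Y) j) (\<pi> (?b j)))"
      unfolding Z_def by (rule linear_on_sum[OF vs graded_subspace \<pi>(1)]) (use bn in auto)
    also have "\<dots> = (\<Sum>j<r. pm_scale (Poly_Mapping.lookup (\<pi> Y) j) (Poly_Mapping.single j 1))"
      by (simp add: \<pi>(4))
    also have "\<dots> = lin_ext (\<lambda>j. Poly_Mapping.single j 1) (\<pi> Y)"
      using \<pi>Y by (intro lin_ext_superset[symmetric]) (auto simp: coord_def)
    also have "\<dots> = \<pi> Y" by (rule lin_eq_on[OF lin_lin_ext lin_id]) simp
    finally have "\<pi> Z = \<pi> Y" .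
    then have "\<pi> (Y - Z) = 0" using linear_on_diff[OF vs graded_subspace \<pi>(1) Y Z] by simp
    then have "Y - Z \<in> N" using \<pi>(3) gl7.subspace_diff[OF graded_subspace Y Z] by blast
    then have "\<pi> (commutator (i x) (Y - Z)) = 0" using A(3)[OF x] \<pi>(3) by blast
    then have "\<pi> (commutator (i x) Y) = \<pi> (commutator (i x) Z)"
      using linear_on_diff[OF vs graded_subspace \<pi>(1) nst[OF x Y] nst[OF x Z]] by (simp add: commutator_diff)
    also have "commutator (i x) Z = (\<Sum>j<r. mat_scale (Poly_Mapping.lookup (\<pi> Y) j) (commutator (i x) (?b j)))"
      unfolding Z_def
      by (rule linear_on_sum[OF vs(1) vs(1) gl7.subspace_UNIV, where f = "commutator (i x)"])
        (simp_all add: linear_on_def gl7.br_add_right gl7.br_scale_right)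
    also have "\<pi> \<dots> = (\<Sum>j<r. pm_scale (Poly_Mapping.lookup (\<pi> Y) j) (\<pi> (commutator (i x) (?b j))))"
      by (rule linear_on_sum[OF vs graded_subspace \<pi>(1)]) (use nst[OF x] bn in auto)
    also have "\<dots> = q x (\<pi> Y)"
      unfolding q_def using \<pi>Y by (subst lin_ext_superset[of "{..<r}"]) (auto simp: coord_def)
    finally show ?thesis .
  qed
  have quot: "quotient_module p N r q"
    unfolding quotient_module_def opp_nilrad_graded[OF w p] using \<pi>(1-3) q_\<pi> by blast
  have q_coord: "q x (Poly_Mapping.single j 1) \<in> coord r" if "x \<in> l_bar p" "j < r" for x j
    using \<pi>(2) nst[OF that(1) bn[OF that(2)]] that(2) by (auto simp: q_single)
  have q_add: "q (x + y) = (\<lambda>v. q x v + q y v)" if x: "x \<in> l_bar p" "y \<in> l_bar p" for x y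
  proof
    fix v
    show "q (x + y) v = q x v + q y v"
    proof (rule lin_eq_on[OF q lin_plus_minus(1)[OF q q]])
      fix j
      show "q (x + y) (Poly_Mapping.single j 1) = q x (Poly_Mapping.single j 1) + q y (Poly_Mapping.single j 1)"
        using \<pi>(1) nst[OF x(1) bn] nst[OF x(2) bn] unfolding linear_on_def
        by (simp add: q_single i_simps gl7.br_add_left)
    qed
  qed
  have q_scale: "q (scale c x) = (\<lambda>v. pm_scale c (q x v))" if x: "x \<in> l_bar p" for c x
  proof
    fix v
    show "q (scale c x) v = pm_scale c (q x v)"
    proof (rule lin_eq_on[OF q lin_pm_scale[OF q]])
      fix j
      show "q (scale c x) (Poly_Mapping.single j 1) = pm_scale c (q x (Poly_Mapping.single j 1))"
        using \<pi>(1) nst[OF x(1) bn] unfolding linear_on_def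
        by (simp add: q_single i_simps gl7.br_scale_left)
    qed
  qed
  have q_br: "q (br x y) = (\<lambda>v. q x (q y v) - q y (q x v))" if x: "x \<in> l_bar p" and y: "y \<in> l_bar p" for x y
  proof
    fix v
    show "q (br x y) v = q x (q y v) - q y (q x v)"
    proof (rule lin_eq_on[OF q lin_plus_minus(2)[OF lin_comp[OF q q] lin_comp[OF q q]]])
      fix j
      show "q (br x y) (Poly_Mapping.single j 1) = q x (q y (Poly_Mapping.single j 1)) - q y (q x (Poly_Mapping.single j 1))"
      proof (cases "j < r")
        case True
        note b = nst[OF x bn[OF True]] nst[OF y bn[OF True]]
        have "q (br x y) (Poly_Mapping.single j 1) =
            \<pi> (commutator (i x) (commutator (i y) (?b j)) - commutator (i y) (commutator (i x) (?b j)))"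
          using True by (simp add: q_single i_br commutator_commutator)
        also have "\<dots> = \<pi> (commutator (i x) (commutator (i y) (?b j))) - \<pi> (commutator (i y) (commutator (i x) (?b j)))"
          by (rule linear_on_diff[OF vs graded_subspace \<pi>(1) nst[OF x b(2)] nst[OF y b(1)]])
        also have "\<dots> = q x (q y (Poly_Mapping.single j 1)) - q y (q x (Poly_Mapping.single j 1))"
          using True by (simp add: q_\<pi>[OF x b(2)] q_\<pi>[OF y b(1)] q_single)
        finally show ?thesis .
      qed (simp add: q_single pmp.linear_0[OF q])
    qed
  qed
  have q_weight: "q x (Poly_Mapping.single j 1) = pm_scale (rt (kk j) (ll j) x) (Poly_Mapping.single j 1)"
    if x: "x \<in> H" and j: "j < r" for x j
  proof -
    have "commutator (i x) (?b j) = mat_scale (rt (kk j) (ll j) x) (?b j)"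
      using R_in_root_space[of "kk j" "ll j"] i_H_cartan7[OF x] by (simp add: gl7.root_space_def root7_apply rt_def x)
    then show ?thesis using j \<pi>(1) \<pi>(4)[OF j] bn[OF j] unfolding linear_on_def by (simp add: q_single)
  qed
  let ?act = "\<lambda>(x :: complex^7^7) (v :: nat \<Rightarrow>\<^sub>0 complex). 0 :: nat \<Rightarrow>\<^sub>0 complex"
  let ?M = "{\<mu> \<in> dual H. \<exists>e actm. highest_weight_module UNIV H borel_bar (l_bar p) \<mu> e actm \<and>
      multiplicity p e actm 1 ?act r q \<noteq> 0}"
  have "(\<lambda>_. 0) \<in> gl7.dual cartan7" by (simp add: gl7.dual_def linear_on_def)
  moreover have "gl7.highest_weight_module so7 cartan7 borel7 (gl7.levi so7 cartan7 p) (\<lambda>_. 0) 1 ?act"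
    by (rule trivial_module) (simp add: gl7.levi_def gl7.subspace_span)
  ultimately have finM: "finite ?M" using fin quot unfolding finite_branching_def by blast
  define wt where "wt M x = (\<Sum>j\<in>#M. rt (kk j) (ll j) x)" for M x
  define deg where "deg M = (\<Sum>j\<in>#M. ht (kk j) - ht (ll j))" for M
  have low: "\<exists>\<mu>\<in>?M. Re (\<mu> (h 3 5)) \<le> - real n" for n
  proof -
    define K where "K = {M. set_mset M \<subseteq> {..<r} \<and> size M = n}"
    \<comment> \<open>Here \<open>r > 0\<close> enters: a nonzero quotient has nonzero symmetric
      powers of every degree.\<close>
    have "replicate_mset n 0 \<in> K" using r by (auto simp: K_def)
    then have "K \<noteq> {}" by blast
    have wt: "sym_act (q x) (Poly_Mapping.single M 1) = pm_scale (wt M x) (Poly_Mapping.single M 1)"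
      if "x \<in> H" "M \<in> K" for x M
      unfolding wt_def using q_weight[OF that(1)] that(2) by (intro sym_act_monomial_weight) (auto simp: K_def)
    have wt_deg: "wt M (h 3 5) = of_real (real_of_int (deg M))" for M
      by (induction M) (auto simp: wt_def deg_def rt_ht)
    have sym_lin: "lin (sym_act (q x))" for x by (rule lin_sym_act)
    have sym_add: "sym_act (q (x + y)) s = sym_act (q x) s + sym_act (q y) s" if "x \<in> l_bar p" "y \<in> l_bar p" for x y s
      unfolding q_add[OF that] by (rule sym_act_add)
    have sym_scale: "sym_act (q (scale c x)) s = pm_scale c (sym_act (q x) s)" if "x \<in> l_bar p" for c x s
      unfolding q_scale[OF that] by (rule sym_act_scale)
    have sym_br: "sym_act (q (br x y)) s = sym_act (q x) (sym_act (q y) s) - sym_act (q y) (sym_act (q x) s)"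
      if "x \<in> l_bar p" "y \<in> l_bar p" for x y s
      unfolding q_br[OF that] by (rule sym_act_commutator[OF q q])
    have stable: "Poly_Mapping.keys (sym_act (q x) s) \<subseteq> K" if "x \<in> l_bar p" "Poly_Mapping.keys s \<subseteq> K" for x s
      using sym_act_keys[of r "q x" s n] q_coord[OF that(1)] that(2) by (simp add: K_def)
    have "finite K" unfolding K_def by (rule finite_multisets)
    obtain M e act F where M': "M \<in> K" "highest_weight_module UNIV H borel_bar (l_bar p) (wt M) e act" "lin F"
      "inj_on F (coord e)" "\<forall>v\<in>coord e. Poly_Mapping.keys (F v) \<subseteq> K"
      "\<forall>x\<in>l_bar p. \<forall>v\<in>coord e. F (act x v) = sym_act (q x) (F v)"
      by (rule highest_weight_submodule[where \<rho> = "\<lambda>x. sym_act (q x)" and wt = wt and \<mu> = wt and deg = "\<lambda>M. real_of_int (deg M)",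
        OF l_bar_subspace sym_lin sym_add sym_scale sym_br stable \<open>finite K\<close> \<open>K \<noteq> {}\<close> H_subset_l_bar wt h_in_H
          wt_deg positive_part_of_l_bar refl])
    note M = M'(1-4) M'(5,6)[rule_format]
    have "wt M \<in> dual H"
      using rt_dual subspace_add[OF H_subspace] subspace_scale[OF H_subspace]
      by (induction M) (auto simp: wt_def dual_def linear_on_def distrib_left)
    moreover have "multiplicity p e act 1 ?act r q \<noteq> 0"
      unfolding multiplicity_def
    proof (rule edim_nonzero[OF vector_space_fun_scale])
      \<comment> \<open>\<open>?J\<close> identifies the symmetric algebra with its tensor product
        with the line \<open>coord 1\<close>; the value 0 off \<open>coord e\<close> is the
        normalisation in \<open>module_homs\<close>.\<close>
      let ?J = "lin_ext (\<lambda>M. Poly_Mapping.single (0::nat, M) (1::complex))"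
      define f where "f v = (if v \<in> coord e then ?J (F v) else 0)" for v
      have JF: "lin (\<lambda>v. ?J (F v))" by (rule lin_comp[OF lin_lin_ext M(3)])
      have act: "act x v \<in> coord e" if "x \<in> l_bar p" "v \<in> coord e" for x v
        using M(2) that unfolding highest_weight_module_def irreducible_module_def fd_module_def by blast
      show "f \<in> module_homs (l_bar p) (coord e) act (coord_tensor_sym 1 r)
          (\<lambda>x. tensor_act (?act (i x)) (sym_act (q x)))"
        unfolding module_homs_def
      proof (intro CollectI conjI ballI allI impI)
        show "linear_on pm_scale pm_scale (coord e) f"
          using pm.subspace_add[OF coord_subspace, of _ e] pm.subspace_scale[OF coord_subspace, of _ e]
          by (auto simp: linear_on_def f_def pmp.linear_add[OF JF] pmp.linear_scale[OF JF])
        show "f ` coord e \<subseteq> coord_tensor_sym 1 r"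
        proof (intro image_subsetI)
          fix v assume v: "v \<in> coord e"
          have "Poly_Mapping.keys (?J (F v)) \<subseteq> {..<1} \<times> {M. set_mset M \<subseteq> {..<r}}"
          proof (rule keys_lin_subset[OF lin_lin_ext])
            fix M' assume "M' \<in> Poly_Mapping.keys (F v)"
            then have "M' \<in> K" using M(5)[OF v] by blast
            then show "Poly_Mapping.keys (?J (Poly_Mapping.single M' 1)) \<subseteq> {..<1} \<times> {M. set_mset M \<subseteq> {..<r}}"
              by (simp add: K_def)
          qed
          then show "f v \<in> coord_tensor_sym 1 r" using v by (simp add: f_def coord_tensor_sym_def)
        qed
        fix x v assume x: "x \<in> l_bar p" and v: "v \<in> coord e"
        show "f (act x v) = tensor_act (?act (i x)) (sym_act (q x)) (f v)"
          using act[OF x v] v by (simp add: f_def M(6)[OF x v] tensor_act_zero_left[OF lin_sym_act])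
      qed (simp add: f_def)
      show "f \<noteq> 0"
      proof
        assume "f = 0"
        have "e \<noteq> 0" using M(2) unfolding highest_weight_module_def irreducible_module_def by blast
        then have e: "Poly_Mapping.single 0 1 \<in> coord e" by (simp add: coord_def)
        let ?s = "F (Poly_Mapping.single 0 1)"
        \<comment> \<open>Forgetting the index of the line is a left inverse of \<open>?J\<close>,
          so a vanishing \<open>f\<close> contradicts the injectivity of \<open>F\<close>.\<close>
        have "lin_ext (\<lambda>(k, M). Poly_Mapping.single M 1) (?J ?s) = ?s"
          by (rule lin_eq_on[OF lin_comp[OF lin_lin_ext lin_lin_ext] lin_id]) simp
        moreover have "f (Poly_Mapping.single 0 1) = 0" using \<open>f = 0\<close> by simp
        then have "?J ?s = 0" using e by (simp add: f_def)
        ultimately have "?s = F 0" by (metis lin_ext_0 pmp.linear_0[OF M(3)])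
        then have "Poly_Mapping.single 0 (1::complex) = (0 :: nat \<Rightarrow>\<^sub>0 complex)"
          using M(4) e pm.subspace_0[OF coord_subspace] by (auto dest: inj_onD)
        then show False by (metis lookup_single_eq lookup_zero zero_neq_one)
      qed
    qed
    ultimately have "wt M \<in> ?M" using M(2) by blast
    moreover have "deg M \<le> - int n"
    proof -
      have "deg M \<le> - int (size M)" if "set_mset M \<subseteq> {..<r}" for M
        using that
      proof (induction M)
        case (add j M)
        then have "\<not> w (ll j) \<le> w (kk j)" using kl[of j] by auto
        \<comment> \<open>Contrapositive of \<open>mono\<close>: smaller degree means smaller
          height, and heights are integers.\<close>
        then have "ht (kk j) - ht (ll j) \<le> - 1" using mono[of "ll j" "kk j"] by linarith
        then show ?case using add by (simp add: deg_def)
      qed (simp add: deg_def)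
      then show ?thesis using M(1) by (auto simp: K_def)
    qed
    then have "Re (wt M (h 3 5)) \<le> - real n" unfolding wt_deg by simp
    ultimately show ?thesis by blast
  qed
  obtain \<mu>0 where "\<mu>0 \<in> ?M" using low[of 0] by blast
  define m where "m = Min ((\<lambda>\<mu>. Re (\<mu> (h 3 5))) ` ?M)"
  have m: "m \<le> Re (\<mu> (h 3 5))" if "\<mu> \<in> ?M" for \<mu>
    unfolding m_def using finM that by (intro Min_le) auto
  obtain n where "- m < real n" using reals_Archimedean2 by blast
  then show False using low[of n] m by fastforce
qed

end

theorem corollary5p4:
  fixes scale :: "complex \<Rightarrow> 'b::ab_group_add \<Rightarrow> 'b"
    and br :: "'b \<Rightarrow> 'b \<Rightarrow> 'b"
    and H :: "'b set"
    and \<alpha> :: "nat \<Rightarrow> 'b \<Rightarrow> complex"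
    and gb :: "int \<Rightarrow> 'b"
    and g :: "int \<Rightarrow> complex^7^7"
    and i :: "'b \<Rightarrow> complex^7^7"
    and p N :: "(complex^7^7) set"
  assumes "G2_in_so7 scale br H \<alpha> gb g i"
    and "parabolic7 p"
    and "G2_in_so7.admissible_N scale br H i p N"
  shows "(G2_in_so7.finite_branching scale br H \<alpha> i p N \<longleftrightarrow>
            p = std_parabolic7 1 0 0 \<or> p = std_parabolic7 0 0 0) \<and>
         std_parabolic7 0 0 0 = so7"
proof -
  interpret G2_in_so7 scale br H \<alpha> gb g i by fact
  have N: "admissible_N p N" by fact
  obtain a b c where abc: "a \<le> 1" "b \<le> 1" "c \<le> 1" "p = par a b c"
    by (rule parabolic7_cases[OF assms(2)])
  let ?w = "parabolic_degree a b c"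
  note w = antisym7_parabolic_degree[of a b c]
  note A = admissible_N_subset[OF w abc(4) N]
  have std: "std_parabolic7 1 0 0 = par 1 0 0" "std_parabolic7 0 0 0 = par 0 0 0"
    by (simp_all add: std_parabolic7_par)
  have "finite_branching p N \<longleftrightarrow> b = 0 \<and> c = 0"
  proof
    assume fin: "finite_branching p N"
    show "b = 0 \<and> c = 0"
    proof (rule ccontr)
      assume "\<not> (b = 0 \<and> c = 0)"
      \<comment> \<open>The two degrees are -(a + b + c) and -(b + 2c), negative as soon as
        \<open>b\<close> or \<open>c\<close> is positive.\<close>
      then have "?w 4 - ?w 1 < 0" "?w 5 - ?w 2 < 0" by (auto simp: parabolic_degree_def)
      then have "R 4 1 \<in> graded ?w (\<lambda>n. n < 0)" "R 5 2 \<in> graded ?w (\<lambda>n. n < 0)"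
        by (auto intro: R_in_graded[OF w])
      then have "N \<noteq> graded ?w (\<lambda>n. n < 0)"
        using R_4_1_R_5_2_not_both_in_N[OF w abc(4) N] by blast
      from not_finite_branching[OF abc(4) w N this parabolic_degree_mono] fin show False by blast
    qed
  next
    assume bc: "b = 0 \<and> c = 0"
    have "N = graded ?w (\<lambda>n. n < 0)"
    proof (cases "a = 0")
      case True
      \<comment> \<open>Here \<open>p\<close> is all of so(7): every degree vanishes and the
        opposite nilradical is zero.\<close>
      then have "?w = (\<lambda>_. 0)" using bc by (auto simp: parabolic_degree_def wvec_def fun_eq_iff)
      then have "graded ?w (\<lambda>n. n < 0) = {0}"
        using gl7.subspace_0[OF so7_subspace] by (auto simp: graded_def vec_eq_iff)
      then show ?thesis using A(2) gl7.subspace_0[OF A(1)] by auto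
    next
      case False
      then have "a = 1" using abc(1) by simp
      then show ?thesis using N_par_1_0_0 N bc abc(4) by simp
    qed
    then show "finite_branching p N" by (rule finite_branching_if_zero_quotient[OF abc(4) w])
  qed
  also have "\<dots> \<longleftrightarrow> p = par 1 0 0 \<or> p = par 0 0 0"
  proof
    assume "b = 0 \<and> c = 0"
    moreover have "a = 0 \<or> a = 1" using abc(1) by linarith
    ultimately show "p = par 1 0 0 \<or> p = par 0 0 0" unfolding abc(4) by metis
  next
    \<comment> \<open>The degrees are recovered from the subalgebra itself, by whether it contains
      the root vectors \<open>R 3 2\<close> and \<open>R 4 3\<close> of the negatives of
      \<open>eta 2\<close> and \<open>eta 3\<close>.\<close>
    have "b' = b \<and> c' = c" if "par a' b' c' = p" "a' \<le> 1" "b' \<le> 1" "c' \<le> 1" for a' b' c'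
    proof -
      have "R 3 2 \<in> par a' b' c' \<longleftrightarrow> R 3 2 \<in> par a b c" "R 4 3 \<in> par a' b' c' \<longleftrightarrow> R 4 3 \<in> par a b c"
        using that(1) abc(4) by simp_all
      then have "0 \<le> - int b' \<longleftrightarrow> 0 \<le> - int b" "0 \<le> - int c' \<longleftrightarrow> 0 \<le> - int c"
        by (simp_all add: R_in_graded_iff antisym7_parabolic_degree) (simp_all add: parabolic_degree_def)
      then show ?thesis using that(2-4) abc(1-3) by linarith
    qed
    from this[of 1 0 0] this[of 0 0 0]
    show "b = 0 \<and> c = 0" if "p = par 1 0 0 \<or> p = par 0 0 0" using that by auto
  qed
  finally show ?thesis by (simp only: std par_0_0_0) 
qed

end
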